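(* Let $m\ge1$. Either let $X=B$, $n\ge3$, $L:=L_{B_n}(m\omega_n)$ and $V$ the irreducible $\mathfrak g(B_n)$-module of highest weight $m\omega_n$; or let $X=D$, $n\ge4$, $L$ one of $L_{D_n}(m\omega_{n-1})$, $L_{D_n}(m\omega_n)$ and $V$ the irreducible $\mathfrak g(D_n)$-module of highest weight $m\omega_{n-1}$, respectively $m\omega_n$. Let $\mathfrak g_k$ ($1\le k\le n-1$) be the Levi subalgebra generated by $x_j,y_j,h_j$, $1\le j\le k$ (so $\mathfrak g_1\subset\dots\subset\mathfrak g_{n-1}\subset\mathfrak g(X_n)$ with $\mathfrak g_k\cong\mathfrak g(A_k)$). Then $L$ (which is the supporting graph of some weight basis of $V$) is a solitary and edge-minimal supporting graph for $V$; and a weight basis of $V$ restricts irreducibly for this chain of Levi subalgebras if and only if its supporting graph is isomorphic to $L$ as an edge-colored directed graph.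
   Context: Bourbaki numbering: $B_n$ is the chain $1-\dots-n$ with node $n$ short; $D_n$ has chain $1-\dots-(n-2)$ with node $n-2$ joined to both $n-1$ and $n$. $x_i,y_i,h_i$ are Chevalley generators; $\omega_i$ fundamental weights. $L_{B_n}(m\omega_n)$: arrays $(c_{i,j})_{1\le j\le i\le n}$ of nonnegative integers with $c_{n,n}\le m$ and $c_{i+1,j}\le c_{i,j}\le c_{i+1,j+1}$ ($1\le j\le i\le n-1$), ordered componentwise; a covering $\mathbf s\to\mathbf t$ differing only at position $(i,j)$ by $+1$ has color $i$. $L_{D_n}(m\omega_{n-1})$: arrays of nonnegative integers $c_{p,q}$ indexed by $\{(p,q):1\le q\le p\le n-2\}\cup\{(n-1,q):1\le q\le\lceil(n-1)/2\rceil\}\cup\{(n,q):1\le q\le\lfloor(n-1)/2\rfloor\}$ such that, with $g_{p,q}:=c_{p,q}$ ($p\le n-2$), $g_{n-1,q}:=c_{n-1,(q+1)/2}$ ($q$ odd), $g_{n-1,q}:=c_{n,q/2}$ ($q$ even), one has $g_{p+1,q}\le g_{p,q}\le g_{p+1,q+1}$ for $1\le q\le p\le n-2$ and $g_{n-1,n-1}\le m$; ordered componentwise, the covering differing at $(i,j')$ by $+1$ has color $i\in\{1,\dots,n\}$. $L_{D_n}(m\omega_n)$ is the same poset with colors $n-1$ and $n$ interchanged. Supporting graph of a weight basis $\{v_r\}_{r\in R}$: the digraph on $R$ with an edge $s\xrightarrow{i}t$ iff $x_i.v_s$ has nonzero $v_t$-coefficient or $y_i.v_t$ has nonzero $v_s$-coefficient.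 It is solitary if every weight basis $\{w_r\}$ of $V$ with the same supporting graph satisfies $w_r=a_rv_r$ for nonzero scalars $a_r$; edge-minimal if no supporting graph of $V$ is isomorphic (as edge-colored digraph) to a graph obtained from $R$ by deleting at least one edge. A weight basis with supporting graph $R$ restricts irreducibly for $\mathfrak g_1\subset\dots\subset\mathfrak g_{n-1}\subset\mathfrak g$ if for each $k$ and each $r\in R$, the span of $\{v_u: u$ in the $\{1,\dots,k\}$-component of $r\}$ (elements reachable from $r$ by undirected paths using colors in $\{1,\dots,k\}$) is an irreducible $\mathfrak g_k$-module. *)

theory Defs
  imports Complex_Main
begin

section \<open>Cartan data (Bourbaki numbering)\<close>

datatype lie_type = TypeB | TypeD

text \<open>cartan X n i j is alpha_j(h_i) for the simple Lie algebra of type X_n (indices 1..n).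
  Type B_n: chain 1-...-n, node n short. Type D_n: chain 1-...-(n-1), plus edge (n-2)-n.\<close>
definition cartan :: "lie_type \<Rightarrow> nat \<Rightarrow> nat \<Rightarrow> nat \<Rightarrow> int" where
  "cartan X n i j =
     (if i = j then 2
      else (case X of
        TypeB \<Rightarrow> (if i = n \<and> j = n - 1 then -2
                  else if i + 1 = j \<or> j + 1 = i then -1 else 0)
      | TypeD \<Rightarrow> (if {i, j} = {n - 2, n} then -1
                  else if (i + 1 = j \<and> j \<le> n - 1) \<or> (j + 1 = i \<and> i \<le> n - 1) then -1
                  else 0)))"

definition comm_op :: "('v::ab_group_add \<Rightarrow> 'v) \<Rightarrow> ('v \<Rightarrow> 'v) \<Rightarrow> ('v \<Rightarrow> 'v)" where
  "comm_op A B = (\<lambda>v. A (B v) - B (A v))"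

text \<open>A finite-dimensional complex vector space 'v (scalar multiplication sc) together with
  operators x i, y i, h i (i = 1..n) satisfying the Chevalley--Serre relations of type X_n,
  i.e. (by Serre's theorem) a finite-dimensional g(X_n)-module.\<close>
definition is_rep ::
  "(complex \<Rightarrow> 'v::ab_group_add \<Rightarrow> 'v) \<Rightarrow> lie_type \<Rightarrow> nat \<Rightarrow>
   (nat \<Rightarrow> 'v \<Rightarrow> 'v) \<Rightarrow> (nat \<Rightarrow> 'v \<Rightarrow> 'v) \<Rightarrow> (nat \<Rightarrow> 'v \<Rightarrow> 'v) \<Rightarrow> bool" where
  "is_rep sc X n x y h \<longleftrightarrow>
     vector_space sc \<and>
     (\<exists>S. finite S \<and> module.span sc S = UNIV) \<and>
     (\<forall>i\<in>{1..n}. Vector_Spaces.linear sc sc (x i) \<and> Vector_Spaces.linear sc sc (y i)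
                  \<and> Vector_Spaces.linear sc sc (h i)) \<and>
     (\<forall>i\<in>{1..n}. \<forall>j\<in>{1..n}.
        comm_op (h i) (h j) = (\<lambda>v. 0) \<and>
        comm_op (h i) (x j) = (\<lambda>v. sc (of_int (cartan X n i j)) (x j v)) \<and>
        comm_op (h i) (y j) = (\<lambda>v. sc (- of_int (cartan X n i j)) (y j v)) \<and>
        comm_op (x i) (y j) = (if i = j then h i else (\<lambda>v. 0)) \<and>
        (i \<noteq> j \<longrightarrow>
           ((comm_op (x i)) ^^ nat (1 - cartan X n i j)) (x j) = (\<lambda>v. 0) \<and>
           ((comm_op (y i)) ^^ nat (1 - cartan X n i j)) (y j) = (\<lambda>v. 0)))"

definition invariant_under ::
  "nat set \<Rightarrow> (nat \<Rightarrow> 'v \<Rightarrow> 'v) \<Rightarrow> (nat \<Rightarrow> 'v \<Rightarrow> 'v) \<Rightarrow> (nat \<Rightarrow> 'v \<Rightarrow> 'v) \<Rightarrow> 'v set \<Rightarrow> bool" where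
  "invariant_under J x y h W \<longleftrightarrow> (\<forall>j\<in>J. x j ` W \<subseteq> W \<and> y j ` W \<subseteq> W \<and> h j ` W \<subseteq> W)"

definition irreducible_sub ::
  "(complex \<Rightarrow> 'v::ab_group_add \<Rightarrow> 'v) \<Rightarrow> nat set \<Rightarrow>
   (nat \<Rightarrow> 'v \<Rightarrow> 'v) \<Rightarrow> (nat \<Rightarrow> 'v \<Rightarrow> 'v) \<Rightarrow> (nat \<Rightarrow> 'v \<Rightarrow> 'v) \<Rightarrow> 'v set \<Rightarrow> bool" where
  "irreducible_sub sc J x y h W \<longleftrightarrow>
     module.subspace sc W \<and> invariant_under J x y h W \<and> W \<noteq> {0} \<and>
     (\<forall>U. module.subspace sc U \<and> U \<subseteq> W \<and> invariant_under J x y h U \<longrightarrow> U = {0} \<or> U = W)"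

definition irr_highest_weight ::
  "(complex \<Rightarrow> 'v::ab_group_add \<Rightarrow> 'v) \<Rightarrow> lie_type \<Rightarrow> nat \<Rightarrow>
   (nat \<Rightarrow> 'v \<Rightarrow> 'v) \<Rightarrow> (nat \<Rightarrow> 'v \<Rightarrow> 'v) \<Rightarrow> (nat \<Rightarrow> 'v \<Rightarrow> 'v) \<Rightarrow> (nat \<Rightarrow> int) \<Rightarrow> bool" where
  "irr_highest_weight sc X n x y h lam \<longleftrightarrow>
     is_rep sc X n x y h \<and>
     irreducible_sub sc {1..n} x y h UNIV \<and>
     (\<exists>v. v \<noteq> 0 \<and> (\<forall>i\<in>{1..n}. x i v = 0 \<and> h i v = sc (of_int (lam i)) v))"

text \<open>Fundamental weight omega_k, as the function i \<mapsto> omega_k(h_i).\<close>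
definition fund_weight :: "nat \<Rightarrow> nat \<Rightarrow> int" where
  "fund_weight k i = (if i = k then 1 else 0)"

text \<open>Edge-colored digraphs: vertex set and set of edges (s, colour, t).\<close>
type_synonym 'a cgraph = "'a set \<times> ('a \<times> nat \<times> 'a) set"

definition cgraph_iso :: "'a cgraph \<Rightarrow> 'b cgraph \<Rightarrow> bool" where
  "cgraph_iso G G' \<longleftrightarrow>
     (\<exists>f. bij_betw f (fst G) (fst G') \<and>
          (\<forall>s\<in>fst G. \<forall>t\<in>fst G. \<forall>i. (s, i, t) \<in> snd G \<longleftrightarrow> (f s, i, f t) \<in> snd G'))"

definition weight_basis ::
  "(complex \<Rightarrow> 'v::ab_group_add \<Rightarrow> 'v) \<Rightarrow> nat \<Rightarrow> (nat \<Rightarrow> 'v \<Rightarrow> 'v) \<Rightarrow> 'r set \<Rightarrow> ('r \<Rightarrow> 'v) \<Rightarrow> bool" where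
  "weight_basis sc n h R v \<longleftrightarrow>
     inj_on v R \<and> \<not> module.dependent sc (v ` R) \<and> module.span sc (v ` R) = UNIV \<and>
     (\<forall>r\<in>R. \<forall>i\<in>{1..n}. \<exists>c. h i (v r) = sc c (v r))"

definition coeff_in :: "(complex \<Rightarrow> 'v::ab_group_add \<Rightarrow> 'v) \<Rightarrow> 'r set \<Rightarrow> ('r \<Rightarrow> 'v) \<Rightarrow> 'v \<Rightarrow> 'r \<Rightarrow> complex" where
  "coeff_in sc R v w t = module.representation sc (v ` R) w (v t)"

definition supp_edges ::
  "(complex \<Rightarrow> 'v::ab_group_add \<Rightarrow> 'v) \<Rightarrow> nat \<Rightarrow> (nat \<Rightarrow> 'v \<Rightarrow> 'v) \<Rightarrow> (nat \<Rightarrow> 'v \<Rightarrow> 'v) \<Rightarrow>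
   'r set \<Rightarrow> ('r \<Rightarrow> 'v) \<Rightarrow> ('r \<times> nat \<times> 'r) set" where
  "supp_edges sc n x y R v =
     {(s, i, t). s \<in> R \<and> t \<in> R \<and> i \<in> {1..n} \<and>
        (coeff_in sc R v (x i (v s)) t \<noteq> 0 \<or> coeff_in sc R v (y i (v t)) s \<noteq> 0)}"

definition supp_graph ::
  "(complex \<Rightarrow> 'v::ab_group_add \<Rightarrow> 'v) \<Rightarrow> nat \<Rightarrow> (nat \<Rightarrow> 'v \<Rightarrow> 'v) \<Rightarrow> (nat \<Rightarrow> 'v \<Rightarrow> 'v) \<Rightarrow>
   'r set \<Rightarrow> ('r \<Rightarrow> 'v) \<Rightarrow> 'r cgraph" where
  "supp_graph sc n x y R v = (R, supp_edges sc n x y R v)"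

definition solitary ::
  "(complex \<Rightarrow> 'v::ab_group_add \<Rightarrow> 'v) \<Rightarrow> nat \<Rightarrow> (nat \<Rightarrow> 'v \<Rightarrow> 'v) \<Rightarrow> (nat \<Rightarrow> 'v \<Rightarrow> 'v) \<Rightarrow>
   (nat \<Rightarrow> 'v \<Rightarrow> 'v) \<Rightarrow> 'r set \<Rightarrow> ('r \<Rightarrow> 'v) \<Rightarrow> bool" where
  "solitary sc n x y h R v \<longleftrightarrow>
     (\<forall>w. weight_basis sc n h R w \<and> supp_edges sc n x y R w = supp_edges sc n x y R v \<longrightarrow>
          (\<forall>r\<in>R. \<exists>a. a \<noteq> 0 \<and> w r = sc a (v r)))"

definition edge_minimal ::
  "'q itself \<Rightarrow> (complex \<Rightarrow> 'v::ab_group_add \<Rightarrow> 'v) \<Rightarrow> nat \<Rightarrow> (nat \<Rightarrow> 'v \<Rightarrow> 'v) \<Rightarrow> (nat \<Rightarrow> 'v \<Rightarrow> 'v) \<Rightarrow>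
   (nat \<Rightarrow> 'v \<Rightarrow> 'v) \<Rightarrow> 'r set \<Rightarrow> ('r \<Rightarrow> 'v) \<Rightarrow> bool" where
  "edge_minimal (_::'q itself) sc n x y h R v \<longleftrightarrow>
     \<not> (\<exists>(R'::'q set) w D. weight_basis sc n h R' w \<and>
          D \<subseteq> supp_edges sc n x y R v \<and> D \<noteq> {} \<and>
          cgraph_iso (supp_graph sc n x y R' w) (R, supp_edges sc n x y R v - D))"

definition component :: "nat \<Rightarrow> ('r \<times> nat \<times> 'r) set \<Rightarrow> 'r \<Rightarrow> 'r set" where
  "component k E r = {u. (r, u) \<in> ({(s, t). \<exists>i\<in>{1..k}. (s, i, t) \<in> E \<or> (t, i, s) \<in> E})\<^sup>*}"

definition restricts_irreducibly ::
  "(complex \<Rightarrow> 'v::ab_group_add \<Rightarrow> 'v) \<Rightarrow> nat \<Rightarrow> (nat \<Rightarrow> 'v \<Rightarrow> 'v) \<Rightarrow> (nat \<Rightarrow> 'v \<Rightarrow> 'v) \<Rightarrow>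
   (nat \<Rightarrow> 'v \<Rightarrow> 'v) \<Rightarrow> 'r set \<Rightarrow> ('r \<Rightarrow> 'v) \<Rightarrow> bool" where
  "restricts_irreducibly sc n x y h R v \<longleftrightarrow>
     (\<forall>k\<in>{1..n-1}. \<forall>r\<in>R.
        irreducible_sub sc {1..k} x y h
          (module.span sc (v ` component k (supp_edges sc n x y R v) r)))"

text \<open>Arrays are functions on index pairs, zero outside the index set.\<close>
type_synonym array = "nat \<times> nat \<Rightarrow> nat"

definition idxB :: "nat \<Rightarrow> (nat \<times> nat) set" where
  "idxB n = {(i, j). 1 \<le> j \<and> j \<le> i \<and> i \<le> n}"

definition vertsB :: "nat \<Rightarrow> nat \<Rightarrow> array set" where
  "vertsB n m = {c. (\<forall>p. p \<notin> idxB n \<longrightarrow> c p = 0) \<and> c (n, n) \<le> m \<and>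
      (\<forall>i j. 1 \<le> j \<and> j \<le> i \<and> i \<le> n - 1 \<longrightarrow>
          c (i + 1, j) \<le> c (i, j) \<and> c (i, j) \<le> c (i + 1, j + 1))}"

definition cover_edges :: "array set \<Rightarrow> (nat \<times> nat) set \<Rightarrow> (nat \<Rightarrow> nat) \<Rightarrow> (array \<times> nat \<times> array) set" where
  "cover_edges A I col = {(s, c, t). s \<in> A \<and> t \<in> A \<and>
      (\<exists>i j. (i, j) \<in> I \<and> t = s((i, j) := s (i, j) + 1) \<and> c = col i)}"

definition LB :: "nat \<Rightarrow> nat \<Rightarrow> array cgraph" where
  "LB n m = (vertsB n m, cover_edges (vertsB n m) (idxB n) id)"

definition idxD :: "nat \<Rightarrow> (nat \<times> nat) set" where
  "idxD n = {(p, q). 1 \<le> q \<and> q \<le> p \<and> p \<le> n - 2}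
          \<union> {(p, q). p = n - 1 \<and> 1 \<le> q \<and> q \<le> (n - 1 + 1) div 2}
          \<union> {(p, q). p = n \<and> 1 \<le> q \<and> q \<le> (n - 1) div 2}"

definition gD :: "nat \<Rightarrow> array \<Rightarrow> nat \<times> nat \<Rightarrow> nat" where
  "gD n c = (\<lambda>(p, q). if p \<le> n - 2 then c (p, q)
                      else if odd q then c (n - 1, (q + 1) div 2) else c (n, q div 2))"

definition vertsD :: "nat \<Rightarrow> nat \<Rightarrow> array set" where
  "vertsD n m = {c. (\<forall>p. p \<notin> idxD n \<longrightarrow> c p = 0) \<and> gD n c (n - 1, n - 1) \<le> m \<and>
      (\<forall>p q. 1 \<le> q \<and> q \<le> p \<and> p \<le> n - 2 \<longrightarrow>
          gD n c (p + 1, q) \<le> gD n c (p, q) \<and> gD n c (p, q) \<le> gD n c (p + 1, q + 1))}"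

definition LD1 :: "nat \<Rightarrow> nat \<Rightarrow> array cgraph" where
  "LD1 n m = (vertsD n m, cover_edges (vertsD n m) (idxD n) id)"

definition LD2 :: "nat \<Rightarrow> nat \<Rightarrow> array cgraph" where
  "LD2 n m = (vertsD n m, cover_edges (vertsD n m) (idxD n)
                (\<lambda>i. if i = n - 1 then n else if i = n then n - 1 else i))"

end

theory Submission
  imports Defs "HOL-Computational_Algebra.Polynomial" "HOL-Library.Function_Algebras"
begin

text \<open>Write N for the number of rows of the triangular arrays (N = n for B, N = n - 1 for D). Restricted to the
  Levi subalgebra of type A of rank N - 1 together with the Cartan subalgebra, V is multiplicity free with
  constituents indexed by the top rows, so V has a Gelfand-Tsetlin basis indexed by the arrays. In type D the
  entries of the top row carry two colors according to the parity of their position; identifying these colors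
  gives type B.

  Existence: one writes down rational Gelfand-Tsetlin coefficients. The relation [x i, y j] = 0 off the diagonal
  is a pairwise identity between factors, and [x i, y i] = h i is a Lagrange interpolation identity. The submodule
  of V \<times> M (with M the space of functions on arrays) generated by the pair of highest weight vectors is the
  graph of an isomorphism. The Serre relations are not needed for M since V is given.

  Uniqueness: the vectors killed by x 1, ..., x k are spanned by the basis elements without outgoing edges of color
  at most k, and among those with the same entries in the rows above k + 1 such an element is determined by its weight.
  Descending in k, a weight basis whose supporting graph maps bijectively on vertices into L, or which restricts
  irreducibly, agrees with the Gelfand-Tsetlin basis up to scalars.\<close>

section \<open>Lagrange interpolation with colliding nodes\<close>

text \<open>The obstacle to the interpolation identity is that equal neighbors in a row, shifted by
  their column numbers, differ by 1, so that the doubled nodes collide. Interlacing then also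
  produces matching roots, which makes a limit argument possible. Uniqueness rests on one
  combinatorial fact. Two patterns saturated below row r have no common cover reached by raising
  different positions of row r. Therefore the terms of a raising operator applied to candidates for
  singular vectors cannot cancel, and the lowering operators become triangular. Weights see only row
  sums (by parity classes in the last row), but a saturated pattern can be read off from its row
  sums; this separates singular vectors level by level without complete reducibility or branching
  rules. The comparison of bases needs only an inclusion of edge sets. The same lemma therefore
  yields solitarity, where the edge sets are equal, and edge-minimality, where edges have been
  deleted.\<close>

lemma lagrange_lead_coeff:
  fixes z :: "'k \<Rightarrow> complex" and p :: "complex poly"
  assumes K: "finite K" "inj_on z K" "degree p < card K"
  shows "(\<Sum>k\<in>K. poly p (z k) / (\<Prod>j\<in>K-{k}. z k - z j)) = coeff p (card K - 1)"
proof -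
  define b where "b k = (\<Prod>j\<in>K-{k}. [:- z j, 1:])" for k
  define q where "q = (\<Sum>k\<in>K. smult (poly p (z k) / (\<Prod>j\<in>K-{k}. z k - z j)) (b k))"
  have db: "degree (b k) = card K - 1" "coeff (b k) (card K - 1) = 1" if "k \<in> K" for k
  proof -
    have "degree (b k) = (\<Sum>j\<in>K-{k}. degree [:- z j, 1:])"
      unfolding b_def by (rule degree_prod_eq_sum_degree) auto
    then show d: "degree (b k) = card K - 1" using that K by simp
    have "lead_coeff (b k) = 1" unfolding b_def by (simp add: lead_coeff_prod)
    then show "coeff (b k) (card K - 1) = 1" using d by simp
  qed
  have pb: "poly (b k) (z l) = (if k = l then (\<Prod>j\<in>K-{k}. z k - z j) else 0)"
    if "k \<in> K" "l \<in> K" for k l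
  proof (cases "k = l")
    case True then show ?thesis by (simp add: b_def poly_prod)
  next
    case False
    then have "\<exists>j\<in>K-{k}. z l - z j = 0" using that by auto
    then show ?thesis using False K by (auto simp: b_def poly_prod)
  qed
  have nz: "(\<Prod>j\<in>K-{k}. z k - z j) \<noteq> 0" if "k \<in> K" for k
    using K that by (auto simp: inj_on_def)
  have q1: "poly q (z l) = poly p (z l)" if "l \<in> K" for l
  proof -
    have "poly q (z l) = (\<Sum>k\<in>K. if k = l then poly p (z l) else 0)"
      unfolding q_def poly_sum
      by (rule sum.cong) (use that nz pb in \<open>auto\<close>)
    then show ?thesis using K that by simp
  qed
  have dq: "degree q \<le> card K - 1"
    unfolding q_def by (rule degree_sum_le) (use K db in \<open>auto intro: order_trans[OF degree_smult_le]\<close>)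
  \<comment> \<open>Both polynomials have degree below the number of nodes and agree at all nodes,
    so \<open>p\<close> is its own Lagrange interpolant. The claim compares coefficients in degree
    \<open>card K - 1\<close>.\<close>
  have "p = q"
  proof (rule poly_eqI_degree[of "z ` K"])
    show "poly p x = poly q x" if "x \<in> z ` K" for x using that q1 by auto
    show "degree p < card (z ` K)" using K by (simp add: card_image)
    show "degree q < card (z ` K)" using K dq by (simp add: card_image)
  qed
  then have "coeff p (card K - 1) = coeff q (card K - 1)" by simp
  also have "\<dots> = (\<Sum>k\<in>K. poly p (z k) / (\<Prod>j\<in>K-{k}. z k - z j))"
    unfolding q_def coeff_sum by (rule sum.cong) (use db in auto)
  finally show ?thesis by simp
qed

lemma coeff_prod_linear:
  fixes r :: "'k \<Rightarrow> complex"
  assumes "finite K"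
  shows "degree (\<Prod>k\<in>K. [:- r k, 1:]) = card K" "coeff (\<Prod>k\<in>K. [:- r k, 1:]) (card K) = 1"
    and "K \<noteq> {} \<Longrightarrow> coeff (\<Prod>k\<in>K. [:- r k, 1:]) (card K - 1) = - (\<Sum>k\<in>K. r k)"
proof -
  show d: "degree (\<Prod>k\<in>K. [:- r k, 1:]) = card K" for K
    by (subst degree_prod_eq_sum_degree) auto
  have "lead_coeff (\<Prod>k\<in>K. [:- r k, 1:]) = 1" for K by (simp add: lead_coeff_prod)
  with d show l: "coeff (\<Prod>k\<in>K. [:- r k, 1:]) (card K) = 1" for K by metis
  show "K \<noteq> {} \<Longrightarrow> coeff (\<Prod>k\<in>K. [:- r k, 1:]) (card K - 1) = - (\<Sum>k\<in>K. r k)"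
    using assms
  proof (induction K rule: finite_induct)
    case (insert a K)
    show ?case
    proof (cases "K = {}")
      case False
      then obtain c where c: "card K = Suc c" using insert by (metis card_eq_0_iff not0_implies_Suc)
      have "coeff (\<Prod>k\<in>K. [:- r k, 1:]) c = - (\<Sum>k\<in>K. r k)" using insert False c by simp
      moreover have "coeff (\<Prod>k\<in>K. [:- r k, 1:]) (Suc c) = 1" using l[of K] c by simp
      ultimately show ?thesis using insert c by (simp add: algebra_simps)
    qed simp
  qed simp
qed

text \<open>A monic polynomial of degree \<open>card K\<close> is one degree too large for
  interpolation. Subtracting the node polynomial keeps the values at the nodes and lowers the
  degree; the next coefficients are minus the sums of the roots and of the nodes.\<close>

lemma lagrange_monic:
  fixes z :: "'k \<Rightarrow> complex" and r :: "'i \<Rightarrow> complex"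
  assumes K: "finite K" "inj_on z K" and I: "finite I" "card I = card K"
  shows "(\<Sum>k\<in>K. (\<Prod>i\<in>I. z k - r i) / (\<Prod>j\<in>K-{k}. z k - z j)) = (\<Sum>k\<in>K. z k) - (\<Sum>i\<in>I. r i)"
proof (cases "K = {}")
  case True then show ?thesis using I by simp
next
  case False
  define f where "f = (\<Prod>i\<in>I. [:- r i, 1:])"
  define g where "g = (\<Prod>k\<in>K. [:- z k, 1:])"
  have In: "I \<noteq> {}" "card K > 0" using False I K by auto
  have "degree (f - g) < card K"
  proof (rule degree_lessI)
    show "f - g \<noteq> 0 \<or> card K > 0" using In by simp
    show "\<forall>k\<ge>card K. coeff (f - g) k = 0"
    proof (intro allI impI)
      fix k assume "k \<ge> card K"
      then consider "k = card K" | "k > card K" by linarith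
      then show "coeff (f - g) k = 0"
      proof cases
        case 1 then show ?thesis using coeff_prod_linear(2)[OF K(1), of z] coeff_prod_linear(2)[OF I(1), of r] I
          by (simp add: f_def g_def)
      next
        case 2 then show ?thesis using coeff_prod_linear(1)[OF K(1), of z] coeff_prod_linear(1)[OF I(1), of r] I
          by (simp add: f_def g_def coeff_eq_0)
      qed
    qed
  qed
  from lagrange_lead_coeff[OF K this]
  have "(\<Sum>k\<in>K. poly (f - g) (z k) / (\<Prod>j\<in>K-{k}. z k - z j)) = coeff (f - g) (card K - 1)" .
  moreover have "poly (f - g) (z k) = (\<Prod>i\<in>I. z k - r i)" if "k \<in> K" for k
    using that K by (auto simp: f_def g_def poly_prod)
  moreover have "coeff (f - g) (card K - 1) = (\<Sum>k\<in>K. z k) - (\<Sum>i\<in>I. r i)"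
    using coeff_prod_linear(3)[OF K(1) False, of z] coeff_prod_linear(3)[OF I(1) In(1), of r] I
    by (simp add: f_def g_def)
  ultimately show ?thesis by simp
qed

text \<open>The two summands belonging to \<open>x q + 1\<close> and \<open>x q\<close> in the
  interpolation sum over the doubled node set of all \<open>x q\<close> and \<open>x q + 1\<close>.
  Their mutual differences 1 and -1 cause the opposite signs.\<close>

definition gt_term :: "('q \<Rightarrow> complex) \<Rightarrow> ('i \<Rightarrow> complex) \<Rightarrow> 'q set \<Rightarrow> 'i set \<Rightarrow> 'q \<Rightarrow> complex" where
  "gt_term x r Q I q = (\<Prod>i\<in>I. r i - (x q + 1)) / (\<Prod>j\<in>Q-{q}. (x j - x q) * (x j - x q - 1))
     - (\<Prod>i\<in>I. r i - x q) / (\<Prod>j\<in>Q-{q}. (x j - x q) * (x j - x q + 1))"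

text \<open>The conditions on \<open>x\<close> say that the \<open>2 * card Q\<close> doubled nodes
  are distinct, so \<open>lagrange_monic\<close> applies. The number of roots is even, which allows
  all differences in a numerator to be reversed.\<close>

lemma gt_sum_distinct:
  assumes Q: "finite Q" "inj_on x Q" and nc: "\<And>i j. i \<in> Q \<Longrightarrow> j \<in> Q \<Longrightarrow> x i + 1 \<noteq> x j"
    and I: "finite I" "card I = 2 * card Q"
  shows "(\<Sum>q\<in>Q. gt_term x r Q I q) = (\<Sum>q\<in>Q. 2 * x q + 1) - (\<Sum>i\<in>I. r i)"
proof -
  define z where "z = (\<lambda>(q, b). x q + (if b then 1 else 0))"
  define K where "K = Q \<times> (UNIV :: bool set)"
  have fK: "finite K" "card I = card K" using Q I by (auto simp: K_def)
  have ij: "inj_on z K"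
    using Q nc unfolding inj_on_def K_def z_def by (auto split: if_splits) (metis add.commute)+
  have neg: "(\<Prod>i\<in>I. a - r i) = (\<Prod>i\<in>I. r i - a)" for a
  proof -
    have "(\<Prod>i\<in>I. a - r i) = (\<Prod>i\<in>I. (-1) * (r i - a))" by (rule prod.cong) auto
    also have "\<dots> = (-1) ^ card I * (\<Prod>i\<in>I. r i - a)" by (subst prod.distrib) (simp add: I)
    finally show ?thesis using I by simp
  qed
  have KQ: "K - {(q, b)} = insert (q, \<not> b) ((Q - {q}) \<times> UNIV)" if "q \<in> Q" for q b
    using that by (auto simp: K_def)
  have two: "(\<Prod>p\<in>(Q-{q}) \<times> (UNIV :: bool set). f p) = (\<Prod>j\<in>Q-{q}. f (j, True) * f (j, False))"
    for q and f :: "'a \<times> bool \<Rightarrow> complex"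
  proof -
    have "(\<Prod>p\<in>(Q-{q}) \<times> (UNIV :: bool set). f p) = (\<Prod>j\<in>Q-{q}. \<Prod>b\<in>UNIV. f (j, b))"
      by (subst prod.cartesian_product) (auto intro: prod.cong)
    then show ?thesis by (simp add: UNIV_bool mult.commute)
  qed
  have "(\<Sum>k\<in>K. (\<Prod>i\<in>I. z k - r i) / (\<Prod>j\<in>K-{k}. z k - z j)) = (\<Sum>k\<in>K. z k) - (\<Sum>i\<in>I. r i)"
    by (rule lagrange_monic[OF fK(1) ij I(1) fK(2)])
  moreover have "(\<Sum>k\<in>K. z k) = (\<Sum>q\<in>Q. 2 * x q + 1)"
  proof -
    have "(\<Sum>k\<in>K. z k) = (\<Sum>q\<in>Q. \<Sum>b\<in>UNIV. z (q, b))"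
      unfolding K_def by (subst sum.cartesian_product) (auto intro: sum.cong)
    then show ?thesis by (simp add: z_def UNIV_bool algebra_simps)
  qed
  moreover have "(\<Sum>k\<in>K. (\<Prod>i\<in>I. z k - r i) / (\<Prod>j\<in>K-{k}. z k - z j)) =
     (\<Sum>q\<in>Q. gt_term x r Q I q)"
  proof -
    have "(\<Sum>k\<in>K. (\<Prod>i\<in>I. z k - r i) / (\<Prod>j\<in>K-{k}. z k - z j)) =
      (\<Sum>q\<in>Q. \<Sum>b\<in>UNIV. (\<Prod>i\<in>I. z (q,b) - r i) / (\<Prod>j\<in>K-{(q,b)}. z (q,b) - z j))"
      unfolding K_def by (subst sum.cartesian_product) (auto intro: sum.cong)
    also have "\<dots> = (\<Sum>q\<in>Q. gt_term x r Q I q)"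
    proof (rule sum.cong[OF refl])
      fix q assume q: "q \<in> Q"
      have 1: "(\<Prod>j\<in>K-{(q,True)}. z (q,True) - z j) = (\<Prod>j\<in>Q-{q}. (x j - x q) * (x j - x q - 1))"
        unfolding KQ[OF q] using Q
        by (subst prod.insert) (auto simp: two z_def intro!: prod.cong simp: algebra_simps)
      have 2: "(\<Prod>j\<in>K-{(q,False)}. z (q,False) - z j) = - (\<Prod>j\<in>Q-{q}. (x j - x q) * (x j - x q + 1))"
        unfolding KQ[OF q] using Q
        by (subst prod.insert) (auto simp: two z_def intro!: prod.cong simp: algebra_simps)
      show "(\<Sum>b\<in>UNIV. (\<Prod>i\<in>I. z (q,b) - r i) / (\<Prod>j\<in>K-{(q,b)}. z (q,b) - z j)) = gt_term x r Q I q"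
        unfolding UNIV_bool using 1 2 by (simp add: gt_term_def neg) (simp add: z_def)
    qed
    finally show ?thesis .
  qed
  ultimately show ?thesis by simp
qed

text \<open>If x i + 1 = x j then both critical numerators vanish twice, while the denominators vanish too and
  division yields 0. Moving the nodes and roots along dx and dr keeps these numerators zero and
  separates the nodes, so the identity survives in the limit.\<close>
lemma gt_sum:
  fixes x dx :: "'q \<Rightarrow> complex" and r dr :: "'i \<Rightarrow> complex"
  assumes Q: "finite Q" "inj_on x Q" "inj_on dx Q"
    and I: "finite I" "card I = 2 * card Q"
    and c: "\<And>i j. i \<in> Q \<Longrightarrow> j \<in> Q \<Longrightarrow> x i + 1 = x j \<Longrightarrow>
        (\<exists>k\<in>I. r k = x i + 1 \<and> dr k = dx i) \<and> (\<exists>k\<in>I. r k = x j \<and> dr k = dx j)"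
  shows "(\<Sum>q\<in>Q. gt_term x r Q I q) = (\<Sum>q\<in>Q. 2 * x q + 1) - (\<Sum>i\<in>I. r i)"
proof -
  define xe where "xe e q = x q + e * dx q" for e q
  define re where "re e q = r q + e * dr q" for e q
  have t: "((\<lambda>e. xe e q) \<longlongrightarrow> x q) (at 0)" "((\<lambda>e. re e i) \<longlongrightarrow> r i) (at 0)" for q i
    unfolding xe_def re_def by (auto intro!: tendsto_eq_intros)
  have "eventually (\<lambda>e. xe e i \<noteq> xe e j) (at 0)" if "i \<in> Q" "j \<in> Q" "i \<noteq> j" for i j
    using that Q by -
      (rule eventually_mono[OF tendsto_imp_eventually_ne[OF tendsto_diff[OF t(1)[of i] t(1)[of j]], of 0]],
       auto simp: inj_on_def)
  moreover have "eventually (\<lambda>e. xe e i + 1 \<noteq> xe e j) (at 0)" if ij: "i \<in> Q" "j \<in> Q" for i j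
  proof (cases "x i + 1 = x j")
    case False
    show ?thesis
      by (rule eventually_mono[OF tendsto_imp_eventually_ne[OF tendsto_diff[OF tendsto_add[OF t(1)[of i] tendsto_const[of 1]] t(1)[of j]], of 0]])
         (use False in auto)
  next
    case True
    then have "i \<noteq> j" by auto
    then have "dx i \<noteq> dx j" using ij Q by (auto simp: inj_on_def)
    moreover have "eventually (\<lambda>e::complex. e \<noteq> 0) (at 0)" by (simp add: eventually_at_filter)
    ultimately show ?thesis using True
      by (auto simp: xe_def elim!: eventually_mono) (metis add.assoc add.commute add_left_imp_eq mult_left_cancel)
  qed
  ultimately have "eventually (\<lambda>e. (\<forall>i\<in>Q. \<forall>j\<in>Q. i \<noteq> j \<longrightarrow> xe e i \<noteq> xe e j) \<and> (\<forall>i\<in>Q. \<forall>j\<in>Q. xe e i + 1 \<noteq> xe e j)) (at 0)"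
    using Q by (auto intro!: eventually_conj eventually_ball_finite)
  then have ev: "eventually (\<lambda>e. (\<Sum>q\<in>Q. gt_term (xe e) (re e) Q I q) = (\<Sum>q\<in>Q. 2 * xe e q + 1) - (\<Sum>i\<in>I. re e i)) (at 0)"
  proof (rule eventually_mono)
    fix e assume a: "(\<forall>i\<in>Q. \<forall>j\<in>Q. i \<noteq> j \<longrightarrow> xe e i \<noteq> xe e j) \<and> (\<forall>i\<in>Q. \<forall>j\<in>Q. xe e i + 1 \<noteq> xe e j)"
    show "(\<Sum>q\<in>Q. gt_term (xe e) (re e) Q I q) = (\<Sum>q\<in>Q. 2 * xe e q + 1) - (\<Sum>i\<in>I. re e i)"
      by (rule gt_sum_distinct) (use a Q I in \<open>auto simp: inj_on_def\<close>)
  qed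
  have A: "((\<lambda>e. (\<Prod>i\<in>I. re e i - (xe e q + 1)) / (\<Prod>j\<in>Q-{q}. (xe e j - xe e q) * (xe e j - xe e q - 1)))
     \<longlongrightarrow> (\<Prod>i\<in>I. r i - (x q + 1)) / (\<Prod>j\<in>Q-{q}. (x j - x q) * (x j - x q - 1))) (at 0)" if q: "q \<in> Q" for q
  proof (cases "\<exists>j\<in>Q. x q + 1 = x j")
    case True
    then obtain k where k: "k \<in> I" "r k = x q + 1" "dr k = dx q" using c[OF q] by blast
    then have "(\<Prod>i\<in>I. re e i - (xe e q + 1)) = 0" for e
      using I by (auto simp: re_def xe_def intro!: prod_zero bexI[of _ k])
    moreover have "(\<Prod>i\<in>I. r i - (x q + 1)) = 0" using k I by (auto intro!: prod_zero bexI[of _ k])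
    ultimately show ?thesis by simp
  next
    case False
    have "x j - x q \<noteq> 0 \<and> x j - x q - 1 \<noteq> 0" if "j \<in> Q - {q}" for j
      using that False Q q by (auto simp: inj_on_def algebra_simps)
    then have "(\<Prod>j\<in>Q-{q}. (x j - x q) * (x j - x q - 1)) \<noteq> 0"
      using Q by (simp del: right_diff_distrib)
    then show ?thesis by (intro tendsto_intros t)
  qed
  have B: "((\<lambda>e. (\<Prod>i\<in>I. re e i - xe e q) / (\<Prod>j\<in>Q-{q}. (xe e j - xe e q) * (xe e j - xe e q + 1)))
     \<longlongrightarrow> (\<Prod>i\<in>I. r i - x q) / (\<Prod>j\<in>Q-{q}. (x j - x q) * (x j - x q + 1))) (at 0)" if q: "q \<in> Q" for q
  proof (cases "\<exists>j\<in>Q. x j + 1 = x q")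
    case True
    then obtain k where k: "k \<in> I" "r k = x q" "dr k = dx q" using c[OF _ q] by blast
    then have "(\<Prod>i\<in>I. re e i - xe e q) = 0" for e
      using I by (auto simp: re_def xe_def intro!: prod_zero bexI[of _ k])
    moreover have "(\<Prod>i\<in>I. r i - x q) = 0" using k I by (auto intro!: prod_zero bexI[of _ k])
    ultimately show ?thesis by simp
  next
    case False
    have "x j - x q \<noteq> 0 \<and> x j - x q + 1 \<noteq> 0" if "j \<in> Q - {q}" for j
      using that False Q q by (auto simp: inj_on_def algebra_simps)
    then have "(\<Prod>j\<in>Q-{q}. (x j - x q) * (x j - x q + 1)) \<noteq> 0"
      using Q by (simp del: right_diff_distrib)
    then show ?thesis by (intro tendsto_intros t)
  qed
  have "((\<lambda>e. \<Sum>q\<in>Q. gt_term (xe e) (re e) Q I q) \<longlongrightarrow> (\<Sum>q\<in>Q. gt_term x r Q I q)) (at 0)"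
    unfolding gt_term_def by (intro tendsto_sum tendsto_diff A B)
  then have "((\<lambda>e. (\<Sum>q\<in>Q. 2 * xe e q + 1) - (\<Sum>i\<in>I. re e i)) \<longlongrightarrow> (\<Sum>q\<in>Q. gt_term x r Q I q)) (at 0)"
    by (rule Lim_transform_eventually[OF _ ev])
  moreover have "((\<lambda>e. (\<Sum>q\<in>Q. 2 * xe e q + 1) - (\<Sum>i\<in>I. re e i)) \<longlongrightarrow> (\<Sum>q\<in>Q. 2 * x q + 1) - (\<Sum>i\<in>I. r i)) (at 0)"
    by (intro tendsto_intros t)
  ultimately show ?thesis using tendsto_unique[OF at_neq_bot] by blast
qed

section \<open>Triangular patterns\<close>

definition raise :: "array \<Rightarrow> nat \<times> nat \<Rightarrow> array" where "raise c p = c(p := c p + 1)"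
definition lower :: "array \<Rightarrow> nat \<times> nat \<Rightarrow> array" where "lower c p = c(p := c p - 1)"

lemma lower_raise [simp]: "lower (raise c p) p = c"
  by (auto simp: lower_def raise_def)

lemma raise_lower [simp]: "c p > 0 \<Longrightarrow> raise (lower c p) p = c"
  by (auto simp: lower_def raise_def)

lemma raise_apply: "raise c p q = c q + (if q = p then 1 else 0)"
  by (simp add: raise_def)

lemma raise_eq_iff [simp]: "raise c p = raise c q \<longleftrightarrow> p = q"
  by (metis fun_upd_same fun_upd_other less_irrefl lessI raise_def Suc_eq_plus1)

definition rsum :: "array \<Rightarrow> nat \<Rightarrow> int" where "rsum c i = (\<Sum>j=1..i. int (c (i, j)))"

text \<open>\<open>bcol b\<close> is the color in the last row of the odd columns
  (\<open>b = True\<close>) and of the even columns (\<open>b = False\<close>). The alternatives are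
  type B, where both colors coincide, and the two labelings of type D.\<close>

locale tri_pattern =
  fixes N m n :: nat and bcol :: "bool \<Rightarrow> nat"
  assumes N3: "N \<ge> 3"
    and bcol: "(n = N \<and> bcol = (\<lambda>_. N)) \<or> (n = N + 1 \<and> bcol = (\<lambda>b. if b then N else N + 1))
      \<or> (n = N + 1 \<and> bcol = (\<lambda>b. if b then N + 1 else N))"
begin

lemma N2: "N \<ge> 2" using N3 by simp

abbreviation "V \<equiv> vertsB N m"
abbreviation "I \<equiv> idxB N"

definition col :: "nat \<times> nat \<Rightarrow> nat" where
  "col p = (if fst p < N then fst p else bcol (odd (snd p)))"

definition pos :: "nat \<Rightarrow> (nat \<times> nat) set" where "pos i = {p \<in> I. col p = i}"

lemma idx_iff: "(i, j) \<in> I \<longleftrightarrow> 1 \<le> j \<and> j \<le> i \<and> i \<le> N" by (simp add: idxB_def)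

lemma finite_idx [simp]: "finite I"
proof -
  have "I \<subseteq> {0..N} \<times> {0..N}" by (auto simp: idxB_def)
  then show ?thesis by (rule finite_subset) simp
qed

lemma finite_pos [simp]: "finite (pos i)" by (simp add: pos_def)

lemma col_bounds: "p \<in> I \<Longrightarrow> 1 \<le> col p \<and> col p \<le> n"
  using bcol N2 by (cases p) (auto simp: idx_iff col_def)

lemma col_lt: "p \<in> I \<Longrightarrow> col p < N \<longleftrightarrow> fst p < N"
  using bcol by (auto simp: col_def split: if_splits)

lemma col_eq: "p \<in> I \<Longrightarrow> fst p < N \<Longrightarrow> col p = fst p" by (simp add: col_def)

lemma N_le_n: "N \<le> n" "n \<le> N + 1" using bcol by auto

lemma min_col: "p \<in> I \<Longrightarrow> fst p = min (col p) N"
  using bcol by (cases p) (auto simp: col_def idx_iff)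

lemma vertD:
  assumes "c \<in> V" "1 \<le> j" "j \<le> i" "i < N"
  shows "c (i + 1, j) \<le> c (i, j)" "c (i, j) \<le> c (i + 1, j + 1)"
  using assms by (auto simp: vertsB_def)

lemma vert_row:
  assumes "c \<in> V" "1 \<le> j" "j < i" "i \<le> N"
  shows "c (i, j) \<le> c (i, j + 1)"
  using vertD[OF assms(1), of j "i - 1"] assms by force

lemma vert_le_m:
  assumes c: "c \<in> V" shows "c p \<le> m"
proof -
  have row: "c (N, j) \<le> m" if "1 \<le> j" "j \<le> N" for j
    using that(2,1)
  proof (induction rule: inc_induct)
    case base then show ?case using c by (simp add: vertsB_def)
  next
    case (step k) then show ?case using vert_row[OF c, of k N] by simp
  qed
  have "c (i, j) \<le> m" if "i \<le> N" "1 \<le> j" "j \<le> i" for i j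
    using that
  proof (induction i arbitrary: j rule: inc_induct)
    case base then show ?case using row by simp
  next
    case (step k)
    have "c (k, j) \<le> c (Suc k, j + 1)" using vertD(2)[OF c, of j k] step by simp
    also have "\<dots> \<le> m" using step by simp
    finally show ?case .
  qed
  moreover have "c p = 0" if "p \<notin> I" using c that unfolding vertsB_def by blast
  ultimately show ?thesis by (cases p; cases "p \<in> I") (auto simp: idx_iff)
qed

lemma vert_out: "c \<in> V \<Longrightarrow> p \<notin> I \<Longrightarrow> c p = 0" by (cases p) (simp add: vertsB_def)

lemma finite_verts [simp]: "finite V"
proof -
  have "finite {f. \<forall>x. (x \<in> I \<longrightarrow> f x \<in> {0..m}) \<and> (x \<notin> I \<longrightarrow> f x = (0::nat))}"
    by (rule finite_set_of_finite_funs) auto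
  then show ?thesis
    by (rule rev_finite_subset) (auto simp: vert_le_m vert_out)
qed

lemma raise_in_iff:
  assumes "c \<in> V" "(i, j) \<in> I"
  shows "raise c (i, j) \<in> V \<longleftrightarrow>
    (if i < N then c (i, j) < c (i + 1, j + 1) else j = N \<longrightarrow> c (i, j) < m) \<and> (j < i \<longrightarrow> c (i, j) < c (i - 1, j))"
    (is "?L \<longleftrightarrow> ?R")
proof
  assume L: ?L
  have 1: "i < N \<Longrightarrow> c (i, j) < c (i + 1, j + 1)"
    using vertD(2)[OF L, of j i] assms by (simp add: raise_def idx_iff)
  have 2: "j < i \<Longrightarrow> c (i, j) < c (i - 1, j)"
  proof -
    assume "j < i"
    moreover have "i \<noteq> i - 1" "1 \<le> j" "j \<le> i - 1" "i - 1 < N" "i - 1 + 1 = i" using \<open>j < i\<close> assms by (auto simp: idx_iff)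
    ultimately show "c (i, j) < c (i - 1, j)"
      using vertD(1)[OF L, of j "i - 1"] by (auto simp: raise_def)
  qed
  have 3: "i = N \<Longrightarrow> j = N \<Longrightarrow> c (i, j) < m"
    using L by (simp add: raise_def vertsB_def)
  show ?R using 1 2 3 assms by (auto simp: idx_iff)
next
  assume R: ?R
  have a: "raise c (i, j) (a + 1, b) \<le> raise c (i, j) (a, b)" if "1 \<le> b" "b \<le> a" "a < N" for a b
    using vertD(1)[OF assms(1) that] R that by (auto simp: raise_def)
  have b: "raise c (i, j) (a, b) \<le> raise c (i, j) (a + 1, b + 1)" if "1 \<le> b" "b \<le> a" "a < N" for a b
    using vertD(2)[OF assms(1) that] R that by (auto simp: raise_def)
  have "raise c (i, j) (N, N) \<le> m"
    using R vert_le_m[OF assms(1), of "(N, N)"] by (auto simp: raise_def)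
  moreover have "\<forall>p. p \<notin> I \<longrightarrow> raise c (i, j) p = 0"
    using assms vert_out by (auto simp: raise_def)
  ultimately show ?L using a b N2 unfolding vertsB_def by auto
qed

lemma vert_raise_step:
  assumes c: "c \<in> V" and d: "d \<in> V" and le: "\<And>p. c p \<le> d p" and ne: "c \<noteq> d"
  obtains p where "p \<in> I" "c p < d p" "raise c p \<in> V"
proof -
  define A where "A = {p. c p < d p}"
  have AI: "A \<subseteq> I" using vert_out[OF d] by (force simp: A_def)
  then have fA: "finite A" by (rule finite_subset) simp
  obtain p0 where "c p0 \<noteq> d p0" using ne by blast
  then have "p0 \<in> A" using le[of p0] by (simp add: A_def)
  define rk where "rk q = 2 * int (snd q) - int (fst q)" for q :: "nat \<times> nat"
  have "Max (rk ` A) \<in> rk ` A" using fA \<open>p0 \<in> A\<close> by (intro Max_in) auto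
  then obtain p where p: "p \<in> A" "rk p = Max (rk ` A)" by auto
  text \<open>The value at p can only be blocked by (i+1,j+1) or (i-1,j), where 2j-i is larger.\<close>
  have mx: "2 * int (snd q) - int (fst q) \<le> 2 * int (snd p) - int (fst p)" if "q \<in> A" for q
    using Max_ge[of "rk ` A" "rk q"] fA that p(2) by (simp add: rk_def)
  obtain i j where ij: "p = (i, j)" by fastforce
  have I: "(i, j) \<in> I" using p AI ij by auto
  have lt: "c (i, j) < d (i, j)" using p ij by (simp add: A_def)
  have 1: "c (i, j) < c (i + 1, j + 1)" if "i < N"
  proof (rule ccontr)
    assume "\<not> ?thesis"
    moreover have "d (i, j) \<le> d (i + 1, j + 1)" "c (i, j) \<le> c (i + 1, j + 1)"
      using vertD(2)[OF c, of j i] vertD(2)[OF d, of j i] I that by (auto simp: idx_iff)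
    ultimately have "(i + 1, j + 1) \<in> A" using lt by (simp add: A_def)
    from mx[OF this] show False by (simp add: ij)
  qed
  have 2: "c (i, j) < c (i - 1, j)" if "j < i"
  proof (rule ccontr)
    assume "\<not> ?thesis"
    moreover have "d (i, j) \<le> d (i - 1, j)" "c (i, j) \<le> c (i - 1, j)"
      using vertD(1)[OF c, of j "i - 1"] vertD(1)[OF d, of j "i - 1"] I that by (auto simp: idx_iff)
    ultimately have "(i - 1, j) \<in> A" using lt by (simp add: A_def)
    from mx[OF this] show False using that by (auto simp: ij)
  qed
  have 3: "c (i, j) < m" using lt vert_le_m[OF d, of "(i, j)"] by simp
  have "raise c (i, j) \<in> V" unfolding raise_in_iff[OF c I] using 1 2 3 by auto
  then show ?thesis using that[of p] ij I lt by simp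
qed

section \<open>Lattice operations on patterns\<close>

lemma vertI:
  assumes "\<And>p. p \<notin> idxB N \<Longrightarrow> c p = 0" "c (N, N) \<le> m"
    and "\<And>i j. 1 \<le> j \<Longrightarrow> j \<le> i \<Longrightarrow> i < N \<Longrightarrow> c (i + 1, j) \<le> c (i, j) \<and> c (i, j) \<le> c (i + 1, j + 1)"
  shows "c \<in> V"
  using assms N2 unfolding vertsB_def by auto

lemma vert_min: assumes c: "c \<in> V" and d: "d \<in> V" shows "(\<lambda>p. min (c p) (d p)) \<in> V"
proof (rule vertI)
  fix i j assume a: "1 \<le> j" "j \<le> i" "i < N"
  show "min (c (i + 1, j)) (d (i + 1, j)) \<le> min (c (i, j)) (d (i, j)) \<and>
      min (c (i, j)) (d (i, j)) \<le> min (c (i + 1, j + 1)) (d (i + 1, j + 1))"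
    using vertD[OF c a] vertD[OF d a] by linarith
qed (use c d vert_out vert_le_m in \<open>auto simp: min_def\<close>)

lemma vert_max: assumes c: "c \<in> V" and d: "d \<in> V" shows "(\<lambda>p. max (c p) (d p)) \<in> V"
proof (rule vertI)
  fix i j assume a: "1 \<le> j" "j \<le> i" "i < N"
  show "max (c (i + 1, j)) (d (i + 1, j)) \<le> max (c (i, j)) (d (i, j)) \<and>
      max (c (i, j)) (d (i, j)) \<le> max (c (i + 1, j + 1)) (d (i + 1, j + 1))"
    using vertD[OF c a] vertD[OF d a] by linarith
qed (use c d vert_out vert_le_m in \<open>auto simp: max_def\<close>)

text \<open>\<open>c\<close> and \<open>raise (lower c q) p\<close> are opposite corners of a
  diamond whose other corners are their componentwise minimum and maximum. So if both ends are
  patterns, both paths between them exist, as the commutator of raising and lowering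
  requires.\<close>

lemma vert_diamond:
  assumes "c \<in> V" "p \<noteq> q" "c q > 0" "raise (lower c q) p \<in> V"
  shows "lower c q \<in> V" "raise c p \<in> V"
proof -
  have "lower c q = (\<lambda>r. min (c r) (raise (lower c q) p r))"
    using assms by (auto simp: raise_def lower_def fun_eq_iff)
  with vert_min[OF assms(1,4)] show "lower c q \<in> V" by simp
  have "raise c p = (\<lambda>r. max (c r) (raise (lower c q) p r))"
    using assms by (auto simp: raise_def lower_def fun_eq_iff)
  with vert_max[OF assms(1,4)] show "raise c p \<in> V" by simp
qed

section \<open>Components for the colors up to k and their maximal elements\<close>

definition agree :: "nat \<Rightarrow> array \<Rightarrow> array \<Rightarrow> bool" where
  "agree k c d \<longleftrightarrow> (\<forall>p\<in>I. col p > k \<longrightarrow> c p = d p)"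

definition kmax :: "nat \<Rightarrow> array \<Rightarrow> bool" where
  "kmax k c \<longleftrightarrow> (\<forall>p\<in>I. col p \<le> k \<longrightarrow> raise c p \<notin> V)"

definition edges :: "(array \<times> nat \<times> array) set" where
  "edges = {(s, i, t). s \<in> V \<and> t \<in> V \<and> (\<exists>p\<in>I. t = raise s p \<and> i = col p)}"

definition total :: "array \<Rightarrow> nat" where "total c = sum c I"

lemma total_raise: "p \<in> I \<Longrightarrow> total (raise c p) = total c + 1"
  by (simp add: total_def raise_apply sum.distrib)

lemma total_le: "c \<in> V \<Longrightarrow> total c \<le> m * card I"
  unfolding total_def using sum_bounded_above[of I c m] vert_le_m by (simp add: mult.commute)

lemma agree_refl [simp]: "agree k c c" by (simp add: agree_def)
lemma agree_sym: "agree k c d \<Longrightarrow> agree k d c" by (simp add: agree_def)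
lemma agree_trans: "agree k c d \<Longrightarrow> agree k d e \<Longrightarrow> agree k c e" by (simp add: agree_def)
lemma agree_raise: "p \<in> I \<Longrightarrow> col p \<le> k \<Longrightarrow> agree k c (raise c p)"
  by (auto simp: agree_def raise_apply)
lemma agree_n: "agree n c d" using col_bounds by (fastforce simp: agree_def)
lemma agree_0: "agree 0 c d \<Longrightarrow> c \<in> V \<Longrightarrow> d \<in> V \<Longrightarrow> c = d"
proof
  fix p assume "agree 0 c d" "c \<in> V" "d \<in> V"
  then show "c p = d p" using vert_out[of c p] vert_out[of d p] col_bounds[of p]
    by (cases "p \<in> I") (auto simp: agree_def)
qed

text \<open>The maximum of \<open>c\<close> and \<open>d\<close> agrees with \<open>c\<close> in the
  colors above \<open>k\<close>. If it were not \<open>c\<close>, a step from \<open>c\<close>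
  towards it would raise a position of color at most \<open>k\<close>, against maximality. So
  \<open>c\<close> dominates \<open>d\<close>, and the converse holds by symmetry.\<close>

lemma kmax_unique:
  assumes c: "c \<in> V" "kmax k c" and d: "d \<in> V" "kmax k d" and a: "agree k c d"
  shows "c = d"
proof -
  have "c = (\<lambda>p. max (c p) (d p))" if c: "c \<in> V" "kmax k c" and d: "d \<in> V" and a: "agree k c d" for c d
  proof (rule ccontr)
    assume ne: "\<not> ?thesis"
    obtain p where p: "p \<in> I" "c p < max (c p) (d p)" "raise c p \<in> V"
      by (rule vert_raise_step[OF c(1) vert_max[OF c(1) d] _ ne]) auto
    with a have "col p \<le> k" by (force simp: agree_def)
    with p c show False by (auto simp: kmax_def)
  qed
  note cd = this[OF c d(1) a] this[OF d c(1) agree_sym[OF a]]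
  show ?thesis
  proof
    fix p show "c p = d p" using fun_cong[OF cd(1), of p] fun_cong[OF cd(2), of p] by linarith
  qed
qed

definition path :: "nat \<Rightarrow> (array \<times> array) set" where
  "path k = {(s, t). s \<in> V \<and> t \<in> V \<and> (\<exists>p\<in>I. col p \<le> k \<and> t = raise s p)}"

text \<open>Climbing terminates because \<open>total\<close> is bounded. Together with
  \<open>kmax_unique\<close> this connects any two members of a class through a common top.\<close>

lemma path_to_kmax:
  assumes "c \<in> V"
  shows "\<exists>d\<in>V. agree k c d \<and> kmax k d \<and> (c, d) \<in> (path k)\<^sup>*"
  using assms
proof (induction "m * card I - total c" arbitrary: c rule: less_induct)
  case less
  show ?case
  proof (cases "kmax k c")
    case True then show ?thesis using less by (intro bexI[of _ c]) auto
  next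
    case False
    then obtain p where p: "p \<in> I" "col p \<le> k" "raise c p \<in> V" by (auto simp: kmax_def)
    have "m * card I - total (raise c p) < m * card I - total c"
      using total_raise[OF p(1), of c] total_le[OF p(3)] by simp
    from less.hyps[OF this p(3)] obtain d where d: "d \<in> V" "agree k (raise c p) d" "kmax k d"
      "(raise c p, d) \<in> (path k)\<^sup>*" by auto
    have "(c, raise c p) \<in> path k" using p less by (auto simp: path_def)
    then have "(c, d) \<in> (path k)\<^sup>*" using d(4) by (rule converse_rtrancl_into_rtrancl)
    then show ?thesis using d agree_trans[OF agree_raise[OF p(1,2)] d(2)] by auto
  qed
qed

section \<open>Patterns saturated below a row\<close>

definition rowmax :: "nat \<Rightarrow> array \<Rightarrow> bool" where
  "rowmax r c \<longleftrightarrow> (\<forall>i j. 1 \<le> j \<and> j \<le> i \<and> i < r \<longrightarrow> c (i, j) = c (i + 1, j + 1))"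

text \<open>By induction the rows below \<open>r\<close> are saturated. If row \<open>r\<close> were
  not, its rightmost unsaturated entry could be raised: the entry to its right is saturated, and
  monotonicity of row \<open>r + 1\<close> then leaves room in row \<open>r - 1\<close>.\<close>

lemma rowmaxI:
  assumes c: "c \<in> V" and "r \<le> N" and "\<And>p. p \<in> I \<Longrightarrow> fst p < r \<Longrightarrow> raise c p \<notin> V"
  shows "rowmax r c"
  using assms(2,3)
proof (induction r)
  case 0 then show ?case by (simp add: rowmax_def)
next
  case (Suc r)
  have R: "rowmax r c" using Suc by auto
  have "c (r, j) = c (r + 1, j + 1)" if "1 \<le> j" "j \<le> r" for j
  proof (rule ccontr)
    assume ne: "\<not> ?thesis"
    define A where "A = {j. 1 \<le> j \<and> j \<le> r \<and> c (r, j) \<noteq> c (r + 1, j + 1)}"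
    have fA: "finite A" "A \<noteq> {}" using ne that by (auto simp: A_def)
    define l where "l = Max A"
    have l: "l \<in> A" using fA by (simp add: l_def)
    have mx: "c (r, j) = c (r + 1, j + 1)" if "l < j" "j \<le> r" for j
      using that l Max_ge[OF fA(1), of j] by (fastforce simp: A_def l_def)
    have l': "1 \<le> l" "l \<le> r" "r < N" using l Suc by (auto simp: A_def)
    have lt: "c (r, l) < c (r + 1, l + 1)" using l vertD(2)[OF c l'] by (simp add: A_def)
    have "c (r, l) < c (r - 1, l)" if "l < r"
    proof -
      have "c (r - 1, l) = c (r, l + 1)" using R[unfolded rowmax_def, rule_format, of l "r - 1"] that l' by simp
      also have "\<dots> = c (r + 1, l + 1 + 1)" using mx[of "l + 1"] that by simp
      also have "\<dots> \<ge> c (r + 1, l + 1)" using vert_row[OF c, of "l + 1" "r + 1"] that l' by simp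
      finally show ?thesis using lt by simp
    qed
    then have "raise c (r, l) \<in> V" using raise_in_iff[OF c, of r l] l' lt by (simp add: idx_iff)
    then show False using Suc.prems(2)[of "(r, l)"] l' by (simp add: idx_iff)
  qed
  with R show ?case by (auto simp: rowmax_def less_Suc_eq)
qed

text \<open>Suppose \<open>a < b\<close>. Raising in row \<open>r\<close> leaves row
  \<open>r - 1\<close> alone, so \<open>c\<close> and \<open>d\<close> share the entry at
  \<open>(r - 1, b - 1)\<close>, which saturation equates with the entry at \<open>(r, b)\<close>;
  but there \<open>c\<close> must exceed \<open>d\<close> by 1.\<close>

lemma rowmax_inj:
  assumes "rowmax r c" "rowmax r d" "(r, a) \<in> I" "(r, b) \<in> I" "raise c (r, a) = raise d (r, b)"
  shows "a = b"
proof -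
  have *: "\<not> a < b" if "rowmax r c" "rowmax r d" "(r, a) \<in> I" "(r, b) \<in> I" "raise c (r, a) = raise d (r, b)" for c d a b
  proof
    assume ab: "a < b"
    have e: "raise c (r, a) p = raise d (r, b) p" for p using that by simp
    have "1 \<le> b - 1" "b - 1 \<le> r - 1" "r - 1 < r" "r - 1 + 1 = r" "b - 1 + 1 = b"
      using that(3,4) ab by (auto simp: idx_iff)
    then have "c (r - 1, b - 1) = c (r, b)" "d (r - 1, b - 1) = d (r, b)"
      using that(1,2)[unfolded rowmax_def, rule_format, of "b - 1" "r - 1"] by simp_all
    then show False using e[of "(r - 1, b - 1)"] e[of "(r, b)"] ab \<open>r - 1 < r\<close>
      by (auto simp: raise_apply split: if_splits)
  qed
  show ?thesis using *[OF assms] *[OF assms(2,1,4,3) assms(5)[symmetric]] by simp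
qed

lemma kmax_rowmax:
  assumes "c \<in> V" "kmax k c" "k < N" shows "rowmax (k + 1) c"
  by (rule rowmaxI) (use assms col_eq in \<open>auto simp: kmax_def\<close>)

text \<open>Row \<open>i\<close> of a saturated pattern is row \<open>i - 1\<close> moved by one
  column, with a new first entry. Differences of row sums therefore recover the first column and
  with it all rows up to \<open>r\<close>.\<close>

lemma rsum_rowmax:
  assumes "rowmax r c" "1 \<le> i" "i \<le> r"
  shows "rsum c i = int (c (i, 1)) + rsum c (i - 1)"
proof -
  have "rsum c i = int (c (i, 1)) + (\<Sum>j=2..i. int (c (i, j)))"
    unfolding rsum_def using assms by (subst sum.atLeast_Suc_atMost) (auto simp: numeral_2_eq_2)
  also have "(\<Sum>j=2..i. int (c (i, j))) = (\<Sum>j=1..i-1. int (c (i, j + 1)))"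
    using assms by (intro sum.reindex_bij_witness[of _ "\<lambda>j. j + 1" "\<lambda>j. j - 1"]) auto
  also have "\<dots> = rsum c (i - 1)"
    unfolding rsum_def
  proof (rule sum.cong[OF refl])
    fix j assume "j \<in> {1..i-1}"
    then have "1 \<le> j \<and> j \<le> i - 1 \<and> i - 1 < r" using assms by auto
    then have "c (i - 1, j) = c (i - 1 + 1, j + 1)" using assms(1) unfolding rowmax_def by blast
    then show "int (c (i, j + 1)) = int (c (i - 1, j))" using assms by simp
  qed
  finally show ?thesis .
qed

lemma rowmax_first:
  assumes "rowmax r c" "1 \<le> j" "j \<le> i" "i \<le> r"
  shows "c (i, j) = c (i - j + 1, 1)"
  using assms(2-4)
proof (induction j arbitrary: i)
  case (Suc j)
  show ?case
  proof (cases "j = 0")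
    case False
    have "c (i - 1, j) = c (i - 1 + 1, j + 1)" using assms(1)[unfolded rowmax_def, rule_format, of j "i - 1"] Suc False by (simp add: less_diff_conv2)
    then have "c (i, Suc j) = c (i - 1, j)" using Suc by simp
    also have "\<dots> = c (i - 1 - j + 1, 1)" using Suc False by (intro Suc.IH) auto
    finally show ?thesis using Suc by simp
  qed (use Suc in auto)
qed simp

lemma rowmax_eqI:
  assumes c: "c \<in> V" "rowmax r c" and d: "d \<in> V" "rowmax r d"
    and a: "\<And>p. p \<in> idxB N \<Longrightarrow> fst p > r \<Longrightarrow> c p = d p"
    and s: "\<And>i. 1 \<le> i \<Longrightarrow> i \<le> r \<Longrightarrow> rsum c i = rsum d i"
  shows "c = d"
proof
  fix p :: "nat \<times> nat"
  have f: "c (i, 1) = d (i, 1)" if "1 \<le> i" "i \<le> r" for i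
    using rsum_rowmax[OF c(2) that] rsum_rowmax[OF d(2) that] s[OF that] s[of "i - 1"] that
    by (cases "i = 1") (auto simp: rsum_def)
  obtain i j where p: "p = (i, j)" by fastforce
  show "c p = d p"
  proof (cases "p \<in> I")
    case True
    show ?thesis
    proof (cases "i \<le> r")
      case r: True
      then show ?thesis using True rowmax_first[OF c(2), of j i] rowmax_first[OF d(2), of j i] f[of "i - j + 1"]
        by (auto simp: p idx_iff)
    qed (use a True p in auto)
  qed (use c d vert_out[of c p] vert_out[of d p] in auto)
qed

section \<open>Weights of patterns\<close>

definition csum :: "array \<Rightarrow> bool \<Rightarrow> int" where
  "csum c b = (\<Sum>j | j \<in> {1..N} \<and> odd j = b. int (c (N, j)))"

text \<open>In type B both classes of columns contribute to the last color, in type D one class to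
  each of the last two. The term \<open>m\<close> stands for a virtual entry at
  \<open>(N + 1, N + 1)\<close>, which borders only the class containing column
  \<open>N\<close>.\<close>

definition wt :: "nat \<Rightarrow> array \<Rightarrow> int" where
  "wt i c = (if i < N then 2 * rsum c i - rsum c (i - 1) - rsum c (i + 1)
     else \<Sum>b | bcol b = i. 2 * csum c b - rsum c (N - 1) - (if odd N = b then int m else 0))"

lemma rsum_raise: "(a, b) \<in> I \<Longrightarrow> rsum (raise c (a, b)) i = rsum c i + (if a = i then 1 else 0)"
proof -
  assume I: "(a, b) \<in> I"
  have "rsum (raise c (a, b)) i = rsum c i + (\<Sum>j=1..i. if a = i \<and> j = b then 1 else 0)"
    unfolding rsum_def sum.distrib[symmetric] by (rule sum.cong) (auto simp: raise_apply)
  also have "(\<Sum>j=1..i. if a = i \<and> j = b then 1 else (0::int)) = (if a = i then 1 else 0)"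
    using I by (auto simp: idx_iff)
  finally show ?thesis .
qed

lemma csum_raise: "(a, b) \<in> I \<Longrightarrow> csum (raise c (a, b)) l = csum c l + (if a = N \<and> odd b = l then 1 else 0)"
proof -
  assume I: "(a, b) \<in> I"
  have "csum (raise c (a, b)) l = csum c l + (\<Sum>j | j \<in> {1..N} \<and> odd j = l. if a = N \<and> j = b then 1 else 0)"
    unfolding csum_def sum.distrib[symmetric] by (rule sum.cong) (auto simp: raise_apply)
  also have "(\<Sum>j | j \<in> {1..N} \<and> odd j = l. if a = N \<and> j = b then 1 else (0::int)) = (if a = N \<and> odd b = l then 1 else 0)"
  proof (cases "a = N \<and> odd b = l")
    case True then show ?thesis using I by (auto simp: idx_iff)
  next
    case False then show ?thesis by (subst sum.neutral) auto
  qed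
  finally show ?thesis .
qed

lemma csum_rsum: "csum c True + csum c False = rsum c N"
proof -
  have "rsum c N = sum (\<lambda>j. int (c (N, j))) ({j. j \<in> {1..N} \<and> odd j = True} \<union> {j. j \<in> {1..N} \<and> odd j = False})"
    unfolding rsum_def by (rule sum.cong) auto
  also have "\<dots> = csum c True + csum c False"
    unfolding csum_def by (rule sum.union_disjoint) auto
  finally show ?thesis by simp
qed

definition ltype :: lie_type where "ltype = (if n = N then TypeB else TypeD)"

lemma cartan_TypeD:
  "cartan TypeD (N + 1) i j = (if i = j then 2
     else if (i + 1 = N \<and> j = N + 1) \<or> (i = N + 1 \<and> j + 1 = N) then -1
     else if (i + 1 = j \<and> j \<le> N) \<or> (j + 1 = i \<and> i \<le> N) then -1 else 0)"
proof -
  have "{i, j} = {N + 1 - 2, N + 1} \<longleftrightarrow> (i + 1 = N \<and> j = N + 1) \<or> (i = N + 1 \<and> j + 1 = N)"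
    using N3 by (auto simp: doubleton_eq_iff)
  then show ?thesis by (simp add: cartan_def)
qed

lemma cartan_TypeB:
  "cartan TypeB N i j = (if i = j then 2 else if i = N \<and> j + 1 = N then -2
     else if i + 1 = j \<or> j + 1 = i then -1 else 0)"
  using N3 by (auto simp: cartan_def)

lemma bcol_cases:
  obtains (B) "n = N" "\<And>b. bcol b = N" "\<And>f :: bool \<Rightarrow> int. (\<Sum>b | bcol b = N. f b) = f True + f False"
  | (D) t where "n = N + 1" "bcol t = N" "bcol (\<not> t) = N + 1"
      "\<And>f :: bool \<Rightarrow> int. (\<Sum>b | bcol b = N. f b) = f t"
      "\<And>f :: bool \<Rightarrow> int. (\<Sum>b | bcol b = N + 1. f b) = f (\<not> t)"
proof (cases "n = N")
  case True
  then have c: "bcol b = N" for b using bcol by auto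
  have "(\<Sum>b | bcol b = N. f b) = f True + f False" for f :: "bool \<Rightarrow> int"
    unfolding c by (simp add: UNIV_bool)
  with True c show ?thesis using B by blast
next
  case False
  define t where "t \<longleftrightarrow> bcol True = N"
  have t: "n = N + 1" "bcol t = N" "bcol (\<not> t) = N + 1" using bcol False by (auto simp: t_def)
  have iff: "bcol b = N \<longleftrightarrow> b = t" "bcol b = N + 1 \<longleftrightarrow> b = (\<not> t)" for b
    using t(2,3) by (cases b; cases t; simp)+
  have "(\<Sum>b | bcol b = N. f b) = f t" "(\<Sum>b | bcol b = N + 1. f b) = f (\<not> t)"
    for f :: "bool \<Rightarrow> int" unfolding iff by simp_all
  then show ?thesis using D t by blast
qed

lemma cartan_col:
  assumes I: "(a, b) \<in> I" and i: "i \<in> {1..n}"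
  shows "cartan ltype n i (col (a, b)) =
    (if i < N then (if a = i then 2 else if a + 1 = i \<or> a = i + 1 then -1 else 0)
     else \<Sum>l | bcol l = i. (if a = N \<and> odd b = l then 2 else if a + 1 = N then -1 else 0))"
proof -
  have a: "1 \<le> a" "a \<le> N" "1 \<le> b" using I by (auto simp: idx_iff)
  have c: "col (a, b) = (if a < N then a else bcol (odd b))" by (simp add: col_def)
  show ?thesis
  proof (cases rule: bcol_cases)
    case B
    have lt: "ltype = TypeB" using B(1) unfolding ltype_def by simp
    have "i < N \<or> i = N" using B(1) i by auto
    then show ?thesis
    proof
      assume "i < N" then show ?thesis unfolding c lt unfolding B(1) cartan_TypeB B(2) using a N3 by auto
    next
      assume i: "i = N" show ?thesis unfolding c lt unfolding i B(1) B(3) cartan_TypeB B(2) using a N3 by auto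
    qed
  next
    case (D t)
    have lt: "ltype = TypeD" using D(1) unfolding ltype_def by simp
    have cc: "col (a, b) = (if a < N then a else if odd b = t then N else N + 1)"
      using c D(2,3) by (cases "odd b"; cases t) auto
    have "i < N \<or> i = N \<or> i = N + 1" using i D(1) by auto
    then show ?thesis
    proof (elim disjE)
      assume "i < N" then show ?thesis unfolding cc lt unfolding D(1) cartan_TypeD using a N3 by auto
    next
      assume i: "i = N" show ?thesis unfolding cc lt unfolding D(1) i cartan_TypeD D(4) using a N3 by (cases "odd b = t") auto
    next
      assume i: "i = N + 1" show ?thesis unfolding cc lt unfolding D(1) i cartan_TypeD D(5) using a N3 by (cases "odd b = t") auto
    qed
  qed
qed

lemma wt_raise:
  assumes p: "p \<in> I" and i: "i \<in> {1..n}"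
  shows "wt i (raise c p) = wt i c + cartan ltype n i (col p)"
proof -
  obtain a b where ab: "p = (a, b)" by fastforce
  have I: "(a, b) \<in> I" using p ab by simp
  have a: "1 \<le> a" "a \<le> N" using I by (auto simp: idx_iff)
  note r = rsum_raise[OF I, of c] csum_raise[OF I, of c]
  show ?thesis
  proof (cases "i < N")
    case True
    then show ?thesis unfolding ab cartan_col[OF I i] using a i by (auto simp: wt_def r)
  next
    case False
    have "2 * csum (raise c (a, b)) l - rsum (raise c (a, b)) (N - 1) - k =
       2 * csum c l - rsum c (N - 1) - k + (if a = N \<and> odd b = l then 2 else if a + 1 = N then -1 else 0)" for l k
      using a N3 by (auto simp: r)
    then show ?thesis unfolding ab cartan_col[OF I i] wt_def using False
      by (simp only: if_False if_not_P sum.distrib)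
  qed
qed

text \<open>In type B the sum has a single term; in type D adding the weights of the two end nodes
  removes the dependence on parity. One formula in row sums thus serves both types.\<close>

lemma wt_top_sum: "(\<Sum>i=N..n. wt i c) = 2 * rsum c N - 2 * rsum c (N - 1) - int m"
proof (cases rule: bcol_cases)
  case B
  show ?thesis unfolding B(1) using csum_rsum[of c] by (simp add: wt_def B(3))
next
  case (D t)
  have "(\<Sum>i=N..n. wt i c) = wt N c + wt (N + 1) c" unfolding D(1) by simp
  then show ?thesis using csum_rsum[of c] D(4,5) by (cases t) (simp_all add: wt_def)
qed

text \<open>Equal weights for the colors below \<open>N\<close> mean that the difference of the row
  sums has vanishing second differences. It starts at 0, hence is linear, and the colors of the last
  row force its last increment to be 0.\<close>

lemma wt_eq_imp_rsum:
  assumes e: "\<And>i. i \<in> {1..n} \<Longrightarrow> wt i c = wt i d" and i: "i \<le> N"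
  shows "rsum c i = rsum d i"
proof -
  define D where "D i = rsum c i - rsum d i" for i
  have D0: "D 0 = 0" by (simp add: D_def rsum_def)
  have rec: "D (i + 1) = 2 * D i - D (i - 1)" if "1 \<le> i" "i < N" for i
    using e[of i] that N_le_n by (simp add: wt_def D_def)
  have lin: "D i = int i * D 1 \<and> (i < N \<longrightarrow> D (i + 1) = int (i + 1) * D 1)" if "i \<le> N" for i
    using that
  proof (induction i)
    case (Suc i) then show ?case using rec[of "Suc i"] by (auto simp: algebra_simps)
  qed (use D0 in auto)
  have "(\<Sum>i=N..n. wt i c) = (\<Sum>i=N..n. wt i d)" using e N2 by (intro sum.cong) auto
  then have "D N = D (N - 1)" by (simp add: wt_top_sum D_def)
  moreover have "D N = int N * D 1" "D (N - 1) = int (N - 1) * D 1" using lin[of N] lin[of "N - 1"] by auto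
  ultimately have "int N * D 1 = (int N - 1) * D 1" using N2 by (simp add: of_nat_diff)
  then have "D 1 = 0" by (simp add: algebra_simps)
  then show ?thesis using lin[OF i] by (simp add: D_def)
qed

text \<open>Maximality saturates the pattern below row \<open>k + 1\<close>, so row sums determine
  all rows up to that one, and the rows above are shared. For \<open>k + 1 = N\<close> there are no
  rows above and the weight alone decides.\<close>

lemma kmax_wt_unique:
  assumes "k < N" "c \<in> V" "kmax k c" "d \<in> V" "kmax k d" and a: "k + 1 < N \<Longrightarrow> agree (k + 1) c d"
    and e: "\<And>i. i \<in> {1..n} \<Longrightarrow> wt i c = wt i d"
  shows "c = d"
proof (rule rowmax_eqI[of c "k + 1" d])
  show "c p = d p" if "p \<in> I" "fst p > k + 1" for p
  proof -
    have "k + 1 < N" using that by (cases p) (auto simp: idx_iff)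
    moreover have "col p > k + 1" using min_col[OF that(1)] that(2) by auto
    ultimately show ?thesis using a that(1) by (auto simp: agree_def)
  qed
  show "rsum c i = rsum d i" if "i \<le> k + 1" for i
    by (rule wt_eq_imp_rsum[OF e]) (use that assms in auto)
qed (use assms kmax_rowmax in auto)

definition topv :: array where "topv p = (if p \<in> I then m else 0)"

lemma topv_in: "topv \<in> V" by (auto simp: vertsB_def topv_def idx_iff)

lemma kmax_topv: "kmax n topv"
  unfolding kmax_def
proof (intro ballI impI)
  fix p assume "p \<in> I"
  then show "raise topv p \<notin> V" using vert_le_m[of "raise topv p" p] by (auto simp: topv_def raise_def)
qed

text \<open>All entries are \<open>m\<close>, so only the sizes of the two classes of columns
  matter. The boundary term compensates the parity of \<open>N\<close> and leaves the weight on the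
  color of the odd columns.\<close>

lemma wt_topv:
  assumes "i \<in> {1..n}"
  shows "wt i topv = (if i = bcol True then int m else 0)"
proof -
  have rs: "rsum topv i = int i * int m" if "i \<le> N" for i
    using that by (simp add: rsum_def topv_def idx_iff)
  have "(\<Sum>j=1..K. if odd j = b then int m else 0) = int ((K + (if b then 1 else 0)) div 2) * int m" for K :: nat and b
    by (induction K) (auto simp: algebra_simps elim!: oddE evenE)
  moreover have "csum topv b = (\<Sum>j=1..N. if odd j = b then int m else 0)" for b
    unfolding csum_def by (subst sum.inter_filter) (auto simp: topv_def idx_iff intro!: sum.cong)
  ultimately have cs: "csum topv True = int ((N + 1) div 2) * int m" "csum topv False = int (N div 2) * int m"
    by simp_all
  have ob: "2 * csum topv True - rsum topv (N - 1) - (if odd N then int m else 0) = int m"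
      "2 * csum topv False - rsum topv (N - 1) - (if odd N then 0 else int m) = 0"
    using N2 by (cases "odd N"; auto simp: cs rs of_nat_diff algebra_simps elim!: oddE evenE)+
  let ?f = "\<lambda>b. 2 * csum topv b - rsum topv (N - 1) - (if odd N = b then int m else 0)"
  have f: "?f b = (if b then int m else 0)" for b using ob by (cases b) auto
  show ?thesis
  proof (cases "i < N")
    case True
    then have "i \<noteq> bcol True" using bcol by auto
    then show ?thesis using True assms by (simp add: wt_def rs of_nat_diff algebra_simps)
  next
    case False
    then have w: "wt i topv = sum (\<lambda>b. if b then int m else 0) {b. bcol b = i}" unfolding wt_def f by simp
    show ?thesis
    proof (cases rule: bcol_cases)
      case B
      then have i: "i = N" using False assms by simp
      show ?thesis unfolding w unfolding i B(3) unfolding B(2) by simp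
    next
      case (D t)
      have bt: "bcol True = (if t then N else N + 1)" using D(2,3) by (cases t) auto
      have "i = N \<or> i = N + 1" using False assms D(1) by auto
      then show ?thesis
      proof
        assume i: "i = N" show ?thesis unfolding w bt unfolding i D(4) by simp
      next
        assume i: "i = N + 1" show ?thesis unfolding w bt unfolding i D(5) by simp
      qed
    qed
  qed
qed

text \<open>The coordinates of twice the sum of the positive coroots in the simple coroots; every
  simple root takes the value 4 on this vector. The doubling avoids the quotient
  \<open>N (N + 1) / 2\<close>. With \<open>N = n\<close> in type B and \<open>N = n - 1\<close> in
  type D the expressions coincide.\<close>

definition rr :: "nat \<Rightarrow> int" where
  "rr i = (if i < N then 2 * int i * (2 * int N + 1 - int i) else int N * (int N + 1))"

lemma rr_cartan:
  assumes j: "j \<in> {1..n}"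
  shows "(\<Sum>i=1..n. rr i * cartan ltype n i j) = 4"
proof -
  obtain M where M: "N = M + 3" using N3 by (metis add.commute le_iff_add)
  \<comment> \<open>The index 0 is included because \<open>rr 0 = 0\<close>; this spares a separate
    case for node 1, which has no left neighbor.\<close>
  have e: "(\<Sum>i=1..n. rr i * cartan X n' i j) = (\<Sum>i\<in>T. rr i * cartan X n' i j)"
    if "n' = n" "T \<subseteq> {0..n}" "\<And>i. i \<in> {0..n} - T \<Longrightarrow> cartan X n' i j = 0" for T X n'
  proof -
    have "(\<Sum>i=1..n. rr i * cartan X n' i j) = (\<Sum>i=0..n. rr i * cartan X n' i j)"
      using N3 by (intro sum.mono_neutral_left) (auto simp: rr_def Suc_le_eq)
    also have "\<dots> = (\<Sum>i\<in>T. rr i * cartan X n' i j)"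
      using that by (intro sum.mono_neutral_right) auto
    finally show ?thesis .
  qed
  have r: "rr i = (if i < M + 3 then 2 * int i * (2 * int M + 7 - int i) else (int M + 3) * (int M + 4))" for i
    unfolding rr_def using M by auto
  show ?thesis
  proof (cases "n = N")
    case True
    have lt: "ltype = TypeB" using True unfolding ltype_def by simp
    have c: "cartan TypeB N i j = (if i = j then 2 else if i = M + 3 \<and> j = M + 2 then -2
       else if i + 1 = j \<or> j + 1 = i then -1 else 0)" for i unfolding cartan_TypeB using M by auto
    note e = e[of N, unfolded True, OF refl]
    show ?thesis
    proof (cases "j = M + 3")
      case j3: True
      have "(\<Sum>i=1..N. rr i * cartan TypeB N i j) = (\<Sum>i\<in>{M+2, M+3}. rr i * cartan TypeB N i j)"
        by (rule e) (unfold c, use j3 M in auto)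
      then show ?thesis unfolding lt unfolding True c r using j3 by (simp add: algebra_simps)
    next
      case False
      then obtain J where J: "j = J + 1" "J \<le> M + 1" using j True M by (cases j) auto
      have "(\<Sum>i=1..N. rr i * cartan TypeB N i j) = (\<Sum>i\<in>{J, J+1, J+2}. rr i * cartan TypeB N i j)"
        by (rule e) (unfold c, use J M in auto)
      then show ?thesis unfolding lt unfolding True c r using J
        by (cases "J = M + 1") (auto simp: algebra_simps)
    qed
  next
    case False
    then have n: "n = N + 1" using N_le_n by simp
    have lt: "ltype = TypeD" using False unfolding ltype_def by simp
    have c: "cartan TypeD (N + 1) i j = (if i = j then 2
     else if (i = M + 2 \<and> j = M + 4) \<or> (i = M + 4 \<and> j = M + 2) then -1
     else if (i + 1 = j \<and> j \<le> M + 3) \<or> (j + 1 = i \<and> i \<le> M + 3) then -1 else 0)" for i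
      unfolding cartan_TypeD using M by auto
    note e = e[of "N + 1", unfolded n, OF refl]
    consider (a) "j \<le> M + 1" | (b) "j = M + 2" | (c) "j = M + 3" | (d) "j = M + 4" using j n M by fastforce
    then show ?thesis
    proof cases
      case a
      then obtain J where J: "j = J + 1" "J \<le> M" using j by (cases j) auto
      have "(\<Sum>i=1..N+1. rr i * cartan TypeD (N+1) i j) = (\<Sum>i\<in>{J, J+1, J+2}. rr i * cartan TypeD (N+1) i j)"
        by (rule e) (unfold c, use J M n in auto)
      then show ?thesis unfolding lt unfolding n c r using J by (auto simp: algebra_simps)
    next
      case b
      have "(\<Sum>i=1..N+1. rr i * cartan TypeD (N+1) i j) = (\<Sum>i\<in>{M+1, M+2, M+3, M+4}. rr i * cartan TypeD (N+1) i j)"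
        by (rule e) (unfold c, use b M n in auto)
      then show ?thesis unfolding lt unfolding n c r using b by (auto simp: algebra_simps)
    next
      case c': c
      have "(\<Sum>i=1..N+1. rr i * cartan TypeD (N+1) i j) = (\<Sum>i\<in>{M+2, M+3}. rr i * cartan TypeD (N+1) i j)"
        by (rule e) (unfold c, use c' M n in auto)
      then show ?thesis unfolding lt unfolding n c r using c' by (auto simp: algebra_simps)
    next
      case d
      have "(\<Sum>i=1..N+1. rr i * cartan TypeD (N+1) i j) = (\<Sum>i\<in>{M+2, M+4}. rr i * cartan TypeD (N+1) i j)"
        by (rule e) (unfold c, use d M n in auto)
      then show ?thesis unfolding lt unfolding n c r using d by (auto simp: algebra_simps)
    qed
  qed
qed

end

section \<open>Gelfand-Tsetlin coefficients\<close>

context tri_pattern begin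

text \<open>Adding the column number makes the rows of a pattern strictly increasing. These shifted
  entries are the nodes and roots of the interpolation.\<close>

definition lv :: "array \<Rightarrow> nat \<times> nat \<Rightarrow> complex" where "lv c p = of_nat (c p) + of_nat (snd p)"

definition same :: "nat \<times> nat \<Rightarrow> nat \<times> nat \<Rightarrow> bool" where
  "same p q \<longleftrightarrow> fst p = fst q \<and> (fst p = N \<longrightarrow> odd (snd p) = odd (snd q))"

text \<open>Rational normalization, free of square roots: factors from the row above enter the
  raising coefficient \<open>fP\<close>, those from the row below the lowering coefficient
  \<open>fQ\<close>. Both coefficients of an edge are indexed by its lower end, where
  \<open>u\<close> is measured; an offset of 1 means a difference taken at the upper end.\<close>

definition fP :: "nat \<times> nat \<Rightarrow> nat \<times> nat \<Rightarrow> complex \<Rightarrow> complex" where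
  "fP p q u = (if fst q = fst p + 1 then u - 1 else if same p q then 1 / u else 1)"

definition fQ :: "nat \<times> nat \<Rightarrow> nat \<times> nat \<Rightarrow> complex \<Rightarrow> complex" where
  "fQ p q u = (if fst q + 1 = fst p then u else if same p q then 1 / (u - 1) else 1)"

text \<open>In row N the factors coming from a row N + 1 and from the entries of the other parity cancel. What remains
  of them are the two boundary factors.\<close>
definition own :: "array \<Rightarrow> nat \<times> nat \<Rightarrow> complex" where
  "own c p = (if fst p < N then -1 else
     - ((if odd (snd p) then - lv c p else 1) * (if odd (snd p) = odd N then of_nat m + of_nat N - lv c p else 1)))"

definition cP :: "array \<Rightarrow> nat \<times> nat \<Rightarrow> complex" where
  "cP c p = own c p * (\<Prod>q\<in>I-{p}. fP p q (lv c q - lv c p))"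

definition cQ :: "array \<Rightarrow> nat \<times> nat \<Rightarrow> complex" where
  "cQ c p = (\<Prod>q\<in>I-{p}. fQ p q (lv c q - lv c p))"

lemma lv_raise: "lv (raise c p) q = lv c q + (if q = p then 1 else 0)"
  by (simp add: lv_def raise_apply)

text \<open>Raising \<open>q\<close> changes only the factor of the pair \<open>p\<close>,
  \<open>q\<close> in the coefficient at \<open>p\<close>, and conversely. What remains is the
  identity \<open>fe\<close> in the single difference \<open>u\<close>.\<close>

lemma coeff_diamond:
  assumes "p \<in> I" "q \<in> I" "p \<noteq> q"
  shows "cP d p * cQ d q = cP (raise d q) p * cQ (raise d p) q"
proof -
  have s: "I - {p} = insert q (I - {p, q})" "I - {q} = insert p (I - {p, q})" using assms by auto
  define u where "u = lv d q - lv d p"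
  have P: "cP c p = own c p * (fP p q (lv c q - lv c p) * (\<Prod>r\<in>I-{p,q}. fP p r (lv c r - lv c p)))" for c
    unfolding cP_def s(1) by (subst prod.insert) auto
  have Q: "cQ c q = fQ q p (lv c p - lv c q) * (\<Prod>r\<in>I-{p,q}. fQ q r (lv c r - lv c q))" for c
    unfolding cQ_def s(2) by (subst prod.insert) auto
  have 1: "own (raise d q) p = own d p" using assms by (simp add: own_def lv_raise)
  have 2: "(\<Prod>r\<in>I-{p,q}. fP p r (lv (raise d q) r - lv (raise d q) p)) = (\<Prod>r\<in>I-{p,q}. fP p r (lv d r - lv d p))"
    using assms by (intro prod.cong) (auto simp: lv_raise)
  have 3: "(\<Prod>r\<in>I-{p,q}. fQ q r (lv (raise d p) r - lv (raise d p) q)) = (\<Prod>r\<in>I-{p,q}. fQ q r (lv d r - lv d q))"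
    using assms by (intro prod.cong) (auto simp: lv_raise)
  have sym: "same q p = same p q" by (auto simp: same_def)
  have fe: "fP p q u * fQ q p (- u) = fP p q (u + 1) * fQ q p (1 - u)"
  proof -
    consider (a) "fst q = fst p + 1" | (b) "fst q \<noteq> fst p + 1" "same p q" | (c) "fst q \<noteq> fst p + 1" "\<not> same p q" by blast
    then show ?thesis
    proof cases
      case b
      have "u * (- u - 1) = (u + 1) * (- u)" by (simp add: algebra_simps)
      then show ?thesis using b by (simp add: fP_def fQ_def sym)
    qed (simp_all add: fP_def fQ_def sym algebra_simps)
  qed
  have e: "lv d p - lv d q = - u" "lv d q - lv d p = u" "lv (raise d q) q - lv (raise d q) p = u + 1"
    "lv (raise d p) p - lv (raise d p) q = 1 - u"
    using assms by (auto simp: u_def lv_raise)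
  have 4: "fP p q (lv d q - lv d p) * fQ q p (lv d p - lv d q) =
     fP p q (lv (raise d q) q - lv (raise d q) p) * fQ q p (lv (raise d p) p - lv (raise d p) q)"
    unfolding e by (rule fe)
  have "cP d p * cQ d q = own d p * (fP p q (lv d q - lv d p) * fQ q p (lv d p - lv d q)) *
     ((\<Prod>r\<in>I-{p,q}. fP p r (lv d r - lv d p)) * (\<Prod>r\<in>I-{p,q}. fQ q r (lv d r - lv d q)))"
    unfolding P Q by (simp only: mult_ac)
  also have "\<dots> = cP (raise d q) p * cQ (raise d p) q"
    unfolding 4 P Q 1 2 3 by (simp only: mult_ac)
  finally show ?thesis .
qed

section \<open>Allowed and blocked moves in terms of the coefficients\<close>

lemma row_mono:
  assumes c: "c \<in> V" and "1 \<le> j" "j \<le> l" "l \<le> i" "i \<le> N"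
  shows "c (i, j) \<le> c (i, l)"
  using assms(3,4)
proof (induction l rule: dec_induct)
  case (step l)
  then show ?case using vert_row[OF c, of l i] assms by simp
qed simp

lemma lv_ne:
  assumes "c p + snd p \<noteq> c q + snd q + k" shows "lv c p - lv c q \<noteq> of_nat k"
proof
  assume "lv c p - lv c q = of_nat k"
  then have "of_nat (c p + snd p) = (of_nat (c q + snd q + k) :: complex)"
    by (simp add: lv_def algebra_simps)
  with assms show False using of_nat_eq_iff by blast
qed

text \<open>Interlacing, sharpened by the fact that \<open>p\<close> can be raised, excludes every
  coincidence of shifted entries that would annihilate a factor. Denominators have to be checked
  too, since division by 0 yields 0.\<close>

lemma coeff_nonzero:
  assumes c: "c \<in> V" and p: "p \<in> I" and r: "raise c p \<in> V"
  shows "cP c p \<noteq> 0" "cQ c p \<noteq> 0"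
proof -
  obtain i j where ij: "p = (i, j)" by fastforce
  have b: "1 \<le> j" "j \<le> i" "i \<le> N" using p by (auto simp: ij idx_iff)
  note r' = r[unfolded ij raise_in_iff[OF c p[unfolded ij]]]
  have above: "c q + snd q \<noteq> c p + snd p + 1" if q: "q \<in> I" "fst q = i + 1" for q
  proof -
    obtain l where l: "q = (i + 1, l)" "1 \<le> l" "l \<le> i + 1" "i < N" using q by (cases q) (auto simp: idx_iff)
    have 1: "c (i, j) < c (i + 1, j + 1)" using r' l by auto
    consider "l \<le> j" | "l \<ge> j + 1" by linarith
    then show ?thesis
    proof cases
      case 1
      then have "c (i + 1, l) \<le> c (i + 1, j)" using row_mono[OF c, of l j "i + 1"] l b by auto
      also have "\<dots> \<le> c (i, j)" using vertD(1)[OF c, of j i] l b by auto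
      finally show ?thesis using 1 l ij by simp
    next
      case 2
      then have "c (i + 1, j + 1) \<le> c (i + 1, l)" using row_mono[OF c, of "j + 1" l "i + 1"] l b by auto
      then show ?thesis using 1 2 l ij by simp
    qed
  qed
  have row: "c q + snd q \<noteq> c p + snd p \<and> c q + snd q \<noteq> c p + snd p + 1" if q: "q \<in> I" "fst q = i" "q \<noteq> p" for q
  proof -
    obtain l where l: "q = (i, l)" "1 \<le> l" "l \<le> i" "l \<noteq> j" using q ij by (cases q) (auto simp: idx_iff)
    consider "l < j" | "l > j" using l by linarith
    then show ?thesis
    proof cases
      case 1
      then show ?thesis using row_mono[OF c, of l j i] l b ij by auto
    next
      case 2
      then have i1: "j \<le> i - 1" "i - 1 < N" "i - 1 + 1 = i" using l b by auto
      have "c (i, j) < c (i - 1, j)" using r' 2 l by auto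
      also have "\<dots> \<le> c (i, j + 1)" using vertD(2)[OF c b(1) i1(1,2)] i1(3) by simp
      also have "\<dots> \<le> c (i, l)" using row_mono[OF c, of "j + 1" l i] 2 l b by auto
      finally show ?thesis using 2 l ij by simp
    qed
  qed
  have below: "c q + snd q \<noteq> c p + snd p" if q: "q \<in> I" "fst q + 1 = i" for q
  proof -
    obtain l where l: "q = (i - 1, l)" "1 \<le> l" "l \<le> i - 1" "i - 1 + 1 = i" using q by (cases q) (auto simp: idx_iff)
    consider "l < j" | "l = j" | "l > j" by linarith
    then show ?thesis
    proof cases
      case 1
      have "c (i - 1, l) \<le> c (i, l + 1)" using vertD(2)[OF c l(2,3)] l b by auto
      also have "\<dots> \<le> c (i, j)" using row_mono[OF c, of "l + 1" j i] 1 l b by auto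
      finally show ?thesis using 1 l ij by simp
    next
      case 2 then show ?thesis using r' l b ij by auto
    next
      case 3
      have "c (i, j) \<le> c (i, l)" using row_mono[OF c, of j l i] 3 l b by auto
      also have "\<dots> \<le> c (i - 1, l)" using vertD(1)[OF c l(2,3)] l b by auto
      finally show ?thesis using 3 l ij by simp
    qed
  qed
  have lvp: "lv c p \<noteq> 0"
  proof -
    have "lv c p = of_nat (c p + snd p)" by (simp add: lv_def)
    then show ?thesis using b ij by (simp only: of_nat_eq_0_iff) simp
  qed
  have "of_nat m + of_nat N - lv c p \<noteq> 0" if "i = N" "odd j = odd N"
  proof -
    have "c p + j < m + N"
    proof (cases "j = N")
      case True then show ?thesis using r' that ij by auto
    next
      case False
      then show ?thesis using vert_le_m[OF c, of p] b by auto
    qed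
    moreover have "of_nat m + of_nat N - lv c p = of_nat (m + N) - of_nat (c p + j)" by (simp add: lv_def ij)
    ultimately show ?thesis by (metis eq_iff_diff_eq_0 less_irrefl of_nat_eq_iff)
  qed
  then have "own c p \<noteq> 0" using lvp b by (auto simp: own_def ij)
  moreover have "fP p q (lv c q - lv c p) \<noteq> 0" if "q \<in> I - {p}" for q
    using lv_ne[of c q p 1] lv_ne[of c q p 0] above[of q] row[of q] that by (auto simp: fP_def same_def ij)
  moreover have "fQ p q (lv c q - lv c p) \<noteq> 0" if "q \<in> I - {p}" for q
    using lv_ne[of c q p 1] lv_ne[of c q p 0] below[of q] row[of q] that by (auto simp: fQ_def same_def ij)
  ultimately show "cP c p \<noteq> 0" "cQ c p \<noteq> 0" by (auto simp: cP_def cQ_def)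
qed

text \<open>Each alternative names the neighbor, or the bound \<open>m\<close>, that stands in the
  way; it will turn out to be a root of the numerator of the corresponding move.\<close>

lemma raise_blocked:
  assumes "c \<in> V" "(i, j) \<in> I" "raise c (i, j) \<notin> V"
  shows "(i < N \<and> c (i + 1, j + 1) = c (i, j)) \<or> (j < i \<and> c (i - 1, j) = c (i, j)) \<or> (i = N \<and> j = N \<and> c (i, j) = m)"
proof -
  have b: "1 \<le> j" "j \<le> i" "i \<le> N" using assms by (auto simp: idx_iff)
  have "i < N \<Longrightarrow> c (i, j) \<le> c (i + 1, j + 1)" using vertD(2)[OF assms(1), of j i] b by auto
  moreover have "j < i \<Longrightarrow> c (i, j) \<le> c (i - 1, j)" using vertD(1)[OF assms(1), of j "i - 1"] b by auto
  ultimately show ?thesis using assms(3) raise_in_iff[OF assms(1,2)] vert_le_m[OF assms(1), of "(i, j)"] b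
    by (auto split: if_splits)
qed

lemma lower_blocked:
  assumes c: "c \<in> V" and p: "(i, j) \<in> I" and n: "\<not> (c (i, j) > 0 \<and> lower c (i, j) \<in> V)"
  shows "(i < N \<and> c (i + 1, j) = c (i, j)) \<or> (1 < j \<and> c (i - 1, j - 1) = c (i, j)) \<or> (i = N \<and> j = 1 \<and> c (i, j) = 0)"
proof (rule ccontr)
  assume a: "\<not> ?thesis"
  have b: "1 \<le> j" "j \<le> i" "i \<le> N" using p by (auto simp: idx_iff)
  have 1: "c (i + 1, j) < c (i, j)" if "i < N"
    using vertD(1)[OF c b(1,2) that] a that by auto
  have 2: "c (i - 1, j - 1) < c (i, j)" if "1 < j"
  proof -
    have "1 \<le> j - 1" "j - 1 \<le> i - 1" "i - 1 < N" "i - 1 + 1 = i" "j - 1 + 1 = j" using b that by auto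
    then show ?thesis using vertD(2)[OF c, of "j - 1" "i - 1"] a that by auto
  qed
  have "c (i, j) > 0"
  proof (cases "i < N")
    case False
    then show ?thesis using a b 2 by (cases "j = 1") auto
  qed (use 1 in auto)
  moreover have "lower c (i, j) \<in> V"
  proof (rule vertI)
    fix k l assume kl: "1 \<le> l" "l \<le> k" "k < N"
    have "(k, l) = (i, j) \<Longrightarrow> c (k + 1, l) < c (i, j)" using 1 kl by auto
    moreover have "(k + 1, l + 1) = (i, j) \<Longrightarrow> c (k, l) < c (i, j)" using 2 kl by auto
    ultimately show "lower c (i, j) (k + 1, l) \<le> lower c (i, j) (k, l) \<and> lower c (i, j) (k, l) \<le> lower c (i, j) (k + 1, l + 1)"
      using vertD[OF c kl] by (auto simp: lower_def)
  next
    show "lower c (i, j) p = 0" if "p \<notin> idxB N" for p using vert_out[OF c that] by (auto simp: lower_def)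
    show "lower c (i, j) (N, N) \<le> m" using vert_le_m[OF c, of "(N, N)"] by (auto simp: lower_def)
  qed
  ultimately show False using n by simp
qed

section \<open>The diagonal of the commutator of x i and y i\<close>

definition ppi :: "array \<Rightarrow> nat \<times> nat \<Rightarrow> complex" where "ppi c p = cP c p * cQ c p"

text \<open>Roots of the numerator attached to the row k (to the class b if k = N).
  The indices (0,0) and (0,1) stand for the two boundary factors in row N.\<close>
definition rootidx :: "nat \<Rightarrow> bool \<Rightarrow> (nat \<times> nat) set" where
  "rootidx k b = {p \<in> I. fst p = k + 1 \<or> fst p + 1 = k}
     \<union> (if k = N \<and> b then {(0, 0)} else {}) \<union> (if k = N \<and> b = odd N then {(0, 1)} else {})"

text \<open>The two boundary roots are shifted entries of virtual cells of row \<open>N + 1\<close>: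
  value 0 in column 1 and value \<open>m\<close> in column \<open>N + 1\<close>. The added 1 for the
  row below makes every numerator factor a difference from \<open>lv c p + 1\<close>.\<close>

definition root :: "array \<Rightarrow> nat \<Rightarrow> nat \<times> nat \<Rightarrow> complex" where
  "root c k p = (if p = (0, 0) then 1 else if p = (0, 1) then of_nat m + of_nat N + 1
     else if fst p = k + 1 then lv c p else lv c p + 1)"

definition block :: "nat \<Rightarrow> bool \<Rightarrow> (nat \<times> nat) set" where
  "block k b = {p \<in> I. fst p = k \<and> (k = N \<longrightarrow> odd (snd p) = b)}"

lemma zero_notin: "(0, j) \<notin> I" by (simp add: idx_iff)

lemma finite_block [simp]: "finite (block k b)" "finite (rootidx k b)"
  by (auto simp: block_def rootidx_def)

lemma ppi_eq:
  assumes p: "p \<in> block k b"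
  shows "ppi c p = - (\<Prod>q\<in>rootidx k b. root c k q - (lv c p + 1)) /
     (\<Prod>q\<in>block k b - {p}. (lv c q - lv c p) * (lv c q - lv c p - 1))"
proof -
  have pI: "p \<in> I" "fst p = k" "k = N \<longrightarrow> odd (snd p) = b" using p by (auto simp: block_def)
  define R where "R = {q \<in> I. fst q = k + 1 \<or> fst q + 1 = k}"
  have "(\<Prod>q\<in>I-{p}. fP p q (lv c q - lv c p)) * (\<Prod>q\<in>I-{p}. fQ p q (lv c q - lv c p)) =
     (\<Prod>q\<in>I-{p}. (if q \<in> R then root c k q - (lv c p + 1) else 1) *
        (if q \<in> block k b - {p} then 1 / ((lv c q - lv c p) * (lv c q - lv c p - 1)) else 1))"
    unfolding prod.distrib[symmetric]
  proof (rule prod.cong[OF refl])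
    fix q assume q: "q \<in> I - {p}"
    then have q0: "q \<noteq> (0, 0)" "q \<noteq> (0, 1)" using zero_notin by auto
    have s: "same p q \<longleftrightarrow> q \<in> block k b - {p}" using q pI by (auto simp: same_def block_def)
    show "fP p q (lv c q - lv c p) * fQ p q (lv c q - lv c p) = (if q \<in> R then root c k q - (lv c p + 1) else 1) *
        (if q \<in> block k b - {p} then 1 / ((lv c q - lv c p) * (lv c q - lv c p - 1)) else 1)"
      unfolding s[symmetric] using q q0 pI
      by (auto simp: fP_def fQ_def R_def root_def same_def)
  qed
  also have "\<dots> = (\<Prod>q\<in>R. root c k q - (lv c p + 1)) *
      (\<Prod>q\<in>block k b - {p}. 1 / ((lv c q - lv c p) * (lv c q - lv c p - 1)))"
  proof -
    have e: "{q \<in> I - {p}. q \<in> R} = R" "{q \<in> I - {p}. q \<in> block k b - {p}} = block k b - {p}"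
      using pI by (auto simp: R_def block_def)
    have f: "finite (I - {p})" by simp
    show ?thesis
      unfolding prod.distrib prod.inter_filter[OF f, symmetric] e ..
  qed
  finally have A: "ppi c p = own c p * ((\<Prod>q\<in>R. root c k q - (lv c p + 1)) *
      (\<Prod>q\<in>block k b - {p}. 1 / ((lv c q - lv c p) * (lv c q - lv c p - 1))))"
    by (simp add: ppi_def cP_def cQ_def mult.assoc)
  have Rn: "(0, 0) \<notin> R" "(0, 1) \<notin> R" "finite R" using zero_notin by (auto simp: R_def)
  have B: "(\<Prod>q\<in>rootidx k b. root c k q - (lv c p + 1)) = - own c p * (\<Prod>q\<in>R. root c k q - (lv c p + 1))"
  proof -
    have ri: "rootidx k b = R \<union> (if k = N \<and> b then {(0, 0)} else {}) \<union> (if k = N \<and> b = odd N then {(0, 1)} else {})"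
      by (simp add: rootidx_def R_def)
    have r0: "root c k (0, 0) - (lv c p + 1) = - lv c p" "root c k (0, 1) - (lv c p + 1) = of_nat m + of_nat N - lv c p"
      by (auto simp: root_def)
    show ?thesis
    proof (cases "k = N")
      case True
      then have o: "own c p = - ((if b then - lv c p else 1) * (if b = odd N then of_nat m + of_nat N - lv c p else 1))"
        using pI by (simp add: own_def)
      show ?thesis unfolding ri o using True Rn r0
        by (cases b; cases "odd N") (simp_all add: mult_ac)
    next
      case False
      then have "own c p = -1" using pI by (cases p) (auto simp: own_def idx_iff)
      then show ?thesis unfolding ri using False by simp
    qed
  qed
  have "(\<Prod>q\<in>block k b - {p}. 1 / ((lv c q - lv c p) * (lv c q - lv c p - 1))) =
      1 / (\<Prod>q\<in>block k b - {p}. (lv c q - lv c p) * (lv c q - lv c p - 1))"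
    by (subst prod_dividef) simp
  then show ?thesis unfolding A B by simp
qed

text \<open>The contribution to the diagonal of \<open>y x\<close> that passes through
  \<open>raise c p\<close>; \<open>down_pi\<close> is the contribution to the diagonal of
  \<open>x y\<close> through \<open>lower c p\<close>.\<close>

definition up_pi :: "array \<Rightarrow> nat \<times> nat \<Rightarrow> complex" where
  "up_pi c p = (if raise c p \<in> V then ppi c p else 0)"
definition down_pi :: "array \<Rightarrow> nat \<times> nat \<Rightarrow> complex" where
  "down_pi c p = (if c p > 0 \<and> lower c p \<in> V then ppi (lower c p) p else 0)"

text \<open>A blocked move contributes 0 by definition, and the closed formula agrees because
  whatever blocks it is a root of the numerator. Lowering \<open>p\<close> moves only the node of
  \<open>p\<close>, since \<open>p\<close> is not among the indices of the roots.\<close>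

lemma down_up_gt_term:
  assumes c: "c \<in> V" and p: "p \<in> block k b"
  shows "down_pi c p - up_pi c p = gt_term (lv c) (root c k) (block k b) (rootidx k b) p"
proof -
  obtain j where j: "p = (k, j)" "(k, j) \<in> I" "k = N \<Longrightarrow> odd j = b" using p by (cases p) (auto simp: block_def)
  then have b: "1 \<le> j" "j \<le> k" "k \<le> N" by (auto simp: idx_iff)
  have z: "prod f (rootidx k b) = 0" if "q \<in> rootidx k b" "f q = 0" for f :: "nat \<times> nat \<Rightarrow> complex" and q
    using that by (intro prod_zero) auto
  have U: "up_pi c p = - (\<Prod>q\<in>rootidx k b. root c k q - (lv c p + 1)) /
     (\<Prod>q\<in>block k b - {p}. (lv c q - lv c p) * (lv c q - lv c p - 1))"
  proof (cases "raise c p \<in> V")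
    case True then show ?thesis by (simp add: up_pi_def ppi_eq[OF p])
  next
    case False
    from raise_blocked[OF c j(2) False[unfolded j]]
    have "(\<Prod>q\<in>rootidx k b. root c k q - (lv c p + 1)) = 0"
    proof (elim disjE conjE)
      assume "k < N" "c (k + 1, j + 1) = c (k, j)"
      then show ?thesis using b by (intro z[of "(k + 1, j + 1)"]) (auto simp: rootidx_def idx_iff root_def lv_def j)
    next
      assume "j < k" "c (k - 1, j) = c (k, j)"
      then show ?thesis using b by (intro z[of "(k - 1, j)"]) (auto simp: rootidx_def idx_iff root_def lv_def j)
    next
      assume e: "k = N" "j = N" "c (k, j) = m"
      then have "b = odd N" using j(3) by simp
      then have "(0, 1) \<in> rootidx k b" using e(1) unfolding rootidx_def by simp
      moreover have "root c k (0, 1) = lv c p + 1" unfolding root_def lv_def j(1) using e by simp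
      ultimately show ?thesis by (intro z[of "(0, 1)"]) auto
    qed
    moreover have "up_pi c p = 0" unfolding up_pi_def by (rule if_not_P[OF False])
    ultimately show ?thesis by (simp only: minus_zero div_0)
  qed
  have D: "down_pi c p = - (\<Prod>q\<in>rootidx k b. root c k q - lv c p) /
     (\<Prod>q\<in>block k b - {p}. (lv c q - lv c p) * (lv c q - lv c p + 1))"
  proof (cases "c p > 0 \<and> lower c p \<in> V")
    case True
    have l: "lv (lower c p) p = lv c p - 1" "q \<noteq> p \<Longrightarrow> lv (lower c p) q = lv c q" for q
      using True by (auto simp: lv_def lower_def)
    have "p \<notin> rootidx k b" using j zero_notin by (auto simp: rootidx_def)
    then have "root (lower c p) k q = root c k q" if "q \<in> rootidx k b" for q
      using that l(2)[of q] by (auto simp: root_def)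
    then have 1: "(\<Prod>q\<in>rootidx k b. root (lower c p) k q - (lv (lower c p) p + 1)) = (\<Prod>q\<in>rootidx k b. root c k q - lv c p)"
      by (intro prod.cong) (auto simp: l)
    have 2: "(\<Prod>q\<in>block k b - {p}. (lv (lower c p) q - lv (lower c p) p) * (lv (lower c p) q - lv (lower c p) p - 1))
       = (\<Prod>q\<in>block k b - {p}. (lv c q - lv c p) * (lv c q - lv c p + 1))"
      by (intro prod.cong) (auto simp: l algebra_simps)
    show ?thesis using True by (simp add: down_pi_def ppi_eq[OF p] 1 2)
  next
    case False
    from lower_blocked[OF c j(2) False[unfolded j]]
    have "(\<Prod>q\<in>rootidx k b. root c k q - lv c p) = 0"
    proof (elim disjE conjE)
      assume "k < N" "c (k + 1, j) = c (k, j)"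
      then show ?thesis using b by (intro z[of "(k + 1, j)"]) (auto simp: rootidx_def idx_iff root_def lv_def j)
    next
      assume "1 < j" "c (k - 1, j - 1) = c (k, j)"
      then show ?thesis using b by (intro z[of "(k - 1, j - 1)"]) (auto simp: rootidx_def idx_iff root_def lv_def j of_nat_diff)
    next
      assume "k = N" "j = 1" "c (k, j) = 0"
      then have "b = True" using j(3) by simp
      then have "(0, 0) \<in> rootidx k b" using \<open>k = N\<close> unfolding rootidx_def by simp
      moreover have "root c k (0, 0) = lv c p" unfolding root_def lv_def j(1) using \<open>j = 1\<close> \<open>c (k, j) = 0\<close> by simp
      ultimately show ?thesis by (intro z[of "(0, 0)"]) auto
    qed
    moreover have "down_pi c p = 0" unfolding down_pi_def by (rule if_not_P[OF False])
    ultimately show ?thesis by (simp only: minus_zero div_0)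
  qed
  show ?thesis unfolding U D gt_term_def by simp
qed

text \<open>Accounts for the column shifts in the last row: those of the nodes of one class on the
  left, those of the roots on the right.\<close>

lemma odd_sum:
  assumes "K \<ge> 1"
  shows "(\<Sum>l | l \<in> {1..K} \<and> odd l = b. 2 * int l + 1) =
    (\<Sum>l=1..K-1. int l + 1) + (if b then 1 else 0) + (if odd K = b then int K + 1 else 0)"
proof -
  have "(\<Sum>l=1..K. if odd l = b then 2 * int l + 1 else 0) =
    (\<Sum>l=1..K-1. int l + 1) + (if b then 1 else 0) + (if odd K = b then int K + 1 else 0)"
    using assms
  proof (induction K rule: dec_induct)
    case (step K)
    have "(\<Sum>l=1..K. int l + 1) = (\<Sum>l=1..K-1. int l + 1) + (int K + 1)"
      using step by (cases K) auto
    then show ?case using step by (cases "odd K"; cases b) auto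
  qed auto
  then show ?thesis by (simp only: sum.inter_filter[OF finite_atLeastAtMost])
qed

lemma row_positions: "{p \<in> I. fst p = k} = Pair k ` (if k \<le> N then {1..k} else {})"
  by (auto simp: idx_iff)

lemma block_gt_sum:
  assumes c: "c \<in> V" and k: "1 \<le> k" "k \<le> N"
  shows "(\<Sum>p\<in>block k b. down_pi c p - up_pi c p) =
    of_int (if k < N then 2 * rsum c k - rsum c (k - 1) - rsum c (k + 1)
      else 2 * csum c b - rsum c (N - 1) - (if odd N = b then int m else 0))"
proof -
  have strict: "lv c (k, i) \<noteq> lv c (k, j)" "lv c (k, i) + 1 = lv c (k, j) \<Longrightarrow> j = i + 1 \<and> c (k, i) = c (k, j)"
    if "1 \<le> i" "i \<le> k" "1 \<le> j" "j \<le> k" "i \<noteq> j" for i j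
  proof -
    have e: "lv c (k, i) = lv c (k, j) \<longleftrightarrow> c (k, i) + i = c (k, j) + j"
        "lv c (k, i) + 1 = lv c (k, j) \<longleftrightarrow> c (k, i) + i + 1 = c (k, j) + j"
      unfolding lv_def by (simp_all flip: of_nat_add of_nat_Suc add: add.commute)
    have "i < j \<Longrightarrow> c (k, i) \<le> c (k, j)" "j < i \<Longrightarrow> c (k, j) \<le> c (k, i)"
      using row_mono[OF c, of i j k] row_mono[OF c, of j i k] that k by auto
    then show "lv c (k, i) \<noteq> lv c (k, j)" "lv c (k, i) + 1 = lv c (k, j) \<Longrightarrow> j = i + 1 \<and> c (k, i) = c (k, j)"
      using e that by (cases "i < j"; fastforce)+
  qed
  have inj: "inj_on (lv c) (block k b)"
    using strict(1) by (auto simp: inj_on_def block_def idx_iff)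
  \<comment> \<open>Nodes differ by 1 only for equal neighboring entries. Interlacing squeezes the
    entry between them in row \<open>k - 1\<close> and the one between them in row
    \<open>k + 1\<close> to the same value, and these give the required roots. In the last row the
    columns of a class differ by at least 2, so no collision occurs.\<close>
  have coll: "(\<exists>q\<in>rootidx k b. root c k q = lv c p + 1 \<and> of_nat (snd q) = (of_nat (snd p) :: complex)) \<and>
      (\<exists>q\<in>rootidx k b. root c k q = lv c p' \<and> of_nat (snd q) = (of_nat (snd p') :: complex))"
    if pp: "p \<in> block k b" "p' \<in> block k b" and e: "lv c p + 1 = lv c p'" for p p'
  proof -
    obtain i j where ij: "p = (k, i)" "p' = (k, j)" using pp by (cases p; cases p') (auto simp: block_def)
    have b: "1 \<le> i" "i \<le> k" "1 \<le> j" "j \<le> k" using pp by (auto simp: ij block_def idx_iff)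
    have "i \<noteq> j" using e ij by auto
    from strict(2)[OF b this] e have s: "j = i + 1" "c (k, i) = c (k, j)" by (auto simp: ij)
    have kN: "k < N"
    proof (rule ccontr)
      assume "\<not> k < N"
      then have "odd i = odd j" using pp k by (auto simp: block_def ij)
      with s show False by simp
    qed
    have v: "c (k - 1, i) = c (k, i)"
    proof -
      have h: "i \<le> k - 1" "k - 1 < N" "k - 1 + 1 = k" using b s kN by auto
      show ?thesis using vertD[OF c b(1) h(1,2)] h(3) s by auto
    qed
    have w: "c (k + 1, j) = c (k, j)"
      using vertD(1)[OF c b(3,4) kN] vertD(2)[OF c b(1,2) kN] s by auto
    have "(k - 1, i) \<in> rootidx k b" "root c k (k - 1, i) = lv c p + 1"
      using b s kN v by (auto simp: rootidx_def idx_iff root_def lv_def ij)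
    moreover have "(k + 1, j) \<in> rootidx k b" "root c k (k + 1, j) = lv c p'"
      using b kN w by (auto simp: rootidx_def idx_iff root_def lv_def ij)
    ultimately show ?thesis using ij by force
  qed
  have sumrow: "(\<Sum>p | p \<in> I \<and> fst p = i. f p) = (\<Sum>l=1..i. f (i, l))" if "i \<le> N" for i and f :: "nat \<times> nat \<Rightarrow> complex"
    unfolding row_positions using that by (simp add: sum.reindex inj_on_def)
  have cardrow: "card {p \<in> I. fst p = i} = i" if "i \<le> N" for i
    unfolding row_positions using that by (simp add: card_image inj_on_def)
  define A where "A = {p \<in> I. fst p = k + 1}"
  define B where "B = {p \<in> I. fst p = k - 1}"
  have Bk: "{p \<in> I. fst p + 1 = k} = B" using k by (auto simp: B_def)
  have AB: "finite A" "finite B" "A \<inter> B = {}" "(0, 0) \<notin> A" "(0, 0) \<notin> B" "(0, 1) \<notin> A" "(0, 1) \<notin> B"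
    using zero_notin k by (auto simp: A_def B_def)
  have rootA: "p \<in> A \<Longrightarrow> root c k p = lv c p" and rootB: "p \<in> B \<Longrightarrow> root c k p = lv c p + 1" for p
    using AB(4-7) k by (auto simp: root_def A_def B_def)
  have cB: "card B = k - 1" using cardrow[of "k - 1"] k by (simp add: B_def)
  have sB: "(\<Sum>p\<in>B. root c k p) = (\<Sum>l=1..k-1. lv c (k - 1, l) + 1)"
  proof -
    have "(\<Sum>p\<in>B. root c k p) = (\<Sum>p\<in>B. lv c p + 1)" by (rule sum.cong) (simp_all add: rootB)
    then show ?thesis using sumrow[of "k - 1" "\<lambda>p. lv c p + 1"] k by (simp add: B_def)
  qed
  have rs: "(\<Sum>l=1..i. lv c (i, l)) = of_int (rsum c i) + (\<Sum>l=1..i. of_nat l)" for i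
    by (simp add: rsum_def lv_def sum.distrib)
  show ?thesis
  proof (cases "k < N")
    case True
    have ri: "rootidx k b = A \<union> B" using True Bk by (auto simp: rootidx_def A_def)
    have bl: "block k b = {p \<in> I. fst p = k}" using True by (auto simp: block_def)
    have cA: "card A = k + 1" using cardrow[of "k + 1"] True by (simp add: A_def)
    have "(\<Sum>p\<in>block k b. down_pi c p - up_pi c p) = (\<Sum>p\<in>block k b. gt_term (lv c) (root c k) (block k b) (rootidx k b) p)"
      by (intro sum.cong refl down_up_gt_term c)
    also have "\<dots> = (\<Sum>p\<in>block k b. 2 * lv c p + 1) - (\<Sum>q\<in>rootidx k b. root c k q)"
    \<comment> \<open>Every shifted entry moves with its column number as speed: distinct within a
      row, and equal for a node and the colliding root of the same column.\<close>
    proof (rule gt_sum[where dx = "\<lambda>p. of_nat (snd p)" and dr = "\<lambda>p. of_nat (snd p)"])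
      show "inj_on (\<lambda>p. of_nat (snd p) :: complex) (block k b)" by (auto simp: inj_on_def bl)
      show "card (rootidx k b) = 2 * card (block k b)"
        unfolding ri bl using AB cA cB cardrow[of k] k by (simp add: card_Un_disjoint)
    qed (use inj coll in auto)
    also have "(\<Sum>q\<in>rootidx k b. root c k q) = (\<Sum>l=1..k+1. lv c (k + 1, l)) + (\<Sum>l=1..k-1. lv c (k - 1, l) + 1)"
    proof -
      have "(\<Sum>p\<in>A. root c k p) = (\<Sum>p\<in>A. lv c p)" by (rule sum.cong) (simp_all add: rootA)
      also have "\<dots> = (\<Sum>l=1..k+1. lv c (k + 1, l))" unfolding A_def using True by (intro sumrow) simp
      finally show ?thesis unfolding ri sB[symmetric] using AB by (simp add: sum.union_disjoint)
    qed
    also have "(\<Sum>p\<in>block k b. 2 * lv c p + 1) = 2 * (\<Sum>l=1..k. lv c (k, l)) + of_nat k"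
      unfolding bl using sumrow[of k "\<lambda>p. 2 * lv c p + 1"] k by (simp add: sum.distrib sum_distrib_left)
    also have "2 * (\<Sum>l=1..k. lv c (k, l)) + of_nat k - ((\<Sum>l=1..k+1. lv c (k + 1, l)) + (\<Sum>l=1..k-1. lv c (k - 1, l) + 1))
      = of_int (2 * rsum c k - rsum c (k - 1) - rsum c (k + 1))"
    proof -
      have "(\<Sum>l=1..k+1. of_nat l :: complex) = (\<Sum>l=1..k. of_nat l) + of_nat k + 1" by simp
      moreover have "(\<Sum>l=1..k. of_nat l :: complex) = (\<Sum>l=1..k-1. of_nat l) + of_nat k" using k by (cases k) auto
      ultimately show ?thesis unfolding sum.distrib rs using k by (simp add: of_nat_diff algebra_simps)
    qed
    finally show ?thesis using True by simp
  next
    case False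
    then have kN: "k = N" using k by simp
    define C where "C = (if b then {(0::nat, 0::nat)} else {}) \<union> (if b = odd N then {(0, 1)} else {})"
    have "A = {}" by (auto simp: A_def kN idx_iff)
    then have ri: "rootidx k b = B \<union> C" using kN Bk by (auto simp: rootidx_def A_def C_def)
    have C: "finite C" "B \<inter> C = {}" using AB by (auto simp: C_def split: if_splits)
    have bl: "block k b = Pair N ` {l. l \<in> {1..N} \<and> odd l = b}" using kN by (auto simp: block_def idxB_def)
    have cbl: "card (block k b) = card {l. l \<in> {1..N} \<and> odd l = b}" unfolding bl by (rule card_image) (simp add: inj_on_def)
    \<comment> \<open>Ensures that there are twice as many roots as nodes: \<open>N - 1\<close>
      entries of the row below together with the boundary roots present for the parity
      \<open>b\<close>.\<close>
    have cc: "card {l. l \<in> {1..K} \<and> odd l = b} * 2 + (if odd K = b then 0 else 1) = K + (if b then 1 else 0)" for K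
    proof -
      have "(\<Sum>l=1..K. if odd l = b then 1 else 0) * 2 + (if odd K = b then 0 else 1) = K + (if b then 1 else (0::nat))"
        by (induction K) auto
      then show ?thesis by (simp only: card_eq_sum sum.inter_filter[OF finite_atLeastAtMost])
    qed
    have "(\<Sum>p\<in>block k b. down_pi c p - up_pi c p) = (\<Sum>p\<in>block k b. gt_term (lv c) (root c k) (block k b) (rootidx k b) p)"
      by (intro sum.cong refl down_up_gt_term c)
    also have "\<dots> = (\<Sum>p\<in>block k b. 2 * lv c p + 1) - (\<Sum>q\<in>rootidx k b. root c k q)"
    proof (rule gt_sum[where dx = "\<lambda>p. of_nat (snd p)" and dr = "\<lambda>p. of_nat (snd p)"])
      show "inj_on (\<lambda>p. of_nat (snd p) :: complex) (block k b)" by (auto simp: inj_on_def bl)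
      have "card C = (if b then 1 else 0) + (if b = odd N then 1 else 0)" by (auto simp: C_def)
      then show "card (rootidx k b) = 2 * card (block k b)"
        unfolding ri cbl using AB C cB cc[of N] kN N3 by (subst card_Un_disjoint) (auto split: if_splits)
    qed (use inj coll in auto)
    also have "(\<Sum>q\<in>rootidx k b. root c k q) = (\<Sum>l=1..N-1. lv c (N - 1, l) + 1) + ((if b then 1 else 0) + (if b = odd N then of_nat m + of_nat N + 1 else 0))"
    proof -
      have "(\<Sum>q\<in>C. root c k q) = (if b then 1 else 0) + (if b = odd N then of_nat m + of_nat N + 1 else 0)"
        by (auto simp: C_def root_def)
      then show ?thesis unfolding ri using AB C sB kN by (simp add: sum.union_disjoint)
    qed
    also have "(\<Sum>p\<in>block k b. 2 * lv c p + 1) = of_int (2 * csum c b) + of_int (\<Sum>l | l \<in> {1..N} \<and> odd l = b. 2 * int l + 1)"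
      unfolding bl by (subst sum.reindex, simp add: inj_on_def)
        (simp add: comp_def csum_def lv_def sum.distrib sum_distrib_left algebra_simps)
    also have "of_int (2 * csum c b) + of_int (\<Sum>l | l \<in> {1..N} \<and> odd l = b. 2 * int l + 1) -
       ((\<Sum>l=1..N-1. lv c (N - 1, l) + 1) + ((if b then 1 else 0) + (if b = odd N then of_nat m + of_nat N + 1 else 0)))
      = (of_int (2 * csum c b - rsum c (N - 1) - (if odd N = b then int m else 0)) :: complex)"
    proof -
      have "(\<Sum>l=1..N-1. lv c (N - 1, l) + 1) = of_int (rsum c (N - 1)) + of_int (\<Sum>l=1..N-1. int l + 1)"
        unfolding sum.distrib rs by simp
      moreover have "N \<ge> 1" using N3 by simp
      ultimately show ?thesis unfolding odd_sum[OF \<open>N \<ge> 1\<close>] by (auto simp: algebra_simps)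
    qed
    finally show ?thesis using kN by simp
  qed
qed

text \<open>The last color of type B collects both classes of the last row. They may be treated
  separately because the factors between different parities are trivial.\<close>

lemma color_gt_sum:
  assumes c: "c \<in> V" and i: "i \<in> {1..n}"
  shows "(\<Sum>p\<in>pos i. down_pi c p - up_pi c p) = of_int (wt i c)"
proof (cases "i < N")
  case True
  have "pos i = block i True" using True col_eq col_lt
    by (fastforce simp: pos_def block_def)
  then show ?thesis using block_gt_sum[OF c, of i True] True i by (simp add: wt_def)
next
  case False
  have "pos i = (\<Union>b\<in>{b. bcol b = i}. block N b)"
    using False col_lt by (fastforce simp: pos_def block_def col_def idx_iff)
  moreover have "(\<Sum>p\<in>(\<Union>b\<in>{b. bcol b = i}. block N b). down_pi c p - up_pi c p) =
     (\<Sum>b | bcol b = i. \<Sum>p\<in>block N b. down_pi c p - up_pi c p)"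
    by (rule sum.UNION_disjoint) (auto simp: block_def)
  ultimately show ?thesis using block_gt_sum[OF c, of N] N3 False by (simp add: wt_def)
qed

end

section \<open>Singular vectors\<close>

context vector_space
begin

lemma family_zero:
  assumes "finite R" "inj_on v R" "independent (v ` R)" "(\<Sum>r\<in>R. scale (u r) (v r)) = 0" "r \<in> R"
  shows "u r = 0"
proof -
  have "(\<Sum>b\<in>v ` R. scale (u (the_inv_into R v b)) b) = (\<Sum>r\<in>R. scale (u r) (v r))"
    by (subst sum.reindex[OF assms(2)]) (auto simp: the_inv_into_f_f[OF assms(2)] intro: sum.cong)
  then have "u (the_inv_into R v (v r)) = 0"
    using independentD[OF assms(3), of "v ` R" "\<lambda>b. u (the_inv_into R v b)" "v r"] assms by simp
  then show ?thesis using assms by (simp add: the_inv_into_f_f)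
qed

lemma family_eq:
  assumes "finite R" "inj_on v R" "independent (v ` R)"
    and "(\<Sum>r\<in>R. scale (u r) (v r)) = (\<Sum>r\<in>R. scale (w r) (v r))" "r \<in> R"
  shows "u r = w r"
  using family_zero[OF assms(1-3), of "\<lambda>r. u r - w r" r] assms(4,5)
  by (simp add: scale_left_diff_distrib sum_subtractf)

lemma family_span:
  assumes "finite R" "inj_on v R" "S \<subseteq> R" "a \<in> span (v ` S)"
  obtains u where "a = (\<Sum>r\<in>R. scale (u r) (v r))" "\<And>r. r \<notin> S \<Longrightarrow> u r = 0"
proof -
  have fS: "finite S" "inj_on v S" using assms finite_subset inj_on_subset by blast+
  obtain u where "a = (\<Sum>b\<in>v ` S. scale (u b) b)" using assms(4) span_finite[of "v ` S"] fS by auto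
  then have "a = (\<Sum>r\<in>S. scale (u (v r)) (v r))" by (simp add: sum.reindex[OF fS(2)])
  also have "\<dots> = (\<Sum>r\<in>R. scale (if r \<in> S then u (v r) else 0) (v r))"
    using assms by (intro sum.mono_neutral_cong_left) auto
  finally show ?thesis using that[of "\<lambda>r. if r \<in> S then u (v r) else 0"] by auto
qed

lemma family_span_in:
  assumes "finite R" "\<And>r. r \<in> R \<Longrightarrow> u r \<noteq> 0 \<Longrightarrow> r \<in> S"
  shows "(\<Sum>r\<in>R. scale (u r) (v r)) \<in> span (v ` S)"
proof (rule span_sum)
  fix r assume "r \<in> R"
  then show "scale (u r) (v r) \<in> span (v ` S)"
    using assms(2) by (cases "u r = 0") (auto intro: span_scale span_base span_zero)
qed

lemma family_representation:
  assumes "finite R" "inj_on v R" "independent (v ` R)" "t \<in> R"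
  shows "representation (v ` R) (\<Sum>r\<in>R. scale (u r) (v r)) (v t) = u t"
proof -
  have "representation (v ` R) (\<Sum>r\<in>R. scale (u r) (v r)) = (\<lambda>b. \<Sum>r\<in>R. representation (v ` R) (scale (u r) (v r)) b)"
    using assms by (intro representation_sum) (auto intro: span_scale span_base span_zero)
  then have "representation (v ` R) (\<Sum>r\<in>R. scale (u r) (v r)) (v t) = (\<Sum>r\<in>R. representation (v ` R) (scale (u r) (v r)) (v t))"
    by simp
  also have "\<dots> = (\<Sum>r\<in>R. u r * (if v t = v r then 1 else 0))"
    using assms by (intro sum.cong refl) (auto simp: representation_scale span_base representation_basis)
  also have "\<dots> = (\<Sum>r\<in>R. if r = t then u r else 0)"
    using assms by (intro sum.cong refl) (auto simp: inj_on_def)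
  finally show ?thesis using assms by simp
qed

end

text \<open>Formulated for an independent family that may span a proper subspace, so that it covers
  the functions on all arrays as well as the given module.\<close>

locale gt_module = tri_pattern N m n bcol + vector_space sc
  for N m n bcol and sc :: "complex \<Rightarrow> 'v::ab_group_add \<Rightarrow> 'v" +
  fixes x y h :: "nat \<Rightarrow> 'v \<Rightarrow> 'v" and e :: "array \<Rightarrow> 'v"
  assumes x_hom: "i \<in> {1..n} \<Longrightarrow> module_hom sc sc (x i)"
    and y_hom: "i \<in> {1..n} \<Longrightarrow> module_hom sc sc (y i)"
    and h_hom: "i \<in> {1..n} \<Longrightarrow> module_hom sc sc (h i)"
    and e_inj: "inj_on e V" and e_ind: "independent (e ` V)"
    and x_e: "i \<in> {1..n} \<Longrightarrow> c \<in> V \<Longrightarrow>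
       x i (e c) = (\<Sum>p\<in>pos i. if raise c p \<in> V then sc (cP c p) (e (raise c p)) else 0)"
    and y_e: "i \<in> {1..n} \<Longrightarrow> c \<in> V \<Longrightarrow>
       y i (e c) = (\<Sum>p\<in>pos i. if c p > 0 \<and> lower c p \<in> V then sc (cQ (lower c p) p) (e (lower c p)) else 0)"
    and h_e: "i \<in> {1..n} \<Longrightarrow> c \<in> V \<Longrightarrow> h i (e c) = sc (of_int (wt i c)) (e c)"
begin

definition E :: "(array \<Rightarrow> complex) \<Rightarrow> 'v" where "E u = (\<Sum>c\<in>V. sc (u c) (e c))"

lemma E_zero: "E u = 0 \<Longrightarrow> c \<in> V \<Longrightarrow> u c = 0"
  unfolding E_def using family_zero[OF finite_verts e_inj e_ind] by blast

lemma E_zeroI: "(\<And>c. c \<in> V \<Longrightarrow> u c = 0) \<Longrightarrow> E u = 0"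
  unfolding E_def by (rule sum.neutral) simp

lemma E_eq: "E u = E w \<Longrightarrow> c \<in> V \<Longrightarrow> u c = w c"
  unfolding E_def using family_eq[OF finite_verts e_inj e_ind] by blast

lemma E_span: "a \<in> span (e ` V) \<Longrightarrow> \<exists>u. a = E u"
  unfolding E_def using family_span[OF finite_verts e_inj subset_refl] by metis

lemma E_single:
  assumes "c0 \<in> V" "\<And>c. c \<in> V \<Longrightarrow> u c \<noteq> 0 \<Longrightarrow> c = c0"
  shows "E u = sc (u c0) (e c0)"
proof -
  have "E u = (\<Sum>c\<in>V. if c = c0 then sc (u c0) (e c0) else 0)"
    unfolding E_def 
  proof (rule sum.cong[OF refl])
    fix c assume "c \<in> V"
    then show "sc (u c) (e c) = (if c = c0 then sc (u c0) (e c0) else 0)"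
      using assms(2)[of c] by (cases "u c = 0") auto
  qed
  then show ?thesis using assms(1) by simp
qed

definition xf :: "nat \<Rightarrow> (array \<Rightarrow> complex) \<Rightarrow> array \<Rightarrow> complex" where
  "xf i u t = (\<Sum>p\<in>pos i. if t p > 0 \<and> lower t p \<in> V then u (lower t p) * cP (lower t p) p else 0)"

lemma x_E:
  assumes i: "i \<in> {1..n}" shows "x i (E u) = E (xf i u)"
proof -
  have "x i (E u) = (\<Sum>c\<in>V. sc (u c) (x i (e c)))"
    unfolding E_def by (simp add: module_hom.sum[OF x_hom[OF i]] module_hom.scale[OF x_hom[OF i]])
  also have "\<dots> = (\<Sum>c\<in>V. \<Sum>p\<in>pos i. if raise c p \<in> V then sc (u c * cP c p) (e (raise c p)) else 0)"
    by (intro sum.cong refl) (auto simp: x_e[OF i] scale_sum_right intro!: sum.cong)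
  also have "\<dots> = (\<Sum>p\<in>pos i. \<Sum>c\<in>V. if raise c p \<in> V then sc (u c * cP c p) (e (raise c p)) else 0)"
    by (rule sum.swap)
  also have "\<dots> = (\<Sum>p\<in>pos i. \<Sum>t\<in>V. if t p > 0 \<and> lower t p \<in> V then sc (u (lower t p) * cP (lower t p) p) (e t) else 0)"
  proof (rule sum.cong[OF refl])
    fix p
    have "(\<Sum>c\<in>V. if raise c p \<in> V then sc (u c * cP c p) (e (raise c p)) else 0)
      = (\<Sum>c\<in>{c\<in>V. raise c p \<in> V}. sc (u c * cP c p) (e (raise c p)))"
      by (rule sum.inter_filter[symmetric]) simp
    also have "\<dots> = (\<Sum>t\<in>{t\<in>V. t p > 0 \<and> lower t p \<in> V}. sc (u (lower t p) * cP (lower t p) p) (e t))"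
      by (rule sum.reindex_bij_witness[of _ "\<lambda>t. lower t p" "\<lambda>c. raise c p"]) (auto simp: raise_apply)
    also have "\<dots> = (\<Sum>t\<in>V. if t p > 0 \<and> lower t p \<in> V then sc (u (lower t p) * cP (lower t p) p) (e t) else 0)"
      by (rule sum.inter_filter) simp
    finally show "(\<Sum>c\<in>V. if raise c p \<in> V then sc (u c * cP c p) (e (raise c p)) else 0) =
      (\<Sum>t\<in>V. if t p > 0 \<and> lower t p \<in> V then sc (u (lower t p) * cP (lower t p) p) (e t) else 0)" .
  qed
  also have "\<dots> = (\<Sum>t\<in>V. \<Sum>p\<in>pos i. if t p > 0 \<and> lower t p \<in> V then sc (u (lower t p) * cP (lower t p) p) (e t) else 0)"
    by (rule sum.swap)
  also have "\<dots> = E (xf i u)"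
    unfolding E_def xf_def scale_sum_left by (intro sum.cong refl) auto
  finally show ?thesis .
qed

lemma h_E: "i \<in> {1..n} \<Longrightarrow> h i (E u) = E (\<lambda>c. of_int (wt i c) * u c)"
  unfolding E_def by (simp add: module_hom.sum[OF h_hom] module_hom.scale[OF h_hom] h_e mult.commute)

text \<open>By induction the support is maximal for the smaller colors, hence saturated below the
  row of color \<open>k + 1\<close>. By \<open>rowmax_inj\<close> the basis vector at
  \<open>raise c p\<close> receives a contribution from \<open>c\<close> alone, with nonzero
  coefficient, so nothing cancels it.\<close>

lemma singular_support:
  assumes "k \<le> n" "\<And>i. i \<in> {1..k} \<Longrightarrow> x i (E u) = 0" "c \<in> V" "u c \<noteq> 0"
  shows "kmax k c"
  using assms
proof (induction k arbitrary: c)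
  case 0
  then show ?case using col_bounds by (fastforce simp: kmax_def)
next
  case (Suc k)
  \<comment> \<open>The minimum is needed because in type D the colors \<open>N\<close> and
    \<open>N + 1\<close> share the last row.\<close>
  define r where "r = min (Suc k) N"
  have rm: "rowmax r d" if "d \<in> V" "u d \<noteq> 0" for d
  proof (rule rowmaxI)
    have "kmax k d" using Suc.IH[OF _ _ that] Suc.prems by simp
    then show "raise d p \<notin> V" if "p \<in> I" "fst p < r" for p
      using that col_eq[of p] by (auto simp: kmax_def r_def)
  qed (use that in \<open>auto simp: r_def\<close>)
  show ?case unfolding kmax_def
  proof (intro ballI impI notI)
    fix p assume p: "p \<in> I" "col p \<le> Suc k" "raise c p \<in> V"
    have "kmax k c" using Suc.IH Suc.prems by simp
    then have cp: "col p = Suc k" using p by (force simp: kmax_def)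
    have i: "Suc k \<in> {1..n}" "Suc k \<in> {1..Suc k}" using Suc.prems by auto
    have "E (xf (Suc k) u) = 0" using x_E[OF i(1)] Suc.prems(2)[OF i(2)] by simp
    then have "xf (Suc k) u (raise c p) = 0" using p(3) by (rule E_zero)
    moreover have "xf (Suc k) u (raise c p) = (\<Sum>q\<in>pos (Suc k). if q = p then u c * cP c p else 0)"
      unfolding xf_def
    proof (rule sum.cong[OF refl])
      fix q assume q: "q \<in> pos (Suc k)"
      let ?d = "lower (raise c p) q"
      have qp: "q = p" if g: "raise c p q > 0" "?d \<in> V" "u ?d \<noteq> 0"
      proof -
        have f: "fst p = r" "fst q = r" using min_col q p cp by (auto simp: pos_def r_def)
        then obtain a b where ab: "p = (r, a)" "q = (r, b)" by (cases p; cases q) auto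
        have "b = a"
          by (rule rowmax_inj[OF rm[OF g(2,3)] rm[OF Suc.prems(3,4)]])
             (use q p g ab raise_lower[of "raise c p" q] in \<open>auto simp: pos_def\<close>)
        then show ?thesis by (simp add: ab)
      qed
      show "(if 0 < raise c p q \<and> ?d \<in> V then u ?d * cP ?d q else 0) = (if q = p then u c * cP c p else 0)"
      proof (cases "q = p")
        case True
        have "0 < raise c p p" by (simp add: raise_apply)
        then show ?thesis using Suc.prems(3) by (simp only: True lower_raise if_P simp_thms if_True)
      next
        case False
        then have "u ?d = 0 \<or> \<not> (0 < raise c p q \<and> ?d \<in> V)" using qp by blast
        then show ?thesis using False by (elim disjE) (simp_all only: mult_zero_left if_False if_cancel)
      qed
    qed
    moreover have "\<dots> = u c * cP c p" using p cp by (simp add: pos_def)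
    ultimately show False using coeff_nonzero(1)[OF Suc.prems(3) p(1,3)] Suc.prems(4) by simp
  qed
qed

text \<open>Applying a raising operator increases \<open>total\<close> on the support, which is
  bounded on patterns; so the process must end at a singular vector.\<close>

lemma singular_exists:
  assumes U: "U \<subseteq> span (e ` V)" "\<And>i a. i \<in> {1..k} \<Longrightarrow> a \<in> U \<Longrightarrow> x i a \<in> U" and k: "k \<le> n"
    and a: "a \<in> U" "a \<noteq> 0"
  shows "\<exists>b\<in>U. b \<noteq> 0 \<and> (\<forall>i\<in>{1..k}. x i b = 0)"
proof (rule ccontr)
  assume no: "\<not> ?thesis"
  have "\<exists>u. E u \<in> U \<and> E u \<noteq> 0 \<and> (\<forall>c\<in>V. u c \<noteq> 0 \<longrightarrow> d \<le> total c)" for d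
  proof (induction d)
    case 0
    then show ?case using E_span[of a] U a by auto
  next
    case (Suc d)
    then obtain u where u: "E u \<in> U" "E u \<noteq> 0" "\<And>c. c \<in> V \<Longrightarrow> u c \<noteq> 0 \<Longrightarrow> d \<le> total c" by auto
    then obtain i where i: "i \<in> {1..k}" "x i (E u) \<noteq> 0" using no by auto
    have x: "x i (E u) = E (xf i u)" using i k by (intro x_E) auto
    have "Suc d \<le> total t" if "t \<in> V" "xf i u t \<noteq> 0" for t
    proof -
      obtain p where p: "p \<in> pos i" "t p > 0" "lower t p \<in> V" "u (lower t p) \<noteq> 0"
      proof (rule ccontr)
        assume "\<not> thesis"
        then have "xf i u t = 0" unfolding xf_def using that by (intro sum.neutral) auto
        with \<open>xf i u t \<noteq> 0\<close> show False by simp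
      qed
      have "total t = total (lower t p) + 1"
        using total_raise[of p "lower t p"] p by (simp add: pos_def)
      then show ?thesis using u(3)[OF p(3,4)] by simp
    qed
    then show ?case using U(2)[OF i(1) u(1)] i x by auto
  qed
  then obtain u where u: "E u \<noteq> 0" "\<forall>c\<in>V. u c \<noteq> 0 \<longrightarrow> m * card I + 1 \<le> total c" by blast
  then obtain c where "c \<in> V" "u c \<noteq> 0" using E_zeroI by blast
  then show False using u(2) total_le[of c] by force
qed

section \<open>Generation by lowering operators\<close>

definition lev :: "array \<Rightarrow> nat" where "lev c = (LEAST r. \<exists>p\<in>I. fst p = r \<and> raise c p \<in> V)"

lemma lev_le: "p \<in> I \<Longrightarrow> raise c p \<in> V \<Longrightarrow> lev c \<le> fst p"
  unfolding lev_def by (rule Least_le) auto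

text \<open>Go up from \<open>c\<close> in the lowest row that allows it and apply the lowering
  operator. This returns \<open>e c\<close> with nonzero coefficient plus vectors of the same total.
  By \<open>rowmax_inj\<close> their patterns are not saturated below that row, so their
  \<open>lev\<close> is smaller and the induction covers them.\<close>

lemma lowering_generates:
  assumes U: "subspace U" "\<And>i a. i \<in> {1..k} \<Longrightarrow> a \<in> U \<Longrightarrow> y i a \<in> U" and k: "k \<le> n"
    and c0: "c0 \<in> V" "kmax k c0" "e c0 \<in> U"
    and c: "c \<in> V" "agree k c c0"
  shows "e c \<in> U"
  using c
proof (induction "(m * card I - total c, lev c)" arbitrary: c rule: wf_induct_rule[OF wf_lex_prod[OF wf_less_than wf_less_than]])
  case (1 c)
  show ?case
  proof (cases "kmax k c")
    case True
    then show ?thesis using kmax_unique[OF 1(2) True c0(1,2) 1(3)] c0 by simp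
  next
    case False
    then obtain p0 where p0: "p0 \<in> I" "col p0 \<le> k" "raise c p0 \<in> V" by (auto simp: kmax_def)
    then have "\<exists>p\<in>I. fst p = lev c \<and> raise c p \<in> V" unfolding lev_def
      by (intro LeastI[of "\<lambda>r. \<exists>p\<in>I. fst p = r \<and> raise c p \<in> V" "fst p0"]) auto
    then obtain p1 where p1: "p1 \<in> I" "fst p1 = lev c" "raise c p1 \<in> V" by auto
    \<comment> \<open>A position of the last row might have a color above \<open>k\<close>, so
      \<open>p0\<close> is kept if it lies in the lowest row. A row strictly lower than that of
      \<open>p0\<close> has its number as color, which is smaller than the color of
      \<open>p0\<close>.\<close>
    obtain p where p: "p \<in> I" "col p \<le> k" "raise c p \<in> V" "fst p = lev c"
    proof (cases "fst p0 = lev c")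
      case True then show ?thesis using that p0 by auto
    next
      case False
      then have "lev c < fst p0" using lev_le[OF p0(1,3)] by simp
      then have "fst p1 < N" "fst p1 < fst p0" using p1 min_col[OF p0(1)] by auto
      then show ?thesis using that[of p1] p1 col_eq[of p1] min_col[OF p0(1)] p0 by auto
    qed
    define r where "r = fst p"
    have r: "r = lev c" "r \<le> N" using p min_col[OF p(1)] by (auto simp: r_def)
    have rm: "rowmax r c" using lev_le r by (intro rowmaxI 1(2)) force+
    have ci: "col p \<in> {1..k}" "col p \<in> {1..n}" using p col_bounds[OF p(1)] k by auto
    let ?t = "raise c p"
    have et: "e ?t \<in> U"
    proof (rule 1(1))
      show "((m * card I - total ?t, lev ?t), (m * card I - total c, lev c)) \<in> less_than <*lex*> less_than"
      proof -
        have "m * card I - total ?t < m * card I - total c"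
          using total_raise[OF p(1), of c] total_le[OF p(3)] by linarith
        then show ?thesis by simp
      qed
      show "agree k ?t c0" using agree_trans[OF agree_sym[OF agree_raise[OF p(1,2)]] 1(3)] .
    qed (use p in auto)
    let ?g = "\<lambda>q. if ?t q > 0 \<and> lower ?t q \<in> V then sc (cQ (lower ?t q) q) (e (lower ?t q)) else 0"
    have "y (col p) (e ?t) = sum ?g (pos (col p))" using y_e[OF ci(2) p(3)] .
    also have "\<dots> = ?g p + sum ?g (pos (col p) - {p})"
      using p by (intro sum.remove) (auto simp: pos_def)
    also have "?g p = sc (cQ c p) (e c)" using 1(2) by (simp add: raise_apply)
    finally have s: "sc (cQ c p) (e c) = y (col p) (e ?t) - sum ?g (pos (col p) - {p})" by simp
    have "?g q \<in> U" if q: "q \<in> pos (col p) - {p}" for q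
    proof (cases "?t q > 0 \<and> lower ?t q \<in> V")
      case True
      let ?d = "lower ?t q"
      have qI: "q \<in> I" "col q = col p" "q \<noteq> p" using q by (auto simp: pos_def)
      have rd: "raise ?d q = ?t" using True by simp
      have "total ?d = total c" using total_raise[OF qI(1), of ?d] total_raise[OF p(1), of c] rd by simp
      moreover have "lev ?d < lev c"
      proof -
        have "fst q = r" using min_col qI p by (simp add: r_def)
        then obtain a b where ab: "p = (r, a)" "q = (r, b)" by (cases p; cases q) (auto simp: r_def)
        have "\<not> rowmax r ?d"
        proof
          assume "rowmax r ?d"
          from rowmax_inj[OF this rm, of b a] have "b = a" using qI p rd ab by auto
          then show False using qI ab by simp
        qed
        then obtain p' where "p' \<in> I" "fst p' < r" "raise ?d p' \<in> V"
          using rowmaxI[of ?d r] True r by auto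
        then show ?thesis using lev_le[of p' ?d] r by simp
      qed
      moreover have "agree k ?d c0"
        using agree_trans[OF agree_trans[OF agree_raise[of q k ?d, unfolded rd] agree_sym[OF agree_raise[OF p(1,2)]]] 1(3)]
          qI p by simp
      ultimately have "e ?d \<in> U" using True by (intro 1(1)) auto
      then show ?thesis using True subspace_scale[OF U(1)] by simp
    qed (simp only: if_False subspace_0[OF U(1)])
    then have "sc (cQ c p) (e c) \<in> U" unfolding s
      by (intro subspace_diff[OF U(1)] U(2)[OF ci(1) et] subspace_sum[OF U(1)])
    then have "sc (1 / cQ c p) (sc (cQ c p) (e c)) \<in> U" by (rule subspace_scale[OF U(1)])
    then show ?thesis using coeff_nonzero(2)[OF 1(2) p(1,3)] by simp
  qed
qed

end

section \<open>Weight bases\<close>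

lemma (in vector_space) hom_span_closed:
  assumes "module_hom scale scale f" "\<And>b. b \<in> B \<Longrightarrow> f b \<in> span B" "a \<in> span B"
  shows "f a \<in> span B"
proof -
  have "f ` B \<subseteq> span B" using assms(2) by auto
  then have "span (f ` B) \<subseteq> span B" by (metis span_mono span_span)
  moreover have "f a \<in> span (f ` B)" using module_hom.span_image[OF assms(1), of B] assms(3) by auto
  ultimately show ?thesis by auto
qed

lemma (in vector_space) span_eq_of_card:
  assumes "finite B" "independent A" "A \<subseteq> span B" "card A = card B"
  shows "span B \<subseteq> span A"
proof -
  have "b \<in> span A" if b: "b \<in> B" for b
  proof (rule ccontr)
    assume nb: "b \<notin> span A"
    then have ind: "independent (insert b A)" using assms(2) independent_insertI by blast
    have "card (insert b A) \<le> card B"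
      using independent_span_bound[OF assms(1) ind] assms(3) b by (simp add: span_base)
    moreover have "finite A" using independent_span_bound[OF assms(1-3)] by simp
    moreover have "b \<notin> A" using nb by (auto intro: span_base)
    ultimately show False using assms(4) by simp
  qed
  then show ?thesis by (intro span_minimal) auto
qed

locale gt_irrep = gt_module N m n bcol sc x y h e
  for N m n bcol and sc :: "complex \<Rightarrow> 'v::ab_group_add \<Rightarrow> 'v" and x y h e +
  assumes e_span: "span (e ` vertsB N m) = UNIV"
    and hx: "i \<in> {1..n} \<Longrightarrow> j \<in> {1..n} \<Longrightarrow>
      h i (x j v) = x j (h i v) + sc (of_int (cartan ltype n i j)) (x j v)"
    and hy: "i \<in> {1..n} \<Longrightarrow> j \<in> {1..n} \<Longrightarrow>
      h i (y j v) = y j (h i v) - sc (of_int (cartan ltype n i j)) (y j v)"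
begin

lemma E_surj: "\<exists>u. a = E u" using E_span[of a] e_span by simp

lemma eigen_coeff:
  assumes i: "i \<in> {1..n}" and ev: "h i (E u) = sc \<mu> (E u)" and c: "c \<in> V" "u c \<noteq> 0"
  shows "of_int (wt i c) = \<mu>"
proof -
  have "E (\<lambda>c. of_int (wt i c) * u c) = E (\<lambda>c. \<mu> * u c)"
    using ev h_E[OF i] by (simp add: E_def scale_sum_right)
  from E_eq[OF this c(1)] c show ?thesis by simp
qed

text \<open>For \<open>k \<ge> N\<close> this is the whole module, where the descent in
  \<open>k\<close> starts; at \<open>k = 0\<close> only the line of \<open>e c\<close> is
  left.\<close>

definition M :: "nat \<Rightarrow> array \<Rightarrow> 'v set" where
  "M k c = span (e ` {d \<in> V. k < N \<longrightarrow> agree k d c})"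

lemma M_support:
  assumes "a \<in> M k c"
  obtains u where "a = E u" "\<And>d. d \<in> V \<Longrightarrow> u d \<noteq> 0 \<Longrightarrow> k < N \<Longrightarrow> agree k d c"
proof -
  have "{d \<in> V. k < N \<longrightarrow> agree k d c} \<subseteq> V" by auto
  then obtain u where u: "a = (\<Sum>r\<in>V. sc (u r) (e r))" "\<And>r. r \<notin> {d \<in> V. k < N \<longrightarrow> agree k d c} \<Longrightarrow> u r = 0"
    by (rule family_span[OF finite_verts e_inj _ assms[unfolded M_def]]) blast
  show ?thesis by (rule that[of u]) (use u in \<open>auto simp: E_def\<close>)
qed

lemma M_0: assumes "c \<in> V" "a \<in> M 0 c" obtains b where "a = sc b (e c)"
proof -
  have "{d \<in> V. 0 < N \<longrightarrow> agree 0 d c} = {c}" using agree_0 assms(1) N3 by auto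
  then have "a \<in> span {e c}" using assms(2) by (simp add: M_def)
  then show ?thesis using that by (auto simp: span_singleton)
qed

lemma class_invariant:
  assumes "k \<le> n" "i \<in> {1..k}" "a \<in> span (e ` {d \<in> V. agree k d c})"
  shows "x i a \<in> span (e ` {d \<in> V. agree k d c})" (is "_ \<in> span ?B")
    and "y i a \<in> span (e ` {d \<in> V. agree k d c})"
    and "h i a \<in> span (e ` {d \<in> V. agree k d c})"
proof -
  have i: "i \<in> {1..n}" using assms by auto
  have ag: "agree k (raise d p) c \<longleftrightarrow> agree k d c" if "p \<in> pos i" for d p
    using agree_raise[of p k d] that assms(2) agree_trans agree_sym by (metis (mono_tags, lifting) atLeastAtMost_iff mem_Collect_eq pos_def)
  show "x i a \<in> span ?B"
  proof (rule hom_span_closed[OF x_hom[OF i] _ assms(3)])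
    fix b assume "b \<in> ?B"
    then obtain d where d: "d \<in> V" "agree k d c" "b = e d" by auto
    have "(if raise d p \<in> V then sc (cP d p) (e (raise d p)) else 0) \<in> span ?B" if "p \<in> pos i" for p
      using ag[OF that, of d] d by (cases "raise d p \<in> V") (auto intro!: span_scale span_zero intro: span_base)
    then show "x i b \<in> span ?B" unfolding d x_e[OF i d(1)] by (intro span_sum)
  qed
  show "y i a \<in> span ?B"
  proof (rule hom_span_closed[OF y_hom[OF i] _ assms(3)])
    fix b assume "b \<in> ?B"
    then obtain d where d: "d \<in> V" "agree k d c" "b = e d" by auto
    have "(if d p > 0 \<and> lower d p \<in> V then sc (cQ (lower d p) p) (e (lower d p)) else 0) \<in> span ?B" if "p \<in> pos i" for p
    proof (cases "d p > 0 \<and> lower d p \<in> V")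
      case True
      then have "agree k (lower d p) c" using ag[OF that, of "lower d p"] d by simp
      then show ?thesis using True by (auto intro!: span_scale intro: span_base)
    qed (simp only: if_False span_zero)
    then show "y i b \<in> span ?B" unfolding d y_e[OF i d(1)] by (intro span_sum)
  qed
  show "h i a \<in> span ?B"
  proof (rule hom_span_closed[OF h_hom[OF i] _ assms(3)])
    fix b assume "b \<in> ?B"
    then show "h i b \<in> span ?B" by (auto simp: h_e[OF i] intro!: span_scale span_base[OF imageI])
  qed
qed

text \<open>Subtracting from \<open>h i\<close> its eigenvalue at one support element removes that
  element and keeps another one of different weight; this is repeated until a single basis vector
  remains. The separation of weights is stated for supports of vectors in \<open>S\<close> because
  it will be known for singular vectors only.\<close>

lemma distinct_weights_pick:
  assumes S: "subspace S" "\<And>i b. i \<in> {1..n} \<Longrightarrow> b \<in> S \<Longrightarrow> h i b \<in> S"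
    and T: "\<And>u c d. E u \<in> S \<Longrightarrow> c \<in> V \<Longrightarrow> d \<in> V \<Longrightarrow> u c \<noteq> 0 \<Longrightarrow> u d \<noteq> 0 \<Longrightarrow> c \<noteq> d \<Longrightarrow> \<exists>i\<in>{1..n}. wt i c \<noteq> wt i d"
    and ne: "E u \<in> S" "E u \<noteq> 0"
  shows "\<exists>c\<in>V. u c \<noteq> 0 \<and> e c \<in> S"
  using ne
proof (induction "card {c \<in> V. u c \<noteq> 0}" arbitrary: u rule: less_induct)
  case less
  obtain c where c: "c \<in> V" "u c \<noteq> 0" using less.prems(2) E_zeroI by blast
  show ?case
  proof (cases "\<exists>d\<in>V. u d \<noteq> 0 \<and> d \<noteq> c")
    case False
    then have "E u = sc (u c) (e c)" using E_single[OF c(1)] by blast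
    then have "e c \<in> S" using subspace_scale[OF S(1) less.prems(1), of "1 / u c"] c by simp
    then show ?thesis using c by blast
  next
    case True
    then obtain d where d: "d \<in> V" "u d \<noteq> 0" "d \<noteq> c" by blast
    obtain i where i: "i \<in> {1..n}" "wt i c \<noteq> wt i d" using T[OF less.prems(1) c(1) d(1) c(2) d(2)] d by blast
    define u' where "u' = (\<lambda>a. (of_int (wt i a) - of_int (wt i c)) * u a)"
    have Eu': "E u' = h i (E u) - sc (of_int (wt i c)) (E u)"
      unfolding h_E[OF i(1)] unfolding E_def u'_def
      by (simp add: scale_sum_right sum_subtractf scale_left_diff_distrib algebra_simps)
    have in': "E u' \<in> S" unfolding Eu' using S less.prems(1) i(1) by (intro subspace_diff subspace_scale) auto
    have "u' d \<noteq> 0" using i d by (simp add: u'_def)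
    then have nz: "E u' \<noteq> 0" using E_zero d by blast
    have "{a \<in> V. u' a \<noteq> 0} \<subset> {a \<in> V. u a \<noteq> 0}" using c by (auto simp: u'_def)
    then have "card {a \<in> V. u' a \<noteq> 0} < card {a \<in> V. u a \<noteq> 0}" by (rule psubset_card_mono[rotated]) simp
    from less.hyps[OF this in' nz] show ?thesis by (auto simp: u'_def)
  qed
qed

section \<open>Arbitrary weight bases and their supporting graphs\<close>

context
  fixes R :: "'r set" and w :: "'r \<Rightarrow> 'v"
  assumes wb: "weight_basis sc n h R w"
begin

lemma w_inj: "inj_on w R" and w_ind: "independent (w ` R)" and w_span: "span (w ` R) = UNIV"
  using wb by (auto simp: weight_basis_def)

lemma w_eigen: "r \<in> R \<Longrightarrow> i \<in> {1..n} \<Longrightarrow> \<exists>c. h i (w r) = sc c (w r)"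
  using wb unfolding weight_basis_def by blast

lemma w_fin: "finite R"
proof -
  have "finite (w ` R) \<and> card (w ` R) \<le> card (e ` V)"
    by (rule independent_span_bound[OF _ w_ind]) (simp_all add: e_span)
  then show ?thesis using finite_imageD w_inj by blast
qed

lemma w_card: "card R = card V"
proof -
  have "card (w ` R) \<le> card (e ` V)"
    using independent_span_bound[OF _ w_ind, of "e ` V"] by (simp add: e_span)
  moreover have "card (e ` V) \<le> card (w ` R)"
    using independent_span_bound[OF _ e_ind, of "w ` R"] w_fin by (simp add: w_span)
  ultimately show ?thesis by (simp add: card_image w_inj e_inj)
qed

lemma w_expand: "a = (\<Sum>t\<in>R. sc (coeff_in sc R w a t) (w t))"
proof -
  obtain u where u: "a = (\<Sum>r\<in>R. sc (u r) (w r))"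
    using family_span[OF w_fin w_inj subset_refl, of a] w_span by auto
  have "coeff_in sc R w a t = u t" if "t \<in> R" for t
    unfolding coeff_in_def u by (rule family_representation[OF w_fin w_inj w_ind that])
  then show ?thesis by (subst u) (simp cong: sum.cong)
qed

lemma coeff_in_sum: "t \<in> R \<Longrightarrow> coeff_in sc R w (\<Sum>r\<in>R. sc (u r) (w r)) t = u t"
  unfolding coeff_in_def by (rule family_representation[OF w_fin w_inj w_ind])

lemma w_nonzero: "r \<in> R \<Longrightarrow> w r \<noteq> 0"
  using w_ind dependent_zero by (metis imageI)

lemma w_coeff_eigen:
  assumes i: "i \<in> {1..n}" and ev: "h i a = sc \<mu> a" and t: "t \<in> R" "h i (w t) = sc \<nu> (w t)"
    and nz: "coeff_in sc R w a t \<noteq> 0"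
  shows "\<mu> = \<nu>"
proof -
  have "\<forall>r\<in>R. \<exists>c. h i (w r) = sc c (w r)" using wb i by (auto simp: weight_basis_def)
  then obtain q where q: "\<And>r. r \<in> R \<Longrightarrow> h i (w r) = sc (q r) (w r)" by metis
  let ?u = "coeff_in sc R w a"
  have "h i a = (\<Sum>r\<in>R. sc (?u r) (h i (w r)))"
    by (subst w_expand[of a]) (simp add: module_hom.sum[OF h_hom[OF i]] module_hom.scale[OF h_hom[OF i]])
  also have "\<dots> = (\<Sum>r\<in>R. sc (?u r * q r) (w r))" by (intro sum.cong refl) (simp add: q)
  finally have 1: "coeff_in sc R w (h i a) t = ?u t * q t" using t(1) by (simp add: coeff_in_sum)
  have "h i a = (\<Sum>r\<in>R. sc (\<mu> * ?u r) (w r))"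
    unfolding ev by (subst w_expand[of a]) (simp add: scale_sum_right)
  then have "coeff_in sc R w (h i a) t = \<mu> * ?u t" using t(1) by (simp add: coeff_in_sum)
  with 1 nz have "\<mu> = q t" by simp
  moreover have "q t = \<nu>" using q[OF t(1)] t w_nonzero[OF t(1)] by (simp add: scale_right_imp_eq)
  ultimately show ?thesis by simp
qed

text \<open>An edge records a nonzero coefficient of raising or lowering in either direction, so a
  vertex set that no edge with color in \<open>J\<close> enters or leaves spans a stable
  subspace.\<close>

lemma supp_closed:
  assumes J: "J \<subseteq> {1..n}" and S: "S \<subseteq> R"
    and cl: "\<And>s i t. (s, i, t) \<in> supp_edges sc n x y R w \<Longrightarrow> i \<in> J \<Longrightarrow> s \<in> S \<longleftrightarrow> t \<in> S"
    and i: "i \<in> J" and a: "a \<in> span (w ` S)"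
  shows "x i a \<in> span (w ` S)" "y i a \<in> span (w ` S)"
proof -
  have i': "i \<in> {1..n}" using J i by auto
  show "x i a \<in> span (w ` S)"
  proof (rule hom_span_closed[OF x_hom[OF i'] _ a])
    fix b assume "b \<in> w ` S"
    then obtain r where r: "r \<in> S" "b = w r" "r \<in> R" using S by auto
    show "x i b \<in> span (w ` S)"
    proof (subst w_expand, rule family_span_in[OF w_fin])
      fix t assume "t \<in> R" "coeff_in sc R w (x i b) t \<noteq> 0"
      then have "(r, i, t) \<in> supp_edges sc n x y R w" using r i' by (auto simp: supp_edges_def)
      then show "t \<in> S" using cl i r by blast
    qed
  qed
  show "y i a \<in> span (w ` S)"
  proof (rule hom_span_closed[OF y_hom[OF i'] _ a])
    fix b assume "b \<in> w ` S"
    then obtain r where r: "r \<in> S" "b = w r" "r \<in> R" using S by auto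
    show "y i b \<in> span (w ` S)"
    proof (subst w_expand, rule family_span_in[OF w_fin])
      fix t assume "t \<in> R" "coeff_in sc R w (y i b) t \<noteq> 0"
      then have "(t, i, r) \<in> supp_edges sc n x y R w" using r i' by (auto simp: supp_edges_def)
      then show "t \<in> S" using cl i r by blast
    qed
  qed
qed

lemma w_span_h:
  assumes "i \<in> {1..n}" "S \<subseteq> R" "a \<in> span (w ` S)"
  shows "h i a \<in> span (w ` S)"
proof (rule hom_span_closed[OF h_hom[OF assms(1)] _ assms(3)])
  fix b assume "b \<in> w ` S"
  then obtain r where r: "r \<in> S" "b = w r" by auto
  then obtain c where "h i b = sc c b" using w_eigen assms(1,2) by blast
  then show "h i b \<in> span (w ` S)" using r by (auto intro: span_scale span_base)
qed

lemma w_in_span: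
  assumes "S \<subseteq> R" "r \<in> R" "w r \<in> span (w ` S)"
  shows "r \<in> S"
proof (rule ccontr)
  assume "r \<notin> S"
  obtain u where u: "w r = (\<Sum>t\<in>R. sc (u t) (w t))" "\<And>t. t \<notin> S \<Longrightarrow> u t = 0"
    using family_span[OF w_fin w_inj assms(1,3)] by metis
  have "w r = (\<Sum>t\<in>R. sc (if t = r then 1 else 0) (w t))"
    using assms(2) w_fin by (simp add: if_distrib[of "\<lambda>c. sc c _"] cong: if_cong)
  then have "u r = 1" using family_eq[OF w_fin w_inj w_ind, of u "\<lambda>t. if t = r then 1 else 0" r] u(1) assms(2) by simp
  then show False using u(2) \<open>r \<notin> S\<close> by simp
qed

lemma edge_weight:
  assumes st: "(s, i, t) \<in> supp_edges sc n x y R w" and j: "j \<in> {1..n}"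
    and s: "h j (w s) = sc \<mu> (w s)" and t: "h j (w t) = sc \<nu> (w t)"
  shows "\<nu> = \<mu> + of_int (cartan ltype n j i)"
proof -
  have i: "i \<in> {1..n}" and R: "s \<in> R" "t \<in> R" using st by (auto simp: supp_edges_def)
  consider (X) "coeff_in sc R w (x i (w s)) t \<noteq> 0" | (Y) "coeff_in sc R w (y i (w t)) s \<noteq> 0"
    using st by (auto simp: supp_edges_def)
  then show ?thesis
  proof cases
    case X
    have "h j (x i (w s)) = sc (\<mu> + of_int (cartan ltype n j i)) (x i (w s))"
      by (simp add: hx[OF j i] s module_hom.scale[OF x_hom[OF i]] scale_left_distrib)
    from w_coeff_eigen[OF j this R(2) t X] show ?thesis by simp
  next
    case Y
    have "h j (y i (w t)) = sc (\<nu> - of_int (cartan ltype n j i)) (y i (w t))"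
      by (simp add: hy[OF j i] t module_hom.scale[OF y_hom[OF i]] scale_left_diff_distrib)
    from w_coeff_eigen[OF j this R(1) s Y] show ?thesis by (simp add: algebra_simps)
  qed
qed

text \<open>The inclusion of edges has three effects: vertices over maximal patterns carry singular
  vectors, weights propagate along edges from the top, and lowering stays within the classes. A
  comparison of dimensions then passes from the maximal pattern of a class to the whole
  class.\<close>

lemma subgraph_basis:
  assumes f: "bij_betw f R V"
    and sub: "\<And>s i t. (s, i, t) \<in> supp_edges sc n x y R w \<Longrightarrow> (f s, i, f t) \<in> edges"
    and r: "r \<in> R"
  shows "\<exists>a. a \<noteq> 0 \<and> w r = sc a (e (f r))"
proof -
  have fV: "f r \<in> V" if "r \<in> R" for r using f that by (auto simp: bij_betw_def)
  have sink: "x i (w r) = 0" if "r \<in> R" "i \<in> {1..k}" "k \<le> n" "kmax k (f r)" for r i k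
  proof -
    have "coeff_in sc R w (x i (w r)) t = 0" if t: "t \<in> R" for t
    proof (rule ccontr)
      assume "\<not> ?thesis"
      then have "(r, i, t) \<in> supp_edges sc n x y R w" using \<open>r \<in> R\<close> t that \<open>i \<in> {1..k}\<close> \<open>k \<le> n\<close> by (auto simp: supp_edges_def)
      from sub[OF this] show False using \<open>kmax k (f r)\<close> \<open>i \<in> {1..k}\<close> by (auto simp: edges_def kmax_def)
    qed
    then show ?thesis by (subst w_expand) simp
  qed
  obtain r0 where r0: "r0 \<in> R" "f r0 = topv" using f topv_in by (metis bij_betw_def imageE)
  have top0: "\<exists>a. a \<noteq> 0 \<and> w r0 = sc a (e topv)"
  proof -
    obtain u where u: "w r0 = E u" using E_surj by blast
    have "c = topv" if "c \<in> V" "u c \<noteq> 0" for c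
    proof -
      have "kmax n c" by (rule singular_support[of n u]) (use sink[OF r0(1), of _ n] kmax_topv r0 u that in auto)
      then show ?thesis using kmax_unique[OF that(1) _ topv_in kmax_topv agree_n] by blast
    qed
    from E_single[OF topv_in this] u have "w r0 = sc (u topv) (e topv)" by simp
    then show ?thesis using w_nonzero[OF r0(1)] by (metis scale_zero_left)
  qed
  \<comment> \<open>The vertices whose weight is the one predicted by \<open>f\<close>. Edges
    preserve membership in both directions, so the span is stable under lowering; it contains
    \<open>e topv\<close> and is therefore everything.\<close>
  define G where "G = {r \<in> R. \<forall>j\<in>{1..n}. h j (w r) = sc (of_int (wt j (f r))) (w r)}"
  have "G = R"
  proof -
    have r0G: "r0 \<in> G"
    proof -
      obtain a where "w r0 = sc a (e topv)" using top0 by blast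
      then show ?thesis unfolding G_def using r0 topv_in
        by (auto simp: module_hom.scale[OF h_hom] h_e mult.commute)
    qed
    have cl: "s \<in> G \<longleftrightarrow> t \<in> G" if st: "(s, i, t) \<in> supp_edges sc n x y R w" "i \<in> {1..n}" for s i t
    proof -
      have R: "s \<in> R" "t \<in> R" using st by (auto simp: supp_edges_def)
      obtain p where p: "p \<in> I" "f t = raise (f s) p" "i = col p" using sub[OF st(1)] by (auto simp: edges_def)
      have "h j (w s) = sc (of_int (wt j (f s))) (w s) \<longleftrightarrow> h j (w t) = sc (of_int (wt j (f t))) (w t)" if j: "j \<in> {1..n}" for j
      proof -
        obtain a b where ab: "h j (w s) = sc a (w s)" "h j (w t) = sc b (w t)"
          using w_eigen R j by metis
        have "b = a + of_int (cartan ltype n j i)" using edge_weight[OF st(1) j ab] .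
        moreover have "wt j (f t) = wt j (f s) + cartan ltype n j i" unfolding p by (rule wt_raise[OF p(1) j])
        ultimately show ?thesis using w_nonzero[OF R(1)] w_nonzero[OF R(2)] unfolding ab by auto
      qed
      then show ?thesis using R by (auto simp: G_def)
    qed
    have GR: "G \<subseteq> R" by (auto simp: G_def)
    have "e topv \<in> span (w ` G)"
    proof -
      obtain a where a: "a \<noteq> 0" "w r0 = sc a (e topv)" using top0 by blast
      have "sc (1 / a) (w r0) \<in> span (w ` G)" using r0G by (intro span_scale span_base) auto
      then show ?thesis using a by simp
    qed
    have "e c \<in> span (w ` G)" if "c \<in> V" for c
    proof (rule lowering_generates[OF subspace_span _ order_refl topv_in kmax_topv \<open>e topv \<in> _\<close> that agree_n])
      fix i a assume "i \<in> {1..n}" "a \<in> span (w ` G)"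
      then show "y i a \<in> span (w ` G)" using supp_closed(2)[OF order_refl GR] cl by blast
    qed
    then have "span (e ` V) \<subseteq> span (w ` G)" by (intro span_minimal) auto
    then have "span (w ` G) = UNIV" using e_span by auto
    then show ?thesis using w_in_span[OF GR] GR by auto
  qed
  then have wtG: "h j (w r) = sc (of_int (wt j (f r))) (w r)" if "r \<in> R" "j \<in> {1..n}" for r j
  proof -
    have "r \<in> G" using \<open>G = R\<close> that by simp
    then show ?thesis using that unfolding G_def by blast
  qed
  have "\<forall>r\<in>R. w r \<in> M 0 (f r)"
  proof (rule inc_induct[of 0 N "\<lambda>k. \<forall>r\<in>R. w r \<in> M k (f r)"])
    show "\<forall>r\<in>R. w r \<in> M N (f r)" by (simp add: M_def e_span)
  next
    fix k assume k: "0 \<le> k" "k < N" and IH: "\<forall>r\<in>R. w r \<in> M (Suc k) (f r)"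
    show "\<forall>r\<in>R. w r \<in> M k (f r)"
    proof
      fix r assume r: "r \<in> R"
      obtain d where d: "d \<in> V" "agree k (f r) d" "kmax k d" using path_to_kmax[OF fV[OF r]] by blast
      obtain r1 where r1: "r1 \<in> R" "f r1 = d" using f d by (metis bij_betw_def imageE)
      have "w r1 \<in> M (Suc k) d" using IH r1 by auto
      then obtain u where u: "w r1 = E u" "\<And>c. c \<in> V \<Longrightarrow> u c \<noteq> 0 \<Longrightarrow> Suc k < N \<Longrightarrow> agree (Suc k) c d"
        using M_support by blast
      have kn: "k \<le> n" using k N_le_n by simp
      \<comment> \<open>A support element of the vector over \<open>d\<close> is maximal by
        singularity, shares the higher rows with \<open>d\<close> by the induction hypothesis, and
        has the weight of \<open>d\<close>.\<close>
      have "c = d" if c: "c \<in> V" "u c \<noteq> 0" for c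
      proof (rule kmax_wt_unique[OF k(2) c(1) _ d(1,3)])
        show "kmax k c"
          by (rule singular_support[of k u c]) (use sink[OF r1(1) _ kn] d r1 u c kn in auto)
        show "k + 1 < N \<Longrightarrow> agree (k + 1) c d" using u(2)[OF c] by simp
        show "wt i c = wt i d" if i: "i \<in> {1..n}" for i
        proof -
          have "h i (E u) = sc (of_int (wt i d)) (E u)" using wtG[OF r1(1) i] u r1 by simp
          from eigen_coeff[OF i this c] show ?thesis by simp
        qed
      qed
      from E_single[OF d(1) this] u have w1: "w r1 = sc (u d) (e d)" by simp
      with w_nonzero[OF r1(1)] have "u d \<noteq> 0" by auto
      define C where "C = {r \<in> R. agree k (f r) d}"
      define B where "B = {c \<in> V. agree k c d}"
      have CR: "C \<subseteq> R" by (auto simp: C_def)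
      have ed: "e d \<in> span (w ` C)"
      proof -
        have "sc (1 / u d) (w r1) \<in> span (w ` C)"
          using r1 by (intro span_scale span_base) (auto simp: C_def)
        then show ?thesis using w1 \<open>u d \<noteq> 0\<close> by simp
      qed
      have "e c \<in> span (w ` C)" if "c \<in> B" for c
      proof (rule lowering_generates[OF subspace_span _ kn d(1,3) ed])
        fix i a assume i: "i \<in> {1..k}" and a: "a \<in> span (w ` C)"
        show "y i a \<in> span (w ` C)"
        proof (rule supp_closed(2)[OF _ CR _ i a])
          show "{1..k} \<subseteq> {1..n}" using kn by auto
          fix s j t assume st: "(s, j, t) \<in> supp_edges sc n x y R w" "j \<in> {1..k}"
          obtain p where p: "p \<in> I" "f t = raise (f s) p" "j = col p" using sub[OF st(1)] by (auto simp: edges_def)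
          have "agree k (f s) (f t)" unfolding p by (rule agree_raise) (use p st in auto)
          then show "s \<in> C \<longleftrightarrow> t \<in> C" using st(1) agree_trans agree_sym unfolding C_def supp_edges_def by blast
        qed
      qed (use that in \<open>auto simp: B_def\<close>)
      then have sub1: "e ` B \<subseteq> span (w ` C)" by auto
      have fC: "finite C" "inj_on w C" using CR w_fin w_inj finite_subset inj_on_subset by blast+
      have BV: "B \<subseteq> V" by (auto simp: B_def)
      \<comment> \<open>As \<open>f\<close> matches the vertices of the class with its patterns,
        both spans have the same dimension and the inclusion just proved becomes an
        equality.\<close>
      have "f ` C = B" using f by (force simp: C_def B_def bij_betw_def)
      moreover have "inj_on f C" using f CR by (auto simp: bij_betw_def intro: inj_on_subset)
      ultimately have "card B = card C" using card_image by blast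
      then have "card (e ` B) = card (w ` C)"
        using card_image[OF fC(2)] card_image[OF inj_on_subset[OF e_inj BV]] by simp
      then have "span (w ` C) \<subseteq> span (e ` B)"
        using fC by (intro span_eq_of_card[OF _ independent_mono[OF e_ind] sub1]) (use BV in auto)
      moreover have "w r \<in> span (w ` C)" using r d by (intro span_base) (auto simp: C_def)
      moreover have "B = {c \<in> V. agree k c (f r)}"
        using d(2) agree_trans agree_sym unfolding B_def by blast
      ultimately show "w r \<in> M k (f r)" using k by (auto simp: M_def)
    qed
  qed simp
  then obtain b where "w r = sc b (e (f r))" using M_0[OF fV[OF r]] r by blast
  then show ?thesis using w_nonzero[OF r] by (metis scale_zero_left)
qed

text \<open>Every edge is already visible in the raising operators, whose coefficients are nonzero.
  For the lowering operators it suffices that they produce no further edges.\<close>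

lemma scaled_basis_edges:
  assumes g: "bij_betw g R V" and a: "\<And>r. r \<in> R \<Longrightarrow> a r \<noteq> 0 \<and> w r = sc (a r) (e (g r))"
  shows "supp_edges sc n x y R w = {(s, i, t). s \<in> R \<and> t \<in> R \<and> (g s, i, g t) \<in> edges}"
proof -
  have gV: "g r \<in> V" if "r \<in> R" for r using g that by (auto simp: bij_betw_def)
  have cE: "coeff_in sc R w (E u) t = u (g t) / a t" if t: "t \<in> R" for u t
  proof -
    have "E u = (\<Sum>r\<in>R. sc (u (g r)) (e (g r)))"
      unfolding E_def by (rule sum.reindex_bij_betw[OF g, symmetric])
    also have "\<dots> = (\<Sum>r\<in>R. sc (u (g r) / a r) (w r))"
      using a by (intro sum.cong refl) auto
    finally show ?thesis using coeff_in_sum[OF t] by simp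
  qed
  have ew: "w s = E (\<lambda>c. if c = g s then a s else 0)" if "s \<in> R" for s
  proof -
    have "E (\<lambda>c. if c = g s then a s else 0) = sc (if g s = g s then a s else 0) (e (g s))"
      by (rule E_single[OF gV[OF that]]) (simp split: if_splits)
    then show ?thesis using a[OF that] by simp
  qed
  have X: "coeff_in sc R w (x i (w s)) t \<noteq> 0 \<longleftrightarrow> (g s, i, g t) \<in> edges"
    if st: "s \<in> R" "t \<in> R" and i: "i \<in> {1..n}" for s i t
  proof -
    have "coeff_in sc R w (x i (w s)) t = xf i (\<lambda>c. if c = g s then a s else 0) (g t) / a t"
      using st by (subst ew) (simp_all add: x_E[OF i] cE)
    moreover have "xf i (\<lambda>c. if c = g s then a s else 0) (g t) \<noteq> 0 \<longleftrightarrow> (g s, i, g t) \<in> edges"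
    proof (cases "\<exists>p\<in>pos i. g t = raise (g s) p")
      case True
      then obtain p where p: "p \<in> pos i" "g t = raise (g s) p" by blast
      have "xf i (\<lambda>c. if c = g s then a s else 0) (g t) = (\<Sum>q\<in>pos i. if q = p then a s * cP (g s) p else 0)"
        unfolding xf_def
      proof (rule sum.cong[OF refl])
        fix q
        show "(if 0 < g t q \<and> lower (g t) q \<in> V then (if lower (g t) q = g s then a s else 0) * cP (lower (g t) q) q else 0)
          = (if q = p then a s * cP (g s) p else 0)"
        proof (cases "q = p")
          case True
          then show ?thesis using p(2) gV[OF st(1)] by (simp add: raise_apply)
        next
          case False
          have "lower (g t) q \<noteq> g s" if "0 < g t q"
          proof
            assume "lower (g t) q = g s"
            then have "raise (g s) q = raise (g s) p" using raise_lower[of "g t" q] that p by simp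
            then show False using False by simp
          qed
          then show ?thesis using False by (cases "0 < g t q") simp_all
        qed
      qed
      also have "\<dots> = a s * cP (g s) p" using p by simp
      finally have "xf i (\<lambda>c. if c = g s then a s else 0) (g t) = a s * cP (g s) p" .
      moreover have "cP (g s) p \<noteq> 0"
        by (rule coeff_nonzero(1)[OF gV[OF st(1)]]) (use p gV[OF st(2)] in \<open>auto simp: pos_def\<close>)
      moreover have "(g s, i, g t) \<in> edges" using p gV[OF st(1)] gV[OF st(2)] unfolding edges_def pos_def by auto
      ultimately show ?thesis using a[OF st(1)] by simp
    next
      case False
      then have "(g s, i, g t) \<notin> edges" by (auto simp: edges_def pos_def)
      moreover have "xf i (\<lambda>c. if c = g s then a s else 0) (g t) = 0"
        unfolding xf_def
      proof (rule sum.neutral, intro ballI)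
        fix q assume q: "q \<in> pos i"
        have "lower (g t) q \<noteq> g s" if "0 < g t q" using False q raise_lower[of "g t" q] that by metis
        then show "(if 0 < g t q \<and> lower (g t) q \<in> V then (if lower (g t) q = g s then a s else 0) * cP (lower (g t) q) q else 0) = 0"
          by (cases "0 < g t q") simp_all
      qed
      ultimately show ?thesis by simp
    qed
    ultimately show ?thesis using a[OF st(2)] by simp
  qed
  have Y: "(g s, i, g t) \<in> edges"
    if st: "s \<in> R" "t \<in> R" and i: "i \<in> {1..n}" and nz: "coeff_in sc R w (y i (w t)) s \<noteq> 0" for s i t
  proof -
    let ?S = "{d \<in> V. \<exists>p\<in>pos i. g t p > 0 \<and> d = lower (g t) p}"
    have ys: "y i (e (g t)) \<in> span (e ` ?S)"
      unfolding y_e[OF i gV[OF st(2)]]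
      by (rule span_sum) (auto intro!: span_scale span_base[OF imageI] span_zero)
    have "?S \<subseteq> V" by auto
    then obtain u where u: "y i (e (g t)) = E u" "\<And>d. d \<notin> ?S \<Longrightarrow> u d = 0"
      unfolding E_def by (rule family_span[OF finite_verts e_inj _ ys]) blast
    have "y i (w t) = E (\<lambda>c. a t * u c)"
      using a[OF st(2)] u(1) module_hom.scale[OF y_hom[OF i]] by (simp add: E_def scale_sum_right)
    then have "u (g s) \<noteq> 0" using nz cE[OF st(1)] by auto
    then have "g s \<in> ?S" using u(2) by blast
    then obtain p where p: "p \<in> pos i" "g t p > 0" "g s = lower (g t) p" by blast
    then have "g t = raise (g s) p" by simp
    then show ?thesis using p(1) gV[OF st(1)] gV[OF st(2)] unfolding edges_def pos_def by auto
  qed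
  have "i \<in> {1..n}" if "(c, i, d) \<in> edges" for c i d using that col_bounds by (auto simp: edges_def)
  then show ?thesis using X Y unfolding supp_edges_def by blast
qed

lemma scaled_basis_irreducible:
  assumes g: "bij_betw g R V" and a: "\<And>r. r \<in> R \<Longrightarrow> a r \<noteq> 0 \<and> w r = sc (a r) (e (g r))"
  shows "restricts_irreducibly sc n x y h R w"
  unfolding restricts_irreducibly_def
proof (intro ballI)
  fix k r assume k: "k \<in> {1..n-1}" and r: "r \<in> R"
  have kn: "k \<le> n" using k by auto
  have gV: "g r \<in> V" if "r \<in> R" for r using g that by (auto simp: bij_betw_def)
  let ?E = "supp_edges sc n x y R w"
  have Eq: "?E = {(s, i, t). s \<in> R \<and> t \<in> R \<and> (g s, i, g t) \<in> edges}"
    by (rule scaled_basis_edges[OF g]) (rule a)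
  define S where "S = {(s, t). \<exists>i\<in>{1..k}. (s, i, t) \<in> ?E \<or> (t, i, s) \<in> ?E}"
  \<comment> \<open>An edge of color at most \<open>k\<close> keeps the entries of higher color.
    Conversely two elements of a class both climb to its unique maximal element, and reversing one
    of the climbs joins them.\<close>
  have comp: "component k ?E r = {u \<in> R. agree k (g u) (g r)}"
  proof (intro set_eqI iffI)
    fix u assume "u \<in> component k ?E r"
    then have "(r, u) \<in> S\<^sup>*" by (simp add: component_def S_def)
    then show "u \<in> {u \<in> R. agree k (g u) (g r)}"
    proof (induction rule: rtrancl_induct)
      case base then show ?case using r by simp
    next
      case (step u v)
      have "v \<in> R \<and> agree k (g u) (g v)"
      proof -
        obtain i where i: "i \<in> {1..k}" "(u, i, v) \<in> ?E \<or> (v, i, u) \<in> ?E" using step(2) by (auto simp: S_def)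
        from i(2) show ?thesis
        proof
          assume "(u, i, v) \<in> ?E"
          then obtain p where "v \<in> R" "p \<in> I" "g v = raise (g u) p" "i = col p" by (auto simp: Eq edges_def)
          then show ?thesis using agree_raise[of p k "g u"] i by auto
        next
          assume "(v, i, u) \<in> ?E"
          then obtain p where "v \<in> R" "p \<in> I" "g u = raise (g v) p" "i = col p" by (auto simp: Eq edges_def)
          then show ?thesis using agree_sym[OF agree_raise[of p k "g v"]] i by auto
        qed
      qed
      then show ?case using step agree_trans agree_sym by blast
    qed
  next
    fix u assume u: "u \<in> {u \<in> R. agree k (g u) (g r)}"
    define gi where "gi = the_inv_into R g"
    have gi: "gi (g r) = r" if "r \<in> R" for r unfolding gi_def using g that by (simp add: bij_betw_def the_inv_into_f_f)
    have giR: "gi c \<in> R" "g (gi c) = c" if "c \<in> V" for c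
      unfolding gi_def using g that by (auto simp: bij_betw_def the_inv_into_into f_the_inv_into_f)
    have lift: "(gi c, gi d) \<in> S\<^sup>*" if "(c, d) \<in> (path k)\<^sup>*" for c d
      using that
    proof (induction rule: rtrancl_induct)
      case (step d d')
      then obtain p where p: "d \<in> V" "d' \<in> V" "p \<in> I" "col p \<le> k" "d' = raise d p" by (auto simp: path_def)
      then have "(gi d, col p, gi d') \<in> ?E" unfolding Eq edges_def using giR by auto
      then have "(gi d, gi d') \<in> S" using p col_bounds[OF p(3)] unfolding S_def by auto
      with step show ?case by simp
    qed simp
    have sym: "S\<inverse> = S" by (auto simp: S_def)
    obtain d where d: "d \<in> V" "agree k (g u) d" "kmax k d" "(g u, d) \<in> (path k)\<^sup>*"
      using path_to_kmax[of "g u" k] gV u by auto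
    obtain d' where d': "d' \<in> V" "agree k (g r) d'" "kmax k d'" "(g r, d') \<in> (path k)\<^sup>*"
      using path_to_kmax[of "g r" k] gV r by auto
    have "agree k d d'" using agree_trans[OF agree_trans[OF agree_sym[OF d(2)]] d'(2)] u by auto
    then have "d = d'" using kmax_unique d d' by blast
    then have "(r, gi d) \<in> S\<^sup>*" "(u, gi d) \<in> S\<^sup>*" using lift[OF d(4)] lift[OF d'(4)] gi r u by auto
    moreover from this(2) have "(gi d, u) \<in> S\<^sup>*" using rtrancl_converseI[of u "gi d" S] unfolding sym by simp
    ultimately have "(r, u) \<in> S\<^sup>*" by simp
    then show "u \<in> component k ?E r" by (simp add: component_def S_def)
  qed
  define B where "B = {c \<in> V. agree k c (g r)}"
  have BV: "B \<subseteq> V" by (auto simp: B_def)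
  have span_eq: "span (w ` component k ?E r) = span (e ` B)"
  proof
    show "span (w ` component k ?E r) \<subseteq> span (e ` B)"
      unfolding comp using a gV by (intro span_minimal) (auto simp: B_def intro!: span_scale span_base[OF imageI])
    have "e c \<in> span (w ` component k ?E r)" if c: "c \<in> B" for c
    proof -
      obtain s where s: "s \<in> R" "g s = c" using g c BV by (metis bij_betw_def imageE subsetD)
      then have "w s \<in> span (w ` component k ?E r)" unfolding comp using c by (intro span_base) (auto simp: B_def)
      from span_scale[OF this, of "1 / a s"] show ?thesis using a[OF s(1)] s by simp
    qed
    then show "span (e ` B) \<subseteq> span (w ` component k ?E r)" by (intro span_minimal) auto
  qed
  have ne: "span (e ` B) \<noteq> {0}"
  proof -
    have "w r \<in> span (e ` B)" unfolding span_eq[symmetric] comp using r by (intro span_base) auto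
    then show ?thesis using w_nonzero[OF r] by auto
  qed
  show "irreducible_sub sc {1..k} x y h (span (w ` component k ?E r))"
    unfolding irreducible_sub_def span_eq
  proof (intro conjI allI impI)
    show "subspace (span (e ` B))" by simp
    show "invariant_under {1..k} x y h (span (e ` B))"
      unfolding invariant_under_def B_def using class_invariant[OF kn] by blast
    show "span (e ` B) \<noteq> {0}" by fact
    fix U assume "subspace U \<and> U \<subseteq> span (e ` B) \<and> invariant_under {1..k} x y h U"
    then have U: "subspace U" "U \<subseteq> span (e ` B)" and inv: "\<And>i b. i \<in> {1..k} \<Longrightarrow> b \<in> U \<Longrightarrow> x i b \<in> U \<and> y i b \<in> U"
      unfolding invariant_under_def by blast+
    show "U = {0} \<or> U = span (e ` B)"
    proof (cases "U = {0}")
      case False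
      \<comment> \<open>A nonzero invariant subspace contains a singular vector, which must be a
        multiple of the basis vector of the unique maximal pattern; lowering returns the whole
        class.\<close>
      then obtain b where "b \<in> U" "b \<noteq> 0" using subspace_0[OF U(1)] by blast
      then obtain b where b: "b \<in> U" "b \<noteq> 0" "\<forall>i\<in>{1..k}. x i b = 0"
        using singular_exists[of U k b] inv kn e_span by auto
      obtain u where u: "b = E u" "\<And>c. c \<notin> B \<Longrightarrow> u c = 0"
        using family_span[OF finite_verts e_inj BV, of b] U(2) b(1) unfolding E_def by blast
      obtain d where d: "d \<in> V" "agree k (g r) d" "kmax k d" using path_to_kmax[OF gV[OF r]] by blast
      have "c = d" if c: "c \<in> V" "u c \<noteq> 0" for c
      proof (rule kmax_unique[OF c(1) _ d(1,3)])
        show "kmax k c" by (rule singular_support[of k u c]) (use b u c kn in auto)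
        have "c \<in> B" using u(2) c by blast
        then show "agree k c d" using agree_trans d(2) by (auto simp: B_def)
      qed
      from E_single[OF d(1) this] u have bd: "b = sc (u d) (e d)" by simp
      then have "u d \<noteq> 0" using b by auto
      then have ed: "e d \<in> U" using subspace_scale[OF U(1) b(1), of "1 / u d"] bd by simp
      have "e c \<in> U" if "c \<in> B" for c
      proof (rule lowering_generates[OF U(1) _ kn d(1,3) ed])
        show "agree k c d" using agree_trans d(2) that by (auto simp: B_def)
      qed (use inv that BV in auto)
      then have "span (e ` B) \<subseteq> U" using U(1) by (intro span_minimal) auto
      then show ?thesis using U(2) by auto
    qed simp
  qed
qed

text \<open>The singular vectors of a component span are stable under all \<open>h i\<close>, and
  their weights are separated by \<open>kmax_wt_unique\<close>; so some \<open>e c\<close> is among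
  them. Lowering generates the class of \<open>c\<close> inside the component span, and
  irreducibility makes the two equal.\<close>

lemma irreducible_basis:
  assumes irr: "restricts_irreducibly sc n x y h R w"
  shows "\<exists>g a. bij_betw g R V \<and> (\<forall>r\<in>R. a r \<noteq> 0 \<and> w r = sc (a r) (e (g r)))"
proof -
  let ?E = "supp_edges sc n x y R w"
  define W where "W k r = span (w ` component k ?E r)" for k r
  have comp_R: "component k ?E r \<subseteq> R" if "r \<in> R" for k r
  proof
    fix u assume "u \<in> component k ?E r"
    then have "(r, u) \<in> {(s, t). \<exists>i\<in>{1..k}. (s, i, t) \<in> ?E \<or> (t, i, s) \<in> ?E}\<^sup>*" by (simp add: component_def)
    then show "u \<in> R" by (induction rule: rtrancl_induct) (use that in \<open>auto simp: supp_edges_def\<close>)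
  qed
  have comp_self: "r \<in> component k ?E r" for k r by (simp add: component_def)
  have comp_mono: "component k ?E r \<subseteq> component (Suc k) ?E r" for k r
    unfolding component_def by (auto elim!: rtrancl_mono[THEN subsetD, rotated])
  have comp_cl: "s \<in> component k ?E r \<longleftrightarrow> t \<in> component k ?E r" if "(s, i, t) \<in> ?E" "i \<in> {1..k}" for s i t k r
  proof -
    define S where "S = {(s, t). \<exists>i\<in>{1..k}. (s, i, t) \<in> ?E \<or> (t, i, s) \<in> ?E}"
    have "(s, t) \<in> S" "(t, s) \<in> S" using that by (auto simp: S_def)
    moreover have "component k ?E r = {u. (r, u) \<in> S\<^sup>*}" by (simp add: component_def S_def)
    ultimately show ?thesis by (auto intro: rtrancl_into_rtrancl)
  qed
  have "\<forall>r\<in>R. \<exists>c\<in>V. W 0 r \<subseteq> M 0 c"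
  proof (rule inc_induct[of 0 N "\<lambda>k. \<forall>r\<in>R. \<exists>c\<in>V. W k r \<subseteq> M k c"])
    show "\<forall>r\<in>R. \<exists>c\<in>V. W N r \<subseteq> M N c" using topv_in by (auto simp: M_def e_span)
  next
    fix k assume k: "0 \<le> k" "k < N" and IH: "\<forall>r\<in>R. \<exists>c\<in>V. W (Suc k) r \<subseteq> M (Suc k) c"
    have kn: "k \<le> n" "k \<le> n - 1" using k N_le_n by auto
    show "\<forall>r\<in>R. \<exists>c\<in>V. W k r \<subseteq> M k c"
    proof
      fix r assume r: "r \<in> R"
      obtain c' where c': "c' \<in> V" "W (Suc k) r \<subseteq> M (Suc k) c'" using IH r by blast
      have sub: "W k r \<subseteq> M (Suc k) c'"
        using c' span_mono[OF image_mono[OF comp_mono[of k r]], of w] by (auto simp: W_def)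
      have xy: "x i b \<in> W k r" "y i b \<in> W k r" if "i \<in> {1..k}" "b \<in> W k r" for i b
      proof -
        have J: "{1..k} \<subseteq> {1..n}" using kn by auto
        show "x i b \<in> W k r" "y i b \<in> W k r"
          using supp_closed[OF J comp_R[OF r] comp_cl that(1)] that(2) by (auto simp: W_def)
      qed
      have hh: "h i b \<in> W k r" if "i \<in> {1..n}" "b \<in> W k r" for i b
        using w_span_h[OF that(1) comp_R[OF r]] that by (auto simp: W_def)
      have sW: "subspace (W k r)" by (simp add: W_def)
      have wr: "w r \<in> W k r" using comp_self by (auto simp: W_def intro: span_base)
      define S where "S = {b \<in> W k r. \<forall>i\<in>{1..k}. x i b = 0}"
      have xh: "module_hom sc sc (x i)" if "i \<in> {1..k}" for i using that kn by (intro x_hom) auto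
      have sS: "subspace S"
        using sW module_hom.zero[OF xh] module_hom.add[OF xh] module_hom.scale[OF xh]
        by (auto simp: subspace_def S_def)
      have hS: "h i b \<in> S" if i: "i \<in> {1..n}" and b: "b \<in> S" for i b
      proof -
        have "x j (h i b) = 0" if j: "j \<in> {1..k}" for j
        proof -
          have j': "j \<in> {1..n}" using j kn by auto
          have "x j b = 0" using b j by (auto simp: S_def)
          then show ?thesis using hx[OF i j', of b] module_hom.zero[OF h_hom[OF i]] by simp
        qed
        then show ?thesis using hh[OF i] b by (auto simp: S_def)
      qed
      have supp: "kmax k c \<and> (k + 1 < N \<longrightarrow> agree (k + 1) c c')" if "E u \<in> S" "c \<in> V" "u c \<noteq> 0" for u c
      proof
        show "kmax k c" by (rule singular_support[of k u c]) (use that kn in \<open>auto simp: S_def\<close>)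
        have "E u \<in> M (Suc k) c'" using that sub by (auto simp: S_def)
        then obtain u' where u': "E u = E u'" "\<And>d. d \<in> V \<Longrightarrow> u' d \<noteq> 0 \<Longrightarrow> Suc k < N \<Longrightarrow> agree (Suc k) d c'"
          using M_support by blast
        show "k + 1 < N \<longrightarrow> agree (k + 1) c c'" using u'(2)[OF that(2)] E_eq[OF u'(1) that(2)] that(3) by simp
      qed
      obtain b where b: "b \<in> W k r" "b \<noteq> 0" "\<forall>i\<in>{1..k}. x i b = 0"
        using singular_exists[of "W k r" k "w r"] xy kn wr w_nonzero[OF r] e_span by auto
      obtain u where u: "b = E u" using E_surj by blast
      have "E u \<in> S" "E u \<noteq> 0" using b u by (auto simp: S_def)
      then obtain c where c: "c \<in> V" "u c \<noteq> 0" "e c \<in> S"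
      proof -
        have "\<exists>c\<in>V. u c \<noteq> 0 \<and> e c \<in> S"
        proof (rule distinct_weights_pick[OF sS])
          show "h i b \<in> S" if "i \<in> {1..n}" "b \<in> S" for i b using hS that .
          show "E u \<in> S" "E u \<noteq> 0" by fact+
        next
          fix u c d assume a: "E u \<in> S" "c \<in> V" "d \<in> V" "u c \<noteq> 0" "u d \<noteq> 0" "c \<noteq> d"
          show "\<exists>i\<in>{1..n}. wt i c \<noteq> wt i d"
          proof (rule ccontr)
            assume "\<not> ?thesis"
            then have "c = d"
              using kmax_wt_unique[OF k(2) a(2) _ a(3)] supp[OF a(1,2,4)] supp[OF a(1,3,5)] agree_trans agree_sym by blast
            with a show False by simp
          qed
        qed
        then show ?thesis using that by blast
      qed
      have km: "kmax k c" using supp[OF \<open>E u \<in> S\<close> c(1,2)] by blast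
      have ec: "e c \<in> W k r" using c by (auto simp: S_def)
      have "e d \<in> W k r" if "d \<in> V" "agree k d c" for d
        by (rule lowering_generates[OF sW _ kn(1) c(1) km ec that]) (use xy in auto)
      then have MW: "M k c \<subseteq> W k r" unfolding M_def using sW k by (intro span_minimal) auto
      \<comment> \<open>Irreducibility is assumed from level 1 on. At level 0 a component is a
        single vertex and its span a line, which gives the equality directly.\<close>
      have "W k r \<subseteq> M k c"
      proof (cases "k = 0")
        case True
        have "component 0 ?E r = {r}" by (simp add: component_def)
        then have W0: "W k r = span {w r}" by (simp add: W_def True)
        then obtain q where q: "e c = sc q (w r)" using ec by (auto simp: span_singleton)
        have "e c \<noteq> 0" using e_ind c dependent_zero by (metis imageI)
        then have "q \<noteq> 0" using q by auto
        have "e c \<in> M k c" unfolding M_def using c by (intro span_base) auto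
        from span_scale[OF this[unfolded M_def], of "1 / q"] have "w r \<in> M k c" using q \<open>q \<noteq> 0\<close> by (simp add: M_def)
        then show ?thesis unfolding W0 M_def by (intro span_minimal) auto
      next
        case False
        then have "irreducible_sub sc {1..k} x y h (W k r)"
          using irr r kn by (auto simp: restricts_irreducibly_def W_def)
        moreover have "subspace (M k c)" by (simp add: M_def)
        moreover have "invariant_under {1..k} x y h (M k c)"
          unfolding invariant_under_def M_def using class_invariant[OF kn(1)] k by (auto simp: image_subset_iff)
        moreover have "M k c \<noteq> {0}"
        proof -
          have "e c \<in> M k c" unfolding M_def using c by (intro span_base) auto
          moreover have "e c \<noteq> 0" using e_ind c dependent_zero by (metis imageI)
          ultimately show ?thesis by auto
        qed
        ultimately show ?thesis using MW unfolding irreducible_sub_def by blast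
      qed
      then show "\<exists>c\<in>V. W k r \<subseteq> M k c" using c by blast
    qed
  qed simp
  then obtain g where g: "\<And>r. r \<in> R \<Longrightarrow> g r \<in> V \<and> W 0 r \<subseteq> M 0 (g r)" by metis
  have "\<exists>a. a \<noteq> 0 \<and> w r = sc a (e (g r))" if r: "r \<in> R" for r
  proof -
    have "w r \<in> W 0 r" using comp_self by (auto simp: W_def intro: span_base)
    then obtain a where "w r = sc a (e (g r))" using g[OF r] M_0 by blast
    then show ?thesis using w_nonzero[OF r] by (metis scale_zero_left)
  qed
  then obtain a where a: "\<And>r. r \<in> R \<Longrightarrow> a r \<noteq> 0 \<and> w r = sc (a r) (e (g r))" by metis
  have inj: "inj_on g R"
  proof (rule inj_onI)
    fix r s assume rs: "r \<in> R" "s \<in> R" "g r = g s"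
    have "w r = sc (a r / a s) (w s)" using a[OF rs(1)] a[OF rs(2)] rs(3) by simp
    then have "w r \<in> span (w ` {s})" by (metis image_empty image_insert insertI1 span_base span_scale)
    then show "r = s" using w_in_span[of "{s}" r] rs by simp
  qed
  moreover have "g ` R = V"
  proof (rule card_subset_eq)
    show "card (g ` R) = card V" using card_image[OF inj] w_card by simp
  qed (use g in auto)
  ultimately have "bij_betw g R V" by (simp add: bij_betw_def)
  with a show ?thesis by blast
qed

end
end

section \<open>Existence of the Gelfand-Tsetlin basis\<close>

lemma sum_apply: "(\<Sum>a\<in>A. f a) t = (\<Sum>a\<in>A. f a t)" for f :: "'a \<Rightarrow> 'b \<Rightarrow> 'c::comm_monoid_add"
  by (induction A rule: infinite_finite_induct) auto

definition fscale :: "complex \<Rightarrow> (array \<Rightarrow> complex) \<Rightarrow> array \<Rightarrow> complex" where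
  "fscale a f = (\<lambda>t. a * f t)"

definition delta :: "array \<Rightarrow> array \<Rightarrow> complex" where
  "delta c = (\<lambda>d. if d = c then 1 else 0)"

interpretation fun_space: vector_space fscale
  by unfold_locales (auto simp: fscale_def fun_eq_iff algebra_simps)

context tri_pattern
begin

text \<open>Written through the value at the target \<open>t\<close>, which makes linearity
  immediate; on the functions \<open>delta c\<close> it becomes the formula required by
  \<open>gt_module\<close>.\<close>

definition mX :: "nat \<Rightarrow> (array \<Rightarrow> complex) \<Rightarrow> array \<Rightarrow> complex" where
  "mX i f = (\<lambda>t. if t \<in> V then \<Sum>p\<in>pos i. if t p > 0 \<and> lower t p \<in> V then cP (lower t p) p * f (lower t p) else 0 else 0)"

definition mY :: "nat \<Rightarrow> (array \<Rightarrow> complex) \<Rightarrow> array \<Rightarrow> complex" where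
  "mY i f = (\<lambda>t. if t \<in> V then \<Sum>p\<in>pos i. if raise t p \<in> V then cQ t p * f (raise t p) else 0 else 0)"

definition mH :: "nat \<Rightarrow> (array \<Rightarrow> complex) \<Rightarrow> array \<Rightarrow> complex" where
  "mH i f = (\<lambda>t. of_int (wt i t) * f t)"

lemma model_hom: "module_hom fscale fscale (mX i)" "module_hom fscale fscale (mY i)" "module_hom fscale fscale (mH i)"
proof -
  have m: "module fscale" by (rule fun_space.module_axioms)
  show "module_hom fscale fscale (mX i)" unfolding module_hom_iff
    by (intro conjI allI m ext) (auto simp: mX_def fscale_def sum.distrib[symmetric] sum_distrib_left algebra_simps intro!: sum.cong)
  show "module_hom fscale fscale (mY i)" unfolding module_hom_iff
    by (intro conjI allI m ext) (auto simp: mY_def fscale_def sum.distrib[symmetric] sum_distrib_left algebra_simps intro!: sum.cong)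
  show "module_hom fscale fscale (mH i)" unfolding module_hom_iff
    by (intro conjI allI m ext) (auto simp: mH_def fscale_def algebra_simps)
qed

lemma inj_delta: "inj delta"
  by (rule injI) (metis delta_def one_neq_zero)

lemma delta_sum: "finite A \<Longrightarrow> (\<Sum>c\<in>A. fscale (u c) (delta c)) t = (if t \<in> A then u t else 0)"
  by (simp add: sum_apply fscale_def delta_def if_distrib cong: if_cong)

lemma raise_lower_iff: "t p > 0 \<and> lower t p = c \<longleftrightarrow> t = raise c p"
  by (auto simp: raise_apply)

lemma model_mX:
  assumes "c \<in> V"
  shows "mX i (delta c) = (\<Sum>p\<in>pos i. if raise c p \<in> V then fscale (cP c p) (delta (raise c p)) else 0)"
proof
  fix t
  have "(if t \<in> V then if t p > 0 \<and> lower t p \<in> V then cP (lower t p) p * delta c (lower t p) else 0 else 0)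
    = (if raise c p \<in> V then fscale (cP c p) (delta (raise c p)) else 0) t" for p
  proof (cases "t = raise c p")
    case True
    then show ?thesis using assms by (simp add: fscale_def delta_def raise_apply)
  next
    case False
    then have "\<not> (t p > 0 \<and> lower t p = c)" by (simp add: raise_lower_iff)
    then show ?thesis using False by (auto simp: fscale_def delta_def)
  qed
  then show "mX i (delta c) t = (\<Sum>p\<in>pos i. if raise c p \<in> V then fscale (cP c p) (delta (raise c p)) else 0) t"
    unfolding mX_def sum_apply by (cases "t \<in> V") (simp_all cong: sum.cong)
qed

lemma model_mY:
  assumes "c \<in> V"
  shows "mY i (delta c) = (\<Sum>p\<in>pos i. if c p > 0 \<and> lower c p \<in> V then fscale (cQ (lower c p) p) (delta (lower c p)) else 0)"
proof
  fix t
  have "(if t \<in> V then if raise t p \<in> V then cQ t p * delta c (raise t p) else 0 else 0)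
    = (if c p > 0 \<and> lower c p \<in> V then fscale (cQ (lower c p) p) (delta (lower c p)) else 0) t" for p
  proof (cases "c = raise t p")
    case True
    then show ?thesis using assms by (simp add: fscale_def delta_def raise_apply)
  next
    case False
    then have "\<not> (c p > 0 \<and> lower c p = t)" by (simp add: raise_lower_iff)
    then show ?thesis using False by (auto simp: fscale_def delta_def)
  qed
  then show "mY i (delta c) t = (\<Sum>p\<in>pos i. if c p > 0 \<and> lower c p \<in> V then fscale (cQ (lower c p) p) (delta (lower c p)) else 0) t"
    unfolding mY_def sum_apply by (cases "t \<in> V") (simp_all cong: sum.cong)
qed

lemma model_gt: "gt_module N m n bcol fscale mX mY mH delta"
proof (intro gt_module.intro gt_module_axioms.intro)
  show "tri_pattern N n bcol" by (rule tri_pattern_axioms)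
  show "vector_space fscale" by (rule fun_space.vector_space_axioms)
  show "inj_on delta V" using inj_delta inj_on_subset by blast
  show "fun_space.independent (delta ` V)"
  proof
    assume "fun_space.dependent (delta ` V)"
    then obtain u where u: "\<exists>v\<in>delta ` V. u v \<noteq> 0" "(\<Sum>v\<in>delta ` V. fscale (u v) v) = 0"
      by (auto simp: fun_space.dependent_finite)
    have "(\<Sum>c\<in>V. fscale (u (delta c)) (delta c)) = 0"
      using u(2) inj_on_subset[OF inj_delta subset_UNIV, of V] by (simp add: sum.reindex)
    then have "u (delta c) = 0" if "c \<in> V" for c
      using delta_sum[OF finite_verts, of "\<lambda>c. u (delta c)" c] that by simp
    with u(1) show False by auto
  qed
  show "mH i (delta c) = fscale (of_int (wt i c)) (delta c)" for i c
    by (auto simp: mH_def fscale_def delta_def)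
qed (use model_hom model_mX model_mY in auto)

lemma model_hy:
  assumes "i \<in> {1..n}"
  shows "mH i (mY j f) = mY j (mH i f) - fscale (of_int (cartan ltype n i j)) (mY j f)"
proof
  fix t
  have "of_int (wt i t) * (if raise t p \<in> V then cQ t p * f (raise t p) else 0) =
     (if raise t p \<in> V then cQ t p * (of_int (wt i (raise t p)) * f (raise t p)) else 0) -
     of_int (cartan ltype n i j) * (if raise t p \<in> V then cQ t p * f (raise t p) else 0)" if "p \<in> pos j" for p
    using wt_raise[of p i t] assms that by (simp add: pos_def algebra_simps)
  then show "mH i (mY j f) t = (mY j (mH i f) - fscale (of_int (cartan ltype n i j)) (mY j f)) t"
    by (simp add: mH_def mY_def fscale_def sum_distrib_left sum_subtractf[symmetric] cong: sum.cong)
qed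

text \<open>Off the diagonal both paths exist together by \<open>vert_diamond\<close> and carry
  equal products by \<open>coeff_diamond\<close>; on the diagonal \<open>color_gt_sum\<close> yields
  the weight. The support condition is there because \<open>mX\<close> and \<open>mY\<close> vanish
  off the patterns whereas \<open>mH\<close> does not.\<close>

lemma model_xy:
  assumes i: "i \<in> {1..n}" and supp: "\<And>t. t \<notin> vertsB N m \<Longrightarrow> f t = 0"
  shows "mX i (mY j f) = mY j (mX i f) + (if i = j then mH i f else 0)"
proof
  fix t
  show "mX i (mY j f) t = (mY j (mX i f) + (if i = j then mH i f else 0)) t"
  proof (cases "t \<in> V")
    case False
    then show ?thesis using supp by (simp add: mX_def mY_def mH_def)
  next
    case t: True
    define A where "A p q = (if t p > 0 \<and> lower t p \<in> V \<and> raise (lower t p) q \<in> V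
       then cP (lower t p) p * cQ (lower t p) q * f (raise (lower t p) q) else 0)" for p q
    define B where "B p q = (if raise t q \<in> V \<and> raise t q p > 0 \<and> lower (raise t q) p \<in> V
       then cQ t q * cP (lower (raise t q) p) p * f (lower (raise t q) p) else 0)" for p q
    have 1: "mX i (mY j f) t = (\<Sum>p\<in>pos i. \<Sum>q\<in>pos j. A p q)"
      unfolding mX_def A_def using t
      by (auto simp: mY_def sum_distrib_left mult.assoc intro!: sum.cong)
    have 2: "mY j (mX i f) t = (\<Sum>p\<in>pos i. \<Sum>q\<in>pos j. B p q)"
      unfolding mY_def B_def using t
      by (subst sum.swap) (auto simp: mX_def sum_distrib_left mult.assoc intro!: sum.cong)
    have off: "A p q = B p q" if pq: "p \<in> pos i" "q \<in> pos j" "p \<noteq> q" for p q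
    proof (cases "t p > 0")
      case tp: True
      have sw: "lower (raise t q) p = raise (lower t p) q"
        using pq by (auto simp: lower_def raise_def fun_eq_iff)
      have c: "(lower t p \<in> V \<and> raise (lower t p) q \<in> V) = (raise t q \<in> V \<and> raise (lower t p) q \<in> V)"
        using vert_diamond[OF t, of q p] pq tp by blast
      have d: "cP (lower t p) p * cQ (lower t p) q = cP (raise (lower t p) q) p * cQ t q"
        using coeff_diamond[of p q "lower t p"] pq tp by (simp add: pos_def)
      have "raise t q p > 0" using tp by (simp add: raise_apply)
      then show ?thesis unfolding A_def B_def sw d using tp c by (auto simp: mult.commute)
    next
      case False
      then show ?thesis using pq by (simp add: A_def B_def raise_apply)
    qed
    have diag: "A p p - B p p = (down_pi t p - up_pi t p) * f t" for p
      using t by (auto simp: A_def B_def down_pi_def up_pi_def ppi_def raise_apply algebra_simps)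
    have "mX i (mY j f) t - mY j (mX i f) t = (\<Sum>p\<in>pos i. \<Sum>q\<in>pos j. A p q - B p q)"
      unfolding 1 2 by (simp add: sum_subtractf)
    also have "\<dots> = (\<Sum>p\<in>pos i. \<Sum>q\<in>pos j. if p = q then (down_pi t p - up_pi t p) * f t else 0)"
      using off diag by (intro sum.cong refl) auto
    also have "\<dots> = (\<Sum>p\<in>pos i. if p \<in> pos j then (down_pi t p - up_pi t p) * f t else 0)"
      by (intro sum.cong refl) (simp add: sum.delta')
    also have "\<dots> = (if i = j then of_int (wt i t) * f t else 0)"
    proof (cases "i = j")
      case True
      then show ?thesis using color_gt_sum[OF t i] by (simp add: sum_distrib_right[symmetric] cong: sum.cong)
    next
      case False
      then show ?thesis by (auto simp: pos_def intro!: sum.neutral)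
    qed
    finally show ?thesis by (simp add: mH_def algebra_simps split: if_splits)
  qed
qed

end

section \<open>Comparison of the model with the given module\<close>

locale hw_module = tri_pattern N m n bcol + vector_space sc
  for N m n bcol and sc :: "complex \<Rightarrow> 'v::ab_group_add \<Rightarrow> 'v" +
  fixes x y h :: "nat \<Rightarrow> 'v \<Rightarrow> 'v" and v0 :: 'v
  assumes x_hom: "i \<in> {1..n} \<Longrightarrow> module_hom sc sc (x i)"
    and y_hom: "i \<in> {1..n} \<Longrightarrow> module_hom sc sc (y i)"
    and h_hom: "i \<in> {1..n} \<Longrightarrow> module_hom sc sc (h i)"
    and hh: "i \<in> {1..n} \<Longrightarrow> j \<in> {1..n} \<Longrightarrow> h i (h j v) = h j (h i v)"
    and hx: "i \<in> {1..n} \<Longrightarrow> j \<in> {1..n} \<Longrightarrow>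
      h i (x j v) = x j (h i v) + sc (of_int (cartan ltype n i j)) (x j v)"
    and hy: "i \<in> {1..n} \<Longrightarrow> j \<in> {1..n} \<Longrightarrow>
      h i (y j v) = y j (h i v) - sc (of_int (cartan ltype n i j)) (y j v)"
    and xy: "i \<in> {1..n} \<Longrightarrow> j \<in> {1..n} \<Longrightarrow> x i (y j v) = y j (x i v) + (if i = j then h i v else 0)"
    and irr: "irreducible_sub sc {1..n} x y h UNIV"
    and v0: "v0 \<noteq> 0" "i \<in> {1..n} \<Longrightarrow> x i v0 = 0" "i \<in> {1..n} \<Longrightarrow> h i v0 = sc (of_int (wt i topv)) v0"
begin

text \<open>The coefficients rr are chosen such that zop commutes with y j up to the constant 4.
  Its eigenvalues separate v0 from everything obtained by applying some y j.\<close>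
definition zop :: "'v \<Rightarrow> 'v" where "zop a = (\<Sum>i=1..n. sc (of_int (rr i)) (h i a))"

definition top_eig :: complex where "top_eig = (\<Sum>i=1..n. of_int (rr i * wt i topv))"

lemma zop_add: "zop (a + b) = zop a + zop b"
  unfolding zop_def sum.distrib[symmetric] by (intro sum.cong refl) (simp add: module_hom.add[OF h_hom] scale_right_distrib)

lemma zop_scale: "zop (sc c a) = sc c (zop a)"
  unfolding zop_def scale_sum_right by (intro sum.cong refl) (simp add: module_hom.scale[OF h_hom] mult.commute)

lemma zop_y: "j \<in> {1..n} \<Longrightarrow> zop (y j a) = y j (zop a) - sc 4 (y j a)"
proof -
  assume j: "j \<in> {1..n}"
  have "zop (y j a) = (\<Sum>i=1..n. sc (of_int (rr i)) (y j (h i a)) - sc (of_int (rr i * cartan ltype n i j)) (y j a))"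
    unfolding zop_def by (intro sum.cong refl) (simp add: hy[OF _ j] scale_right_diff_distrib)
  also have "\<dots> = y j (zop a) - sc (of_int (\<Sum>i=1..n. rr i * cartan ltype n i j)) (y j a)"
    by (simp add: sum_subtractf zop_def module_hom.sum[OF y_hom[OF j]] module_hom.scale[OF y_hom[OF j]] scale_sum_left)
  finally show ?thesis unfolding rr_cartan[OF j] by simp
qed

lemma zop_v0: "zop v0 = sc top_eig v0"
  unfolding zop_def top_eig_def scale_sum_left by (intro sum.cong refl) (simp add: v0)

text \<open>A product of the commuting operators \<open>zop - \<mu>\<close>. The list form allows
  the eigenvalues to be shifted one by one when a lowering operator is moved past.\<close>

fun dop :: "complex list \<Rightarrow> 'v \<Rightarrow> 'v" where
  "dop [] a = a"
| "dop (\<mu> # ls) a = dop ls (zop a - sc \<mu> a)"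

lemma zop_diff: "zop (a - b) = zop a - zop b"
  using zop_add[of "a - b" b] by simp

lemma dop_add: "dop ls (a + b) = dop ls a + dop ls b"
proof (induction ls arbitrary: a b)
  case (Cons \<mu> ls)
  have "zop (a + b) - sc \<mu> (a + b) = (zop a - sc \<mu> a) + (zop b - sc \<mu> b)"
    by (simp add: zop_add scale_right_distrib)
  then show ?case using Cons by simp
qed simp

lemma dop_scale: "dop ls (sc c a) = sc c (dop ls a)"
proof (induction ls arbitrary: a)
  case (Cons \<mu> ls)
  have "zop (sc c a) - sc \<mu> (sc c a) = sc c (zop a - sc \<mu> a)"
    by (simp add: zop_scale scale_right_diff_distrib mult.commute)
  then show ?case using Cons by simp
qed simp

lemma dop_zero: "dop ls 0 = 0" using dop_scale[of ls 0 0] by simp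

lemma dop_append: "dop (ls @ ms) a = dop ms (dop ls a)"
  by (induction ls arbitrary: a) auto

lemma dop_step: "dop ls (zop a - sc \<mu> a) = zop (dop ls a) - sc \<mu> (dop ls a)"
proof (induction ls arbitrary: a)
  case (Cons \<nu> ls)
  have "zop (zop a - sc \<mu> a) - sc \<nu> (zop a - sc \<mu> a) = zop (zop a - sc \<nu> a) - sc \<mu> (zop a - sc \<nu> a)"
    by (simp add: zop_diff zop_scale scale_right_diff_distrib mult.commute)
  then show ?case using Cons[of "zop a - sc \<nu> a"] by simp
qed simp

lemma dop_commute: "dop ls (dop ms a) = dop ms (dop ls a)"
  by (induction ms arbitrary: a) (auto simp: dop_step)

definition below :: "complex set" where "below = {top_eig - 4 * of_nat l | l. l \<ge> 1}"

text \<open>The sum of the generalized eigenspaces of \<open>zop\<close> for the eigenvalues in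
  \<open>below\<close>, described by annihilating products so that no weight decomposition of the
  module has to be established.\<close>

definition K :: "'v set" where "K = {a. \<exists>ls. set ls \<subseteq> below \<and> dop ls a = 0}"

lemma K_add: "a \<in> K \<Longrightarrow> b \<in> K \<Longrightarrow> a + b \<in> K"
proof -
  assume "a \<in> K" "b \<in> K"
  then obtain ls ms where "set ls \<subseteq> below" "dop ls a = 0" "set ms \<subseteq> below" "dop ms b = 0" by (auto simp: K_def)
  then show ?thesis unfolding K_def
    by (intro CollectI exI[of _ "ls @ ms"]) (simp add: dop_append dop_add dop_zero dop_commute[of ms ls])
qed

lemma K_scale: "a \<in> K \<Longrightarrow> sc c a \<in> K"
  unfolding K_def by (auto simp: dop_scale)

lemma below_step: "\<mu> \<in> below \<Longrightarrow> \<mu> - 4 \<in> below"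
proof -
  assume "\<mu> \<in> below"
  then obtain l where "l \<ge> 1" "\<mu> = top_eig - 4 * of_nat l" by (auto simp: below_def)
  then have "\<mu> - 4 = top_eig - 4 * of_nat (l + 1)" by (simp add: algebra_simps)
  then show ?thesis unfolding below_def by (intro CollectI exI[of _ "l + 1"]) auto
qed

lemma dop_y: "j \<in> {1..n} \<Longrightarrow> dop (map (\<lambda>\<mu>. \<mu> - 4) ls) (y j a) = y j (dop ls a)"
proof (induction ls arbitrary: a)
  case (Cons \<mu> ls)
  have "zop (y j a) - sc (\<mu> - 4) (y j a) = y j (zop a - sc \<mu> a)"
    using Cons.prems by (simp add: zop_y module_hom.diff[OF y_hom] module_hom.scale[OF y_hom] scale_left_diff_distrib)
  then show ?case using Cons by simp
qed simp

lemma K_y: "j \<in> {1..n} \<Longrightarrow> a \<in> K \<Longrightarrow> y j a \<in> K"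
proof -
  assume j: "j \<in> {1..n}" and "a \<in> K"
  then obtain ls where ls: "set ls \<subseteq> below" "dop ls a = 0" by (auto simp: K_def)
  show ?thesis unfolding K_def
    by (rule CollectI, rule exI[of _ "map (\<lambda>\<mu>. \<mu> - 4) ls"])
       (use ls below_step in \<open>auto simp: dop_y[OF j] module_hom.zero[OF y_hom[OF j]]\<close>)
qed

lemma K_y_v0: "j \<in> {1..n} \<Longrightarrow> y j v0 \<in> K"
proof -
  assume j: "j \<in> {1..n}"
  have "dop [top_eig - 4] (y j v0) = 0"
    using dop_y[OF j, of "[top_eig]" v0] by (simp add: zop_v0 module_hom.zero[OF y_hom[OF j]])
  moreover have "top_eig - 4 \<in> below" unfolding below_def by (intro CollectI exI[of _ 1]) simp
  ultimately show ?thesis unfolding K_def by (intro CollectI exI[of _ "[top_eig - 4]"]) simp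
qed

text \<open>On the line of \<open>v0\<close> each factor of \<open>dop\<close> acts by
  \<open>top_eig - \<mu>\<close>, a positive multiple of 4.\<close>

lemma v0_notin_K: assumes "t \<noteq> 0" shows "sc t v0 \<notin> K"
proof
  assume "sc t v0 \<in> K"
  then obtain ls where ls: "set ls \<subseteq> below" "dop ls (sc t v0) = 0" by (auto simp: K_def)
  have "dop ls (sc t v0) \<noteq> 0" using ls(1) assms
  proof (induction ls arbitrary: t)
    case (Cons \<mu> ls)
    have e: "zop (sc t v0) - sc \<mu> (sc t v0) = sc (t * (top_eig - \<mu>)) v0"
      by (simp add: zop_scale zop_v0 right_diff_distrib scale_left_diff_distrib mult.commute)
    have "top_eig - \<mu> \<noteq> 0" using Cons.prems by (auto simp: below_def)
    then show ?case unfolding dop.simps e using Cons by simp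
  qed (use v0 in simp)
  with ls show False by simp
qed

text \<open>Only lowering is built in. Stability under the other generators is derived by induction
  from their commutation with lowering, and this limits what has to be verified for the model to
  \<open>model_hy\<close> and \<open>model_xy\<close>.\<close>

inductive hwpair :: "'v \<Rightarrow> (array \<Rightarrow> complex) \<Rightarrow> bool" where
  base: "hwpair v0 (delta topv)"
| add: "hwpair a b \<Longrightarrow> hwpair a' b' \<Longrightarrow> hwpair (a + a') (b + b')"
| scale: "hwpair a b \<Longrightarrow> hwpair (sc c a) (fscale c b)"
| lowering: "hwpair a b \<Longrightarrow> i \<in> {1..n} \<Longrightarrow> hwpair (y i a) (mY i b)"

interpretation model: gt_module N m n bcol fscale mX mY mH delta
  by (rule model_gt)

lemma hwpair_supp: "hwpair a b \<Longrightarrow> t \<notin> V \<Longrightarrow> b t = 0"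
  by (induction rule: hwpair.induct) (use topv_in in \<open>auto simp: delta_def fscale_def mY_def\<close>)

lemma hwpair_0: "hwpair 0 0"
proof -
  have "fscale 0 (delta topv) = 0" by (rule fun_space.scale_zero_left)
  then show ?thesis using hwpair.scale[OF hwpair.base, of 0] by (simp only: scale_zero_left)
qed

lemma hwpair_diff: "hwpair a b \<Longrightarrow> hwpair a' b' \<Longrightarrow> hwpair (a - a') (b - b')"
proof -
  assume "hwpair a b" "hwpair a' b'"
  then have "hwpair (a + sc (-1) a') (b + fscale (-1) b')" by (intro hwpair.add hwpair.scale)
  moreover have "b + fscale (-1) b' = b - b'" by (simp add: fscale_def fun_eq_iff)
  ultimately show ?thesis by simp
qed

lemma hwpair_sum: "(\<And>c. c \<in> A \<Longrightarrow> hwpair (f c) (g c)) \<Longrightarrow> hwpair (sum f A) (sum g A)"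
  by (induction A rule: infinite_finite_induct) (auto intro: hwpair.add hwpair_0)

lemma hwpair_h: "hwpair a b \<Longrightarrow> i \<in> {1..n} \<Longrightarrow> hwpair (h i a) (mH i b)"
proof (induction rule: hwpair.induct)
  case base
  have "mH i (delta topv) = fscale (of_int (wt i topv)) (delta topv)" using base topv_in by (intro model.h_e)
  then show ?case using base v0(3) hwpair.scale[OF hwpair.base] by simp
next
  case (add a b a' b')
  show ?case unfolding module_hom.add[OF h_hom[OF add.prems]] module_hom.add[OF model.h_hom[OF add.prems]]
    using add by (intro hwpair.add)
next
  case (scale a b c)
  show ?case unfolding module_hom.scale[OF h_hom[OF scale.prems]] module_hom.scale[OF model.h_hom[OF scale.prems]]
    using scale by (intro hwpair.scale)
next
  case (lowering a b j)
  show ?case unfolding hy[OF lowering.prems lowering(2)] model_hy[OF lowering.prems]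
    using lowering by (intro hwpair_diff hwpair.scale hwpair.lowering)
qed

lemma hwpair_x: "hwpair a b \<Longrightarrow> i \<in> {1..n} \<Longrightarrow> hwpair (x i a) (mX i b)"
proof (induction rule: hwpair.induct)
  case base
  have "mX i (delta topv) = 0"
    unfolding model_mX[OF topv_in] using kmax_topv base col_bounds
    by (intro sum.neutral) (auto simp: kmax_def pos_def)
  then show ?case unfolding v0(2)[OF base] by (simp only: hwpair_0)
next
  case (add a b a' b')
  show ?case unfolding module_hom.add[OF x_hom[OF add.prems]] module_hom.add[OF model.x_hom[OF add.prems]]
    using add by (intro hwpair.add)
next
  case (scale a b c)
  show ?case unfolding module_hom.scale[OF x_hom[OF scale.prems]] module_hom.scale[OF model.x_hom[OF scale.prems]]
    using scale by (intro hwpair.scale)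
next
  case (lowering a b j)
  have m: "mX i (mY j b) = mY j (mX i b) + (if i = j then mH i b else 0)"
    using hwpair_supp[OF lowering(1)] lowering by (intro model_xy)
  have "hwpair (if i = j then h i a else 0) (if i = j then mH i b else 0)"
    using hwpair_0 hwpair_h[OF lowering(1) lowering.prems] by (cases "i = j") (simp_all only: simp_thms if_True if_False)
  then show ?case unfolding xy[OF lowering.prems lowering(2)] m
    using lowering by (intro hwpair.add hwpair.lowering)
qed

text \<open>Lowering gives the value 0 at \<open>topv\<close> in the model and lands in
  \<open>K\<close> in the given module. So the two components of a pair always have the same part
  along the highest weight vectors.\<close>

lemma hwpair_K: "hwpair a b \<Longrightarrow> \<exists>a'\<in>K. a = sc (b topv) v0 + a'"
proof (induction rule: hwpair.induct)
  case base
  have "0 \<in> K" unfolding K_def by (intro CollectI exI[of _ "[]"]) simp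
  then show ?case by (intro bexI[of _ 0]) (auto simp: delta_def)
next
  case (add a b a' b')
  then obtain k k' where "k \<in> K" "a = sc (b topv) v0 + k" "k' \<in> K" "a' = sc (b' topv) v0 + k'" by blast
  then show ?case by (intro bexI[of _ "k + k'"]) (auto simp: K_add scale_left_distrib)
next
  case (scale a b c)
  then obtain k where "k \<in> K" "a = sc (b topv) v0 + k" by blast
  then show ?case by (intro bexI[of _ "sc c k"]) (auto simp: K_scale scale_right_distrib fscale_def)
next
  case (lowering a b i)
  then obtain k where k: "k \<in> K" "a = sc (b topv) v0 + k" by blast
  have "mY i b topv = 0" unfolding mY_def using kmax_topv col_bounds by (auto simp: kmax_def pos_def intro!: sum.neutral)
  moreover have "y i a \<in> K" unfolding k using k lowering
    by (simp add: module_hom.add[OF y_hom] module_hom.scale[OF y_hom] K_add K_scale K_y K_y_v0)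
  ultimately show ?case by (intro bexI[of _ "y i a"]) auto
qed

text \<open>A nonzero fibre over 0 is stable under raising and contains a singular vector, whose
  value at \<open>topv\<close> is nonzero. By \<open>hwpair_K\<close> a nonzero multiple of
  \<open>v0\<close> would then lie in \<open>K\<close>. Knowledge of the singular vectors thus takes
  the place of irreducibility of the model.\<close>

lemma hwpair_fst_zero: assumes "hwpair 0 b" shows "b = 0"
proof (rule ccontr)
  assume "b \<noteq> 0"
  have rep: "f = model.E f" if "hwpair a f" for a f
    using hwpair_supp[OF that] by (auto simp: model.E_def delta_sum fun_eq_iff)
  have "\<exists>b'\<in>{b. hwpair 0 b}. b' \<noteq> 0 \<and> (\<forall>i\<in>{1..n}. mX i b' = 0)"
  proof (rule model.singular_exists[of _ n b])
    show "{b. hwpair 0 b} \<subseteq> fun_space.span (delta ` V)"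
    proof
      fix f assume "f \<in> {b. hwpair 0 b}"
      then have f: "hwpair 0 f" by simp
      have "model.E f \<in> fun_space.span (delta ` V)"
        unfolding model.E_def by (rule fun_space.family_span_in) auto
      then show "f \<in> fun_space.span (delta ` V)" by (subst rep[OF f])
    qed
    show "mX i f \<in> {b. hwpair 0 b}" if "i \<in> {1..n}" "f \<in> {b. hwpair 0 b}" for i f
      using hwpair_x[of 0 f i] that module_hom.zero[OF x_hom] by simp
  qed (use assms \<open>b \<noteq> 0\<close> in auto)
  then obtain b' where b': "hwpair 0 b'" "b' \<noteq> 0" "\<And>i. i \<in> {1..n} \<Longrightarrow> mX i b' = 0" by blast
  have "c = topv" if "c \<in> V" "b' c \<noteq> 0" for c
  proof (rule kmax_unique[OF that(1) _ topv_in kmax_topv agree_n])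
    show "kmax n c" by (rule model.singular_support[of n b']) (use b' rep[OF b'(1)] that in auto)
  qed
  then have z: "b' c = 0" if "b' topv = 0" for c
    using that hwpair_supp[OF b'(1), of c] by (cases "c \<in> V") auto
  have "b' topv \<noteq> 0"
  proof
    assume "b' topv = 0"
    from z[OF this] have "b' = 0" by (intro ext) simp
    with b'(2) show False by simp
  qed
  moreover obtain k where k: "k \<in> K" "0 = sc (b' topv) v0 + k" using hwpair_K[OF b'(1)] by blast
  ultimately have "sc (b' topv) v0 \<notin> K" by (intro v0_notin_K)
  moreover have "sc (b' topv) v0 = sc (-1) k" using k(2) by (simp add: eq_neg_iff_add_eq_0)
  ultimately show False using K_scale[OF k(1)] by metis
qed

lemma submodule_cases:
  assumes "subspace U" "\<And>i a. i \<in> {1..n} \<Longrightarrow> a \<in> U \<Longrightarrow> x i a \<in> U \<and> y i a \<in> U \<and> h i a \<in> U"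
  shows "U = {0} \<or> U = UNIV"
proof -
  have "invariant_under {1..n} x y h U"
    unfolding invariant_under_def image_subset_iff using assms(2) by (intro ballI conjI) simp_all
  with irr[unfolded irreducible_sub_def, THEN conjunct2, THEN conjunct2, THEN conjunct2, THEN spec, of U]
  show ?thesis using assms(1) by simp
qed

text \<open>On this side irreducibility of the given module applies: the fibre is a submodule, and
  it is proper because \<open>v0\<close> is not in \<open>K\<close>.\<close>

lemma hwpair_snd_zero: assumes "hwpair a 0" shows "a = 0"
proof -
  let ?U = "{a. hwpair a 0}"
  have "?U = {0} \<or> ?U = UNIV"
  proof (rule submodule_cases)
    show "subspace ?U"
      unfolding subspace_def using hwpair_0 hwpair.add[of _ 0 _ 0] hwpair.scale[of _ 0] by auto
    fix i a assume "i \<in> {1..n}" "a \<in> ?U"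
    then show "x i a \<in> ?U \<and> y i a \<in> ?U \<and> h i a \<in> ?U"
      using hwpair_x[of a 0 i] hwpair.lowering[of a 0 i] hwpair_h[of a 0 i]
        module_hom.zero[OF model.x_hom] module_hom.zero[OF model.y_hom] module_hom.zero[OF model.h_hom] by simp
  qed
  moreover have "\<not> hwpair v0 0"
  proof
    assume "hwpair v0 0"
    from hwpair_K[OF this] have "v0 \<in> K" by simp
    then show False using v0_notin_K[of 1] by simp
  qed
  ultimately show ?thesis using assms by blast
qed

lemma hwpair_total: "\<exists>b. hwpair a b"
proof -
  let ?U = "{a. \<exists>b. hwpair a b}"
  have "?U = {0} \<or> ?U = UNIV"
  proof (rule submodule_cases)
    show "subspace ?U" unfolding subspace_def using hwpair_0 hwpair.add hwpair.scale by blast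
  qed (use hwpair_x hwpair.lowering hwpair_h in blast)
  moreover have "v0 \<in> ?U" using hwpair.base by blast
  ultimately show ?thesis using v0(1) by blast
qed

lemma hwpair_delta: assumes "c \<in> V" shows "\<exists>a. hwpair a (delta c)"
proof -
  let ?U = "{b. \<exists>a. hwpair a b}"
  have "delta c \<in> ?U"
  proof (rule model.lowering_generates[OF _ _ order_refl topv_in kmax_topv _ assms agree_n])
    show "fun_space.subspace ?U" unfolding fun_space.subspace_def using hwpair_0 hwpair.add hwpair.scale by blast
    show "mY i b \<in> ?U" if "i \<in> {1..n}" "b \<in> ?U" for i b using that hwpair.lowering by blast
    show "delta topv \<in> ?U" using hwpair.base by blast
  qed
  then show ?thesis by simp
qed

lemma hwpair_unique: "hwpair a b \<Longrightarrow> hwpair a' b \<Longrightarrow> a = a'"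
  using hwpair_snd_zero[of "a - a'"] hwpair_diff[of a b a' b] by simp

definition gv :: "array \<Rightarrow> 'v" where "gv c = (SOME a. hwpair a (delta c))"

lemma hwpair_gv: "c \<in> V \<Longrightarrow> hwpair (gv c) (delta c)"
  unfolding gv_def using hwpair_delta by (rule someI_ex)

lemma hwpair_comb: "A \<subseteq> V \<Longrightarrow> hwpair (\<Sum>c\<in>A. sc (u c) (gv c)) (\<Sum>c\<in>A. fscale (u c) (delta c))"
  by (intro hwpair_sum hwpair.scale hwpair_gv) auto

text \<open>The relation is single-valued in both directions and compatible with all generators.
  Hence the vectors paired with the functions \<open>delta c\<close> inherit the formulas of the
  model.\<close>

theorem gt_basis_exists: "gt_irrep N m n bcol sc x y h gv"
proof (intro gt_irrep.intro gt_module.intro gt_module_axioms.intro gt_irrep_axioms.intro)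
  show "tri_pattern N n bcol" by (rule tri_pattern_axioms)
  show "vector_space sc" by (rule vector_space_axioms)
  show inj: "inj_on gv V"
  proof (rule inj_onI)
    fix c d assume cd: "c \<in> V" "d \<in> V" "gv c = gv d"
    have "hwpair 0 (delta c - delta d)"
      using hwpair_diff[OF hwpair_gv[OF cd(1)] hwpair_gv[OF cd(2)]] cd(3) by simp
    from hwpair_fst_zero[OF this] have "delta c = delta d" by (simp only: right_minus_eq)
    then show "c = d" using inj_delta by (simp add: inj_eq)
  qed
  show "independent (gv ` V)"
  proof
    assume "dependent (gv ` V)"
    then obtain u where u: "\<exists>v\<in>gv ` V. u v \<noteq> 0" "(\<Sum>v\<in>gv ` V. sc (u v) v) = 0"
      by (auto simp: dependent_finite)
    have "(\<Sum>c\<in>V. sc (u (gv c)) (gv c)) = 0" using u(2) by (simp add: sum.reindex[OF inj])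
    then have "hwpair 0 (\<Sum>c\<in>V. fscale (u (gv c)) (delta c))"
      using hwpair_comb[OF order_refl, of "\<lambda>c. u (gv c)"] by simp
    then have z: "(\<Sum>c\<in>V. fscale (u (gv c)) (delta c)) = 0" by (rule hwpair_fst_zero)
    have "u (gv c) = 0" if "c \<in> V" for c
      using delta_sum[OF finite_verts, of "\<lambda>c. u (gv c)" c] that z by simp
    with u(1) show False by auto
  qed
  show "x i (gv c) = (\<Sum>p\<in>pos i. if raise c p \<in> V then sc (cP c p) (gv (raise c p)) else 0)"
    if "i \<in> {1..n}" "c \<in> V" for i c
  proof (rule hwpair_unique)
    show "hwpair (x i (gv c)) (mX i (delta c))" using that by (intro hwpair_x hwpair_gv)
    show "hwpair (\<Sum>p\<in>pos i. if raise c p \<in> V then sc (cP c p) (gv (raise c p)) else 0) (mX i (delta c))"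
      unfolding model_mX[OF that(2)] by (rule hwpair_sum) (auto intro: hwpair.scale hwpair_gv hwpair_0)
  qed
  show "y i (gv c) = (\<Sum>p\<in>pos i. if c p > 0 \<and> lower c p \<in> V then sc (cQ (lower c p) p) (gv (lower c p)) else 0)"
    if "i \<in> {1..n}" "c \<in> V" for i c
  proof (rule hwpair_unique)
    show "hwpair (y i (gv c)) (mY i (delta c))" using that by (intro hwpair.lowering hwpair_gv)
    show "hwpair (\<Sum>p\<in>pos i. if c p > 0 \<and> lower c p \<in> V then sc (cQ (lower c p) p) (gv (lower c p)) else 0) (mY i (delta c))"
      unfolding model_mY[OF that(2)] by (rule hwpair_sum) (auto intro: hwpair.scale hwpair_gv hwpair_0)
  qed
  show "h i (gv c) = sc (of_int (wt i c)) (gv c)" if "i \<in> {1..n}" "c \<in> V" for i c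
  proof (rule hwpair_unique)
    show "hwpair (h i (gv c)) (mH i (delta c))" using that by (intro hwpair_h hwpair_gv)
    show "hwpair (sc (of_int (wt i c)) (gv c)) (mH i (delta c))"
      unfolding model.h_e[OF that] using that by (intro hwpair.scale hwpair_gv)
  qed
  have "a \<in> span (gv ` V)" for a
  proof -
    obtain b where b: "hwpair a b" using hwpair_total by blast
    have "b = (\<Sum>c\<in>V. fscale (b c) (delta c))" using hwpair_supp[OF b] by (auto simp: delta_sum fun_eq_iff)
    then have "a = (\<Sum>c\<in>V. sc (b c) (gv c))" using hwpair_unique[OF b] hwpair_comb[OF order_refl, of b] by simp
    then show ?thesis by (auto intro: span_sum span_scale span_base)
  qed
  then show "span (gv ` V) = UNIV" by blast
qed (use x_hom y_hom h_hom hx hy in auto)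

end

section \<open>The posets of type B and D\<close>

context gt_irrep
begin

section \<open>Transfer along an identification of a colored graph with the patterns\<close>

context
  fixes G :: "'a cgraph" and \<psi> :: "'a \<Rightarrow> array"
  assumes \<psi>: "bij_betw \<psi> (fst G) (vertsB N m)"
    and \<psi>_edges: "\<And>s t i. s \<in> fst G \<Longrightarrow> t \<in> fst G \<Longrightarrow> (s, i, t) \<in> snd G \<longleftrightarrow> (\<psi> s, i, \<psi> t) \<in> edges"
begin

lemma iso_to_patterns:
  assumes "cgraph_iso (supp_graph sc n x y R v) G"
  obtains f where "bij_betw f R V"
    "\<And>s i t. s \<in> R \<Longrightarrow> t \<in> R \<Longrightarrow> (s, i, t) \<in> supp_edges sc n x y R v \<longleftrightarrow> (f s, i, f t) \<in> edges"
proof -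
  obtain f where f: "bij_betw f R (fst G)"
    "\<And>s i t. s \<in> R \<Longrightarrow> t \<in> R \<Longrightarrow> (s, i, t) \<in> supp_edges sc n x y R v \<longleftrightarrow> (f s, i, f t) \<in> snd G"
    using assms by (auto simp: cgraph_iso_def supp_graph_def)
  have "bij_betw (\<psi> \<circ> f) R V" using f(1) \<psi> by (rule bij_betw_trans)
  moreover have "f s \<in> fst G" if "s \<in> R" for s using f(1) that by (auto simp: bij_betw_def)
  ultimately show ?thesis using that[of "\<psi> \<circ> f"] f(2) \<psi>_edges by simp
qed

lemma subgraph_scaled:
  assumes wb: "weight_basis sc n h R w" and f: "bij_betw f R V"
    and sub: "\<And>s i t. (s, i, t) \<in> supp_edges sc n x y R w \<Longrightarrow> (f s, i, f t) \<in> edges"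
  obtains a where "\<And>r. r \<in> R \<Longrightarrow> a r \<noteq> 0 \<and> w r = sc (a r) (e (f r))"
proof -
  have "\<forall>r\<in>R. \<exists>a. a \<noteq> 0 \<and> w r = sc a (e (f r))" using subgraph_basis[OF wb f sub] by blast
  then show ?thesis using that by metis
qed

lemma supp_edges_mem: "(s, i, t) \<in> supp_edges sc n x y R v \<Longrightarrow> s \<in> R \<and> t \<in> R"
  by (simp add: supp_edges_def)

lemma iso_scaled:
  assumes wb: "weight_basis sc n h R v" and iso: "cgraph_iso (supp_graph sc n x y R v) G"
  obtains f a where "bij_betw f R V" "\<And>r. r \<in> R \<Longrightarrow> a r \<noteq> 0 \<and> v r = sc (a r) (e (f r))"
    "\<And>s i t. (s, i, t) \<in> supp_edges sc n x y R v \<Longrightarrow> (f s, i, f t) \<in> edges"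
proof -
  obtain f where f: "bij_betw f R V"
    "\<And>s i t. s \<in> R \<Longrightarrow> t \<in> R \<Longrightarrow> (s, i, t) \<in> supp_edges sc n x y R v \<longleftrightarrow> (f s, i, f t) \<in> edges"
    using iso_to_patterns[OF iso] by blast
  have sub: "(f s, i, f t) \<in> edges" if "(s, i, t) \<in> supp_edges sc n x y R v" for s i t
    using supp_edges_mem[OF that] f(2) that by blast
  obtain a where a: "\<And>r. r \<in> R \<Longrightarrow> a r \<noteq> 0 \<and> v r = sc (a r) (e (f r))"
    using subgraph_scaled[OF wb f(1) sub] by blast
  show ?thesis by (rule that[OF f(1) a sub])
qed

lemma patterns_support:
  assumes G: "snd G \<subseteq> fst G \<times> UNIV \<times> fst G"
  shows "\<exists>v. weight_basis sc n h (fst G) v \<and> supp_graph sc n x y (fst G) v = G"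
proof -
  have im: "(e \<circ> \<psi>) ` fst G = e ` V" using \<psi> unfolding image_comp[symmetric] by (simp add: bij_betw_def)
  have wb: "weight_basis sc n h (fst G) (e \<circ> \<psi>)"
    unfolding weight_basis_def im
  proof (intro conjI ballI)
    show "inj_on (e \<circ> \<psi>) (fst G)" using \<psi> e_inj by (auto simp: bij_betw_def intro: comp_inj_on)
    show "independent (e ` V)" by (rule e_ind)
    show "span (e ` V) = UNIV" by (rule e_span)
    fix r i assume "r \<in> fst G" "i \<in> {1..n}"
    then show "\<exists>c. h i ((e \<circ> \<psi>) r) = sc c ((e \<circ> \<psi>) r)"
      using h_e[of i "\<psi> r"] \<psi> by (auto simp: bij_betw_def)
  qed
  have "supp_edges sc n x y (fst G) (e \<circ> \<psi>) = {(s, i, t). s \<in> fst G \<and> t \<in> fst G \<and> (\<psi> s, i, \<psi> t) \<in> edges}"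
    by (rule scaled_basis_edges[OF wb \<psi>, of "\<lambda>_. 1"]) simp
  also have "\<dots> = snd G" using G \<psi>_edges by auto
  finally have "supp_graph sc n x y (fst G) (e \<circ> \<psi>) = G" by (simp add: supp_graph_def)
  with wb show ?thesis by blast
qed

lemma patterns_rigid:
  assumes wb: "weight_basis sc n h R v" and iso: "cgraph_iso (supp_graph sc n x y R v) G"
  shows "solitary sc n x y h R v" and "edge_minimal TYPE('q) sc n x y h R v"
proof -
  obtain f a where f: "bij_betw f R V"
    and a: "\<And>r. r \<in> R \<Longrightarrow> a r \<noteq> 0 \<and> v r = sc (a r) (e (f r))"
    and sub: "\<And>s i t. (s, i, t) \<in> supp_edges sc n x y R v \<Longrightarrow> (f s, i, f t) \<in> edges"
    using iso_scaled[OF wb iso] by blast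
  show "solitary sc n x y h R v"
    unfolding solitary_def
  proof (intro allI impI ballI)
    fix w r assume w: "weight_basis sc n h R w \<and> supp_edges sc n x y R w = supp_edges sc n x y R v" and r: "r \<in> R"
    have "\<exists>b. b \<noteq> 0 \<and> w r = sc b (e (f r))"
      by (rule subgraph_basis[OF _ f _ r]) (use w sub in auto)
    then obtain b where b: "b \<noteq> 0" "w r = sc b (e (f r))" by blast
    then have "w r = sc (b / a r) (v r)" "b / a r \<noteq> 0" using a[OF r] by auto
    then show "\<exists>c. c \<noteq> 0 \<and> w r = sc c (v r)" by blast
  qed
  show "edge_minimal TYPE('q) sc n x y h R v"
    unfolding edge_minimal_def
  proof (intro notI, elim exE conjE)
    fix R' :: "'q set" and w D
    assume wb': "weight_basis sc n h R' w" and D: "D \<subseteq> supp_edges sc n x y R v" "D \<noteq> {}"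
      and iso': "cgraph_iso (supp_graph sc n x y R' w) (R, supp_edges sc n x y R v - D)"
    obtain g where g: "bij_betw g R' R"
      "\<And>s i t. s \<in> R' \<Longrightarrow> t \<in> R' \<Longrightarrow> (s, i, t) \<in> supp_edges sc n x y R' w \<longleftrightarrow> (g s, i, g t) \<in> supp_edges sc n x y R v - D"
      using iso' by (auto simp: cgraph_iso_def supp_graph_def)
    have fg: "bij_betw (f \<circ> g) R' V" using g(1) f by (rule bij_betw_trans)
    have sub': "((f \<circ> g) s, i, (f \<circ> g) t) \<in> edges" if "(s, i, t) \<in> supp_edges sc n x y R' w" for s i t
      using supp_edges_mem[OF that] g(2)[of s t i] that sub by simp
    obtain b where b: "\<And>r. r \<in> R' \<Longrightarrow> b r \<noteq> 0 \<and> w r = sc (b r) (e ((f \<circ> g) r))"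
      using subgraph_scaled[OF wb' fg sub'] by blast
    \<comment> \<open>The basis with fewer edges is again a rescaled Gelfand-Tsetlin basis and
      therefore has all edges, including those supposedly deleted.\<close>
    have E: "supp_edges sc n x y R' w = {(s, i, t). s \<in> R' \<and> t \<in> R' \<and> ((f \<circ> g) s, i, (f \<circ> g) t) \<in> edges}"
      by (rule scaled_basis_edges[OF wb' fg]) (rule b)
    obtain s i t where d: "(s, i, t) \<in> D" using D(2) by auto
    then have dv: "(s, i, t) \<in> supp_edges sc n x y R v" using D(1) by blast
    then have R: "s \<in> R" "t \<in> R" "(f s, i, f t) \<in> edges" using sub[OF dv] supp_edges_mem[OF dv] by simp_all
    obtain s' t' where st: "s' \<in> R'" "t' \<in> R'" "g s' = s" "g t' = t" using g(1) R by (metis bij_betw_def imageE)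
    then have "(s', i, t') \<in> supp_edges sc n x y R' w" unfolding E using R by simp
    then show False using g(2)[OF st(1,2)] st d by simp
  qed
qed

lemma restricts_iff_patterns:
  assumes wb: "weight_basis sc n h R v"
  shows "restricts_irreducibly sc n x y h R v \<longleftrightarrow> cgraph_iso (supp_graph sc n x y R v) G"
proof
  assume "restricts_irreducibly sc n x y h R v"
  from irreducible_basis[OF wb this] obtain g a where g: "bij_betw g R V"
    and a: "\<And>r. r \<in> R \<Longrightarrow> a r \<noteq> 0 \<and> v r = sc (a r) (e (g r))" by blast
  have E: "supp_edges sc n x y R v = {(s, i, t). s \<in> R \<and> t \<in> R \<and> (g s, i, g t) \<in> edges}"
    by (rule scaled_basis_edges[OF wb g]) (rule a)
  define f where "f = the_inv_into (fst G) \<psi> \<circ> g"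
  have f: "bij_betw f R (fst G)"
    unfolding f_def by (rule bij_betw_trans[OF g bij_betw_the_inv_into[OF \<psi>]])
  have gV: "g r \<in> V" if "r \<in> R" for r using g that by (auto simp: bij_betw_def)
  have "\<psi> (f r) = g r" if "r \<in> R" for r
    unfolding f_def using gV[OF that] \<psi> by (simp add: bij_betw_def f_the_inv_into_f)
  moreover have "f r \<in> fst G" if "r \<in> R" for r using f that by (auto simp: bij_betw_def)
  ultimately have "(s, i, t) \<in> supp_edges sc n x y R v \<longleftrightarrow> (f s, i, f t) \<in> snd G" if "s \<in> R" "t \<in> R" for s i t
    unfolding E using \<psi>_edges that by simp
  with f show "cgraph_iso (supp_graph sc n x y R v) G"
    by (auto simp: cgraph_iso_def supp_graph_def)
next
  assume iso: "cgraph_iso (supp_graph sc n x y R v) G"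
  obtain f a where f: "bij_betw f R V"
    and a: "\<And>r. r \<in> R \<Longrightarrow> a r \<noteq> 0 \<and> v r = sc (a r) (e (f r))"
    and sub: "\<And>s i t. (s, i, t) \<in> supp_edges sc n x y R v \<Longrightarrow> (f s, i, f t) \<in> edges"
    using iso_scaled[OF wb iso] by blast
  show "restricts_irreducibly sc n x y h R v"
    by (rule scaled_basis_irreducible[OF wb f]) (rule a)
qed

end
end

section \<open>Identification of the three posets with triangular patterns\<close>

context tri_pattern
begin

lemma LB_edges:
  assumes "n = N"
  shows "snd (LB N m) = edges" "fst (LB N m) = V"
proof -
  have "col p = fst p" if "p \<in> I" for p
    using min_col[OF that] col_bounds[OF that] assms by simp
  then show "snd (LB N m) = edges"
    by (force simp: LB_def cover_edges_def edges_def raise_def)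
qed (simp add: LB_def)

text \<open>The passage from the arrays \<open>g\<close> to the arrays \<open>c\<close> of type D as
  a map of positions; it splits the last triangular row by the parity of the column.\<close>

definition posD :: "nat \<times> nat \<Rightarrow> nat \<times> nat" where
  "posD p = (if fst p < N then p else if odd (snd p) then (N, (snd p + 1) div 2) else (N + 1, snd p div 2))"

definition unfoldD :: "array \<Rightarrow> array" where
  "unfoldD c p = (if p \<in> I then c (posD p) else 0)"

lemma posD_bij: "bij_betw posD I (idxD (N + 1))"
proof (rule bij_betw_byWitness[where f' = "\<lambda>p. if fst p < N then p else if fst p = N then (N, 2 * snd p - 1) else (N, 2 * snd p)"])
  show "\<forall>a\<in>I. (if fst (posD a) < N then posD a else if fst (posD a) = N then (N, 2 * snd (posD a) - 1) else (N, 2 * snd (posD a))) = a"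
    by (auto simp: posD_def idxB_def elim!: oddE evenE)
  show "\<forall>a'\<in>idxD (N + 1). posD (if fst a' < N then a' else if fst a' = N then (N, 2 * snd a' - 1) else (N, 2 * snd a')) = a'"
    using N3 by (auto simp: posD_def idxD_def)
  show "posD ` I \<subseteq> idxD (N + 1)"
    using N3 by (auto simp: posD_def idxD_def idxB_def elim!: oddE evenE)
  show "(\<lambda>p. if fst p < N then p else if fst p = N then (N, 2 * snd p - 1) else (N, 2 * snd p)) ` idxD (N + 1) \<subseteq> I"
    using N3 by (auto simp: idxD_def idxB_def)
qed

lemma vertsD_iff: "c \<in> vertsD (N + 1) m \<longleftrightarrow> (\<forall>p. p \<notin> idxD (N + 1) \<longrightarrow> c p = 0) \<and> unfoldD c \<in> V"
proof -
  have g: "gD (N + 1) c (p, q) = unfoldD c (p, q)" if "1 \<le> q" "q \<le> p" "p \<le> N" for p q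
    using that N3 by (auto simp: gD_def unfoldD_def posD_def idx_iff)
  have "unfoldD c p = 0" if "p \<notin> I" for p using that by (simp add: unfoldD_def)
  then have "unfoldD c \<in> V \<longleftrightarrow> unfoldD c (N, N) \<le> m \<and> (\<forall>p q. 1 \<le> q \<and> q \<le> p \<and> p \<le> N - 1 \<longrightarrow>
      unfoldD c (p + 1, q) \<le> unfoldD c (p, q) \<and> unfoldD c (p, q) \<le> unfoldD c (p + 1, q + 1))"
    by (auto simp: vertsB_def)
  also have "\<dots> \<longleftrightarrow> gD (N + 1) c (N, N) \<le> m \<and> (\<forall>p q. 1 \<le> q \<and> q \<le> p \<and> p \<le> N - 1 \<longrightarrow>
      gD (N + 1) c (p + 1, q) \<le> gD (N + 1) c (p, q) \<and> gD (N + 1) c (p, q) \<le> gD (N + 1) c (p + 1, q + 1))"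
  proof -
    have "gD (N + 1) c (N, N) = unfoldD c (N, N)" using g N3 by simp
    moreover have "gD (N + 1) c (p + 1, q) = unfoldD c (p + 1, q) \<and> gD (N + 1) c (p, q) = unfoldD c (p, q) \<and>
        gD (N + 1) c (p + 1, q + 1) = unfoldD c (p + 1, q + 1)" if "1 \<le> q \<and> q \<le> p \<and> p \<le> N - 1" for p q
      using g[of q "p + 1"] g[of q p] g[of "q + 1" "p + 1"] that N3 by auto
    ultimately show ?thesis by auto
  qed
  finally show ?thesis by (simp add: vertsD_def)
qed

lemma vertsD_out: "c \<in> vertsD (N + 1) m \<Longrightarrow> p \<notin> idxD (N + 1) \<Longrightarrow> c p = 0"
  unfolding vertsD_iff by blast

lemma unfoldD_bij: "bij_betw unfoldD (vertsD (N + 1) m) V"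
proof (rule bij_betwI')
  fix c d assume cd: "c \<in> vertsD (N + 1) m" "d \<in> vertsD (N + 1) m"
  show "unfoldD c = unfoldD d \<longleftrightarrow> c = d"
  proof
    assume e: "unfoldD c = unfoldD d"
    show "c = d"
    proof
      fix p show "c p = d p"
      proof (cases "p \<in> idxD (N + 1)")
        case True
        then obtain q where "q \<in> I" "posD q = p" using posD_bij by (metis bij_betw_def imageE)
        then show ?thesis using fun_cong[OF e, of q] by (simp add: unfoldD_def)
      next
        case False
        then show ?thesis using vertsD_out[OF cd(1)] vertsD_out[OF cd(2)] by metis
      qed
    qed
  qed simp
next
  show "c \<in> vertsD (N + 1) m \<Longrightarrow> unfoldD c \<in> V" for c unfolding vertsD_iff by blast
next
  fix d assume d: "d \<in> V"
  define c where "c = (\<lambda>p. if p \<in> idxD (N + 1) then d (the_inv_into I posD p) else 0)"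
  have "unfoldD c p = d p" for p
  proof (cases "p \<in> I")
    case True
    then have "posD p \<in> idxD (N + 1)" "the_inv_into I posD (posD p) = p"
      using posD_bij by (auto simp: bij_betw_def the_inv_into_f_f)
    then show ?thesis using True by (simp add: unfoldD_def c_def)
  qed (use d vert_out in \<open>auto simp: unfoldD_def\<close>)
  then have "unfoldD c = d" by (rule ext)
  moreover have "c \<in> vertsD (N + 1) m"
    unfolding vertsD_iff \<open>unfoldD c = d\<close> using d by (simp add: c_def)
  ultimately show "\<exists>c\<in>vertsD (N + 1) m. d = unfoldD c" by metis
qed

text \<open>Colors belong to rows in the arrays of type D but to parities in the last triangular
  row. The parameter \<open>colD\<close> absorbs the interchange of the last two colors, so both
  posets are covered.\<close>

lemma unfoldD_edges:
  assumes s: "s \<in> vertsD (N + 1) m" and t: "t \<in> vertsD (N + 1) m"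
    and c: "\<And>p. p \<in> I \<Longrightarrow> colD (fst (posD p)) = col p"
  shows "(s, i, t) \<in> cover_edges (vertsD (N + 1) m) (idxD (N + 1)) colD \<longleftrightarrow> (unfoldD s, i, unfoldD t) \<in> edges"
proof -
  have step: "t = s(posD p := s (posD p) + 1) \<longleftrightarrow> unfoldD t = raise (unfoldD s) p" if p: "p \<in> I" for p
  proof
    assume e: "t = s(posD p := s (posD p) + 1)"
    show "unfoldD t = raise (unfoldD s) p"
    proof
      fix q
      have "q \<in> I \<Longrightarrow> posD q = posD p \<longleftrightarrow> q = p" using posD_bij p by (auto simp: bij_betw_def inj_on_def)
      then show "unfoldD t q = raise (unfoldD s) p q" using p by (auto simp: e unfoldD_def raise_apply)
    qed
  next
    assume e: "unfoldD t = raise (unfoldD s) p"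
    show "t = s(posD p := s (posD p) + 1)"
    proof
      fix r show "t r = (s(posD p := s (posD p) + 1)) r"
      proof (cases "r \<in> idxD (N + 1)")
        case True
        then obtain q where q: "q \<in> I" "posD q = r" using posD_bij by (metis bij_betw_def imageE)
        have "posD q = posD p \<longleftrightarrow> q = p" using posD_bij p q by (auto simp: bij_betw_def inj_on_def)
        then show ?thesis using fun_cong[OF e, of q] q p by (auto simp: unfoldD_def raise_apply)
      next
        case False
        then have "r \<noteq> posD p" using posD_bij p by (auto simp: bij_betw_def)
        then show ?thesis using vertsD_out[OF s False] vertsD_out[OF t False] by simp
      qed
    qed
  qed
  have "(s, i, t) \<in> cover_edges (vertsD (N + 1) m) (idxD (N + 1)) colD \<longleftrightarrow>
      (\<exists>r\<in>idxD (N + 1). t = s(r := s r + 1) \<and> i = colD (fst r))"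
    using s t unfolding cover_edges_def by (simp only: mem_Collect_eq case_prod_conv Bex_def split_paired_Ex fst_conv simp_thms)
  also have "\<dots> \<longleftrightarrow> (\<exists>p\<in>I. t = s(posD p := s (posD p) + 1) \<and> i = colD (fst (posD p)))"
    unfolding bij_betw_imp_surj_on[OF posD_bij, symmetric] by blast
  also have "\<dots> \<longleftrightarrow> (\<exists>p\<in>I. unfoldD t = raise (unfoldD s) p \<and> i = col p)"
    using step c by auto
  also have "\<dots> \<longleftrightarrow> (unfoldD s, i, unfoldD t) \<in> edges"
    using s t unfolding edges_def vertsD_iff by blast
  finally show ?thesis .
qed

lemma hw_module_of_irr:
  fixes sc :: "complex \<Rightarrow> 'v::ab_group_add \<Rightarrow> 'v"
  assumes hw: "irr_highest_weight sc ltype n x y h lam"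
    and lam: "\<And>i. i \<in> {1..n} \<Longrightarrow> lam i = (if i = bcol True then int m else 0)"
  shows "\<exists>v0. hw_module N m n bcol sc x y h v0"
proof -
  obtain v0 where v0: "v0 \<noteq> 0" "\<And>i. i \<in> {1..n} \<Longrightarrow> x i v0 = 0 \<and> h i v0 = sc (of_int (lam i)) v0"
    using hw by (auto simp: irr_highest_weight_def)
  have rep: "is_rep sc ltype n x y h" and irr: "irreducible_sub sc {1..n} x y h UNIV"
    using hw by (auto simp: irr_highest_weight_def)
  have lin: "Vector_Spaces.linear sc sc (x i)" "Vector_Spaces.linear sc sc (y i)" "Vector_Spaces.linear sc sc (h i)"
    if "i \<in> {1..n}" for i
    using rep that unfolding is_rep_def by blast+
  have rel: "comm_op (h i) (h j) = (\<lambda>v. 0)"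
      "comm_op (h i) (x j) = (\<lambda>v. sc (of_int (cartan ltype n i j)) (x j v))"
      "comm_op (h i) (y j) = (\<lambda>v. sc (- of_int (cartan ltype n i j)) (y j v))"
      "comm_op (x i) (y j) = (if i = j then h i else (\<lambda>v. 0))"
    if "i \<in> {1..n}" "j \<in> {1..n}" for i j
    using rep that unfolding is_rep_def by blast+
  have vs: "vector_space sc" using rep unfolding is_rep_def by blast
  have "hw_module N m n bcol sc x y h v0"
  proof (intro hw_module.intro hw_module_axioms.intro)
    fix i j v assume ij: "i \<in> {1..n}" "j \<in> {1..n}"
    show "h i (h j v) = h j (h i v)"
      using fun_cong[OF rel(1)[OF ij], of v] by (simp add: comm_op_def)
    show "h i (x j v) = x j (h i v) + sc (of_int (cartan ltype n i j)) (x j v)"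
      using fun_cong[OF rel(2)[OF ij], of v] by (simp add: comm_op_def algebra_simps)
    show "h i (y j v) = y j (h i v) - sc (of_int (cartan ltype n i j)) (y j v)"
      using fun_cong[OF rel(3)[OF ij], of v] vector_space.vector_space_assms(1)[OF vs]
        module.scale_minus_left[OF module_iff_vector_space[THEN iffD2, OF vs]]
      by (simp add: comm_op_def algebra_simps)
    show "x i (y j v) = y j (x i v) + (if i = j then h i v else 0)"
      using fun_cong[OF rel(4)[OF ij], of v] by (auto simp: comm_op_def algebra_simps)
  qed (use tri_pattern_axioms vs lin irr v0 lam wt_topv in \<open>auto simp: module_hom_iff_linear\<close>)
  then show ?thesis by blast
qed

end

theorem theorem8p4:
  fixes sc :: "complex \<Rightarrow> 'v::ab_group_add \<Rightarrow> 'v"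
    and x y h :: "nat \<Rightarrow> 'v \<Rightarrow> 'v"
    and X :: lie_type and n m :: nat and L :: "array cgraph" and lam :: "nat \<Rightarrow> int"
  assumes "m \<ge> 1"
    and "(X = TypeB \<and> n \<ge> 3 \<and> L = LB n m \<and> lam = (\<lambda>i. int m * fund_weight n i))
       \<or> (X = TypeD \<and> n \<ge> 4 \<and> L = LD1 n m \<and> lam = (\<lambda>i. int m * fund_weight (n - 1) i))
       \<or> (X = TypeD \<and> n \<ge> 4 \<and> L = LD2 n m \<and> lam = (\<lambda>i. int m * fund_weight n i))"
    and "irr_highest_weight sc X n x y h lam"
  shows "(\<exists>v. weight_basis sc n h (fst L) v \<and> supp_graph sc n x y (fst L) v = L)
    \<and> (\<forall>(R::'r set) v. weight_basis sc n h R v \<and> cgraph_iso (supp_graph sc n x y R v) L \<longrightarrow>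
          solitary sc n x y h R v \<and> edge_minimal TYPE('q) sc n x y h R v)
    \<and> (\<forall>(R::'r set) v. weight_basis sc n h R v \<longrightarrow>
          (restricts_irreducibly sc n x y h R v \<longleftrightarrow> cgraph_iso (supp_graph sc n x y R v) L))"
proof -
  have "\<exists>N bcol \<psi>. tri_pattern N n bcol \<and> tri_pattern.ltype N n = X
     \<and> (\<forall>i\<in>{1..n}. lam i = (if i = bcol True then int m else 0))
     \<and> bij_betw \<psi> (fst L) (vertsB N m) \<and> snd L \<subseteq> fst L \<times> UNIV \<times> fst L
     \<and> (\<forall>s\<in>fst L. \<forall>t\<in>fst L. \<forall>i. (s, i, t) \<in> snd L \<longleftrightarrow> (\<psi> s, i, \<psi> t) \<in> tri_pattern.edges N m bcol)"
    using assms(2)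
  proof (elim disjE conjE)
    assume a: "X = TypeB" "n \<ge> 3" "L = LB n m" "lam = (\<lambda>i. int m * fund_weight n i)"
    interpret tri_pattern n m n "\<lambda>_. n" by unfold_locales (use a in auto)
    show ?thesis
    proof (rule exI[of _ n], rule exI[of _ "\<lambda>_. n"], rule exI[of _ id], intro conjI ballI allI)
      show "bij_betw id (fst L) (vertsB n m)" unfolding a(3) LB_edges(2)[OF refl] by simp
      show "snd L \<subseteq> fst L \<times> UNIV \<times> fst L" by (auto simp: a LB_def cover_edges_def)
      show "(s, i, t) \<in> snd L \<longleftrightarrow> (id s, i, id t) \<in> edges" for s t i unfolding a(3) LB_edges(1)[OF refl] by simp
    qed (use a tri_pattern_axioms in \<open>auto simp: ltype_def fund_weight_def\<close>)
  next
    assume a: "X = TypeD" "n \<ge> 4" "L = LD1 n m" "lam = (\<lambda>i. int m * fund_weight (n - 1) i)"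
    define N where "N = n - 1"
    have n: "n = N + 1" using a by (simp add: N_def)
    let ?b = "\<lambda>b. if b then N else N + 1"
    interpret tri_pattern N m n ?b by unfold_locales (use a n in auto)
    have c: "id (fst (posD p)) = col p" if "p \<in> idxB N" for p
      using that by (auto simp: posD_def col_def)
    show ?thesis
    proof (rule exI[of _ N], rule exI[of _ ?b], rule exI[of _ unfoldD], intro conjI ballI allI)
      show "bij_betw unfoldD (fst L) (vertsB N m)" unfolding a n LD1_def using unfoldD_bij by simp
      show "snd L \<subseteq> fst L \<times> UNIV \<times> fst L" by (auto simp: a LD1_def cover_edges_def)
      show "ltype = X" using n a(1) unfolding ltype_def by simp
      show "(s, i, t) \<in> snd L \<longleftrightarrow> (unfoldD s, i, unfoldD t) \<in> edges" if "s \<in> fst L" "t \<in> fst L" for s t i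
        using unfoldD_edges[of s t id i] that c unfolding a n LD1_def by simp
    qed (use a n tri_pattern_axioms in \<open>auto simp: fund_weight_def\<close>)
  next
    assume a: "X = TypeD" "n \<ge> 4" "L = LD2 n m" "lam = (\<lambda>i. int m * fund_weight n i)"
    define N where "N = n - 1"
    have n: "n = N + 1" using a by (simp add: N_def)
    \<comment> \<open>The interchange puts the odd columns on color \<open>n\<close>, which is where
      \<open>wt_topv\<close> places the highest weight.\<close>
    let ?b = "\<lambda>b. if b then N + 1 else N"
    let ?c = "\<lambda>i. if i = N + 1 - 1 then N + 1 else if i = N + 1 then N + 1 - 1 else i"
    interpret tri_pattern N m n ?b by unfold_locales (use a n in auto)
    have c: "?c (fst (posD p)) = col p" if "p \<in> idxB N" for p
      using that by (auto simp: posD_def col_def)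
    show ?thesis
    proof (rule exI[of _ N], rule exI[of _ ?b], rule exI[of _ unfoldD], intro conjI ballI allI)
      show "bij_betw unfoldD (fst L) (vertsB N m)" unfolding a n LD2_def using unfoldD_bij by simp
      show "snd L \<subseteq> fst L \<times> UNIV \<times> fst L" by (auto simp: a LD2_def cover_edges_def)
      show "ltype = X" using n a(1) unfolding ltype_def by simp
      show "(s, i, t) \<in> snd L \<longleftrightarrow> (unfoldD s, i, unfoldD t) \<in> edges" if "s \<in> fst L" "t \<in> fst L" for s t i
        using unfoldD_edges[of s t ?c i] that c unfolding a n LD2_def fst_conv snd_conv by blast
    qed (use a n tri_pattern_axioms in \<open>auto simp: fund_weight_def\<close>)
  qed
  then obtain N bcol \<psi> where T: "tri_pattern N n bcol" "tri_pattern.ltype N n = X"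
    and lam: "\<And>i. i \<in> {1..n} \<Longrightarrow> lam i = (if i = bcol True then int m else 0)"
    and \<psi>: "bij_betw \<psi> (fst L) (vertsB N m)" "snd L \<subseteq> fst L \<times> UNIV \<times> fst L"
      "\<And>s t i. s \<in> fst L \<Longrightarrow> t \<in> fst L \<Longrightarrow> (s, i, t) \<in> snd L \<longleftrightarrow> (\<psi> s, i, \<psi> t) \<in> tri_pattern.edges N m bcol"
    by blast
  obtain v0 where "hw_module N m n bcol sc x y h v0"
    using tri_pattern.hw_module_of_irr[OF T(1), of sc x y h lam m] assms(3) lam T(2) by blast
  then obtain e where "gt_irrep N m n bcol sc x y h e" using hw_module.gt_basis_exists by blast
  then interpret gt_irrep N m n bcol sc x y h e .
  show ?thesis
    using patterns_support[OF \<psi>(1,3,2)] patterns_rigid[OF \<psi>(1,3)] restricts_iff_patterns[OF \<psi>(1,3)] by blast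
qed

end
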